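(* The following are equivalent over $\mathsf{RCA}_0$: (1) $\mathrm{FPT}$; (2) $\mathrm{FPT}^k$, for any fixed $k \ge 1$; (3) $\mathrm{FPT}^{<\mathbb{N}}$; (4) $\mathrm{FPT}^+$; (5) arithmetical comprehension (i.e. $\mathsf{ACA}_0$).
   Context: We work in second-order arithmetic. $\mathsf{RCA}_0$ is the subsystem with the basic arithmetical axioms (those of Peano arithmetic without induction), the $\Sigma^0_1$-induction scheme and the $\Delta^0_1$ (recursive) comprehension scheme; arithmetical comprehension is the scheme $\exists X\forall n(n\in X\leftrightarrow\varphi(n))$ for arithmetical $\varphi$ (possibly with set parameters), and $\mathsf{ACA}_0$ is $\mathsf{RCA}_0$ plus this scheme. Finite sets and finite sequences are coded by natural numbers; $\mathrm{lh}(s)$ is the length of a finite sequence $s$. A sequence of sets $\langle Y_i\rangle$ is coded by $Y \subseteq \mathbb{N}$ via $(i,v) \in Y \leftrightarrow v \in Y_i$, with $(m,n) = (m+n)^2+m$. Countable algebras: for $V \subseteq \mathbb{N}$, a countable algebra over $V$ is a sequence $\mathcal{A} = \langle A_n : n \in \mathbb{N}\rangle$ of subsets of $V$ (repetitions allowed) which contains $V$ and is closed under unions, intersections, and complements relative to $V$. $\mathcal{A}$ is atomic if for every $v \in V$ there is $k$ with $A_k = \{v\}$. Weak orders and profiles: for a finite nonempty $X \subseteq \mathbb{N}$, a weak order on $X$ is a transitive, strongly connected relation $R \subseteq X \times X$; write $x \lesssim_R y$ for $(x,y)\in R$, $x <_R y$ for $(x,y) \in R \wedge (y,x)\notin R$.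 $W$ is the finite set of (codes of) weak orders on $X$. A profile over $V,X$ is a function $f: V \to W$. For a sequence $\mathcal{F} = \langle f_i \rangle$ of profiles write $x \lesssim_{i(v)} y$ for $x \lesssim_{f_i(v)} y$ (similarly $<_{i(v)}$), and for $C \subseteq V$ write $x <_{i[C]} y$ to mean $x <_{i(v)} y$ for all $v \in C$. "$f_i = f_j$ on $\{x,y\}$" means that for all $v \in V$ and all $a,b \in \{x,y\}$, $a \lesssim_{i(v)} b \leftrightarrow a \lesssim_{j(v)} b$; "$R = R'$ on $\{x,y\}$" for weak orders is defined analogously. Uniform measurability: $\mathcal{F}$ is uniformly $\mathcal{A}$-measurable if there is $\mu : \mathbb{N} \times X \times X \to \mathbb{N}$ such that for all $n$, $x,y \in X$, $v \in V$: $x \lesssim_{n(v)} y \leftrightarrow v \in A_{\mu(n,x,y)}$. Quasi-partition embedding: a permutation of $W$ is a finite sequence $p$ such that for every $R \in W$ there is a unique $i$ with $p(i) = R$; $\mathrm{Perm}(W)$ is the set of these. A quasi-partition is a finite sequence $s$ with $\mathrm{lh}(s) \geq 1$; $\mathrm{QPart}(k)$ is the set of quasi-partitions with $\mathrm{lh}(s) \le k$. $\mathcal{A}$ is quasi-partition embedded into $\mathcal{F}$ if there is $e : \mathrm{Perm}(W) \times \mathrm{QPart}(|W|) \to \mathbb{N}$ such that for all $p,s$ and all $v \in V$: $f_{e(p,s)}(v) = p(i)$ if there is a unique $i < \mathrm{lh}(s)-1$ with $v \in A_{s(i)}$, and $f_{e(p,s)}(v) = p(\mathrm{lh}(s)-1)$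 otherwise. Countable society: $\mathcal{S} = \langle V,X,\mathcal{A},\mathcal{F}\rangle$ where $V \subseteq \mathbb{N}$ is nonempty, $X \subseteq \mathbb{N}$ is finite with $|X| \ge 3$, $\mathcal{A}$ is an atomic countable algebra over $V$, $\mathcal{F}$ is a sequence of profiles over $V,X$, $\mathcal{F}$ is uniformly $\mathcal{A}$-measurable, and $\mathcal{A}$ is quasi-partition embedded into $\mathcal{F}$. Social welfare functions: $\sigma : \mathbb{N} \to W$ is a social welfare function for $\mathcal{S}$ if (unanimity) for all $x,y \in X$ and $i$, if $x <_{i[V]} y$ then $x <_{\sigma(i)} y$; and (independence) for all $x,y\in X$ and $i,j$, if $f_i = f_j$ on $\{x,y\}$ then $\sigma(i) = \sigma(j)$ on $\{x,y\}$. $\sigma$ is non-dictatorial if for every $v \in V$ there are $i$ and $x,y \in X$ with $x <_{i(v)} y$ and $y \lesssim_{\sigma(i)} x$. For $k \ge 1$, $\sigma$ is $k$-non-dictatorial if for every finite sequence $s$ of elements of $V$ with $\mathrm{lh}(s) \le k$ there are $j$ and $x,y \in X$ such that $x <_{j(s(i))} y$ for all $i < \mathrm{lh}(s)$ and $y <_{\sigma(j)} x$. $\sigma$ is finitely non-dictatorial if it is $k$-non-dictatorial for all $k \ge 1$. $\sigma$ has the cofinite coalitions property if for every profile index $j$ and all $x,y \in X$, if cofinitely many $v \in V$ satisfy $x <_{j(v)} y$, then $x <_{\sigma(j)} y$. Principles: $\mathrm{FPT}$ states: for every countable society $\mathcal{S} = \langle V,X,\mathcal{A},\mathcal{F}\rangle$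 with $V$ infinite there is a non-dictatorial social welfare function for $\mathcal{S}$. $\mathrm{FPT}^k$ (for fixed $k \ge 1$), $\mathrm{FPT}^{<\mathbb{N}}$ and $\mathrm{FPT}^+$ are obtained by replacing "non-dictatorial" with "$k$-non-dictatorial", "finitely non-dictatorial", and "having the cofinite coalitions property", respectively. *)

theory Defs
  imports Main
begin

section \<open>The language of second-order arithmetic\<close>

text \<open>
  Two sorts of variables, numbers and sets, each named by natural numbers.  There is no equality
  between sets in the language.
\<close>

datatype l2_term =
    Var nat
  | Zero
  | One
  | Add l2_term l2_term
  | Mul l2_term l2_term

datatype l2_form =
    Eq l2_term l2_term
  | Less l2_term l2_term
  | Mem l2_term nat
  | Neg l2_form
  | Con l2_form l2_form
  | Dis l2_form l2_form
  | Imp l2_form l2_form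
  | Iff l2_form l2_form
  | AllN nat l2_form
  | ExN nat l2_form
  | AllS nat l2_form
  | ExS nat l2_form

primrec vars :: "l2_term \<Rightarrow> nat set" where
  "vars (Var x) = {x}"
| "vars Zero = {}"
| "vars One = {}"
| "vars (Add s t) = vars s \<union> vars t"
| "vars (Mul s t) = vars s \<union> vars t"

text \<open>Bounded-quantifier formulas; the bounding term must not contain the bound variable.\<close>

inductive Sigma00 :: "l2_form \<Rightarrow> bool" where
  "Sigma00 (Eq s t)"
| "Sigma00 (Less s t)"
| "Sigma00 (Mem t Y)"
| "Sigma00 \<phi> \<Longrightarrow> Sigma00 (Neg \<phi>)"
| "\<lbrakk>Sigma00 \<phi>; Sigma00 \<psi>\<rbrakk> \<Longrightarrow> Sigma00 (Con \<phi> \<psi>)"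
| "\<lbrakk>Sigma00 \<phi>; Sigma00 \<psi>\<rbrakk> \<Longrightarrow> Sigma00 (Dis \<phi> \<psi>)"
| "\<lbrakk>Sigma00 \<phi>; Sigma00 \<psi>\<rbrakk> \<Longrightarrow> Sigma00 (Imp \<phi> \<psi>)"
| "\<lbrakk>Sigma00 \<phi>; Sigma00 \<psi>\<rbrakk> \<Longrightarrow> Sigma00 (Iff \<phi> \<psi>)"
| "\<lbrakk>Sigma00 \<phi>; x \<notin> vars t\<rbrakk> \<Longrightarrow> Sigma00 (AllN x (Imp (Less (Var x) t) \<phi>))"
| "\<lbrakk>Sigma00 \<phi>; x \<notin> vars t\<rbrakk> \<Longrightarrow> Sigma00 (ExN x (Con (Less (Var x) t) \<phi>))"

definition Sigma01 :: "l2_form \<Rightarrow> bool" where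
  "Sigma01 \<phi> \<longleftrightarrow> (\<exists>x \<theta>. Sigma00 \<theta> \<and> \<phi> = ExN x \<theta>)"

definition Pi01 :: "l2_form \<Rightarrow> bool" where
  "Pi01 \<phi> \<longleftrightarrow> (\<exists>x \<theta>. Sigma00 \<theta> \<and> \<phi> = AllN x \<theta>)"

primrec arithmetical :: "l2_form \<Rightarrow> bool" where
  "arithmetical (Eq s t) = True"
| "arithmetical (Less s t) = True"
| "arithmetical (Mem t Y) = True"
| "arithmetical (Neg \<phi>) = arithmetical \<phi>"
| "arithmetical (Con \<phi> \<psi>) = (arithmetical \<phi> \<and> arithmetical \<psi>)"
| "arithmetical (Dis \<phi> \<psi>) = (arithmetical \<phi> \<and> arithmetical \<psi>)"
| "arithmetical (Imp \<phi> \<psi>) = (arithmetical \<phi> \<and> arithmetical \<psi>)"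
| "arithmetical (Iff \<phi> \<psi>) = (arithmetical \<phi> \<and> arithmetical \<psi>)"
| "arithmetical (AllN x \<phi>) = arithmetical \<phi>"
| "arithmetical (ExN x \<phi>) = arithmetical \<phi>"
| "arithmetical (AllS Y \<phi>) = False"
| "arithmetical (ExS Y \<phi>) = False"


section \<open>Structures and satisfaction\<close>

text \<open>
  The first-order part is the whole type \<open>'a\<close> with arbitrary operations (so it may well be
  nonstandard), and the set quantifiers range over an arbitrary nonempty collection \<open>Sets\<close> of
  subsets of it.
\<close>

record 'a l2_structure =
  l2_zero :: 'a            ("\<zero>\<index>")
  l2_one  :: 'a            ("\<one>\<index>")
  l2_add  :: "'a \<Rightarrow> 'a \<Rightarrow> 'a"  (infixl "\<oplus>\<index>" 65)
  l2_mul  :: "'a \<Rightarrow> 'a \<Rightarrow> 'a"  (infixl "\<otimes>\<index>" 70)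
  l2_less :: "'a \<Rightarrow> 'a \<Rightarrow> bool" (infix "\<prec>\<index>" 50)
  l2_sets :: "'a set set"   ("Sets\<index>")

locale l2 =
  fixes M :: "'a l2_structure" (structure)
  assumes Sets_nonempty: "Sets \<noteq> {}"
begin

primrec val :: "(nat \<Rightarrow> 'a) \<Rightarrow> l2_term \<Rightarrow> 'a" where
  "val e (Var x) = e x"
| "val e Zero = \<zero>"
| "val e One = \<one>"
| "val e (Add s t) = val e s \<oplus> val e t"
| "val e (Mul s t) = val e s \<otimes> val e t"

primrec sat :: "(nat \<Rightarrow> 'a) \<Rightarrow> (nat \<Rightarrow> 'a set) \<Rightarrow> l2_form \<Rightarrow> bool" where
  "sat e E (Eq s t) \<longleftrightarrow> val e s = val e t"
| "sat e E (Less s t) \<longleftrightarrow> val e s \<prec> val e t"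
| "sat e E (Mem t Y) \<longleftrightarrow> val e t \<in> E Y"
| "sat e E (Neg \<phi>) \<longleftrightarrow> \<not> sat e E \<phi>"
| "sat e E (Con \<phi> \<psi>) \<longleftrightarrow> sat e E \<phi> \<and> sat e E \<psi>"
| "sat e E (Dis \<phi> \<psi>) \<longleftrightarrow> sat e E \<phi> \<or> sat e E \<psi>"
| "sat e E (Imp \<phi> \<psi>) \<longleftrightarrow> (sat e E \<phi> \<longrightarrow> sat e E \<psi>)"
| "sat e E (Iff \<phi> \<psi>) \<longleftrightarrow> (sat e E \<phi> \<longleftrightarrow> sat e E \<psi>)"
| "sat e E (AllN x \<phi>) \<longleftrightarrow> (\<forall>a. sat (e(x := a)) E \<phi>)"
| "sat e E (ExN x \<phi>) \<longleftrightarrow> (\<exists>a. sat (e(x := a)) E \<phi>)"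
| "sat e E (AllS Y \<phi>) \<longleftrightarrow> (\<forall>B\<in>Sets. sat e (E(Y := B)) \<phi>)"
| "sat e E (ExS Y \<phi>) \<longleftrightarrow> (\<exists>B\<in>Sets. sat e (E(Y := B)) \<phi>)"

definition set_assignment :: "(nat \<Rightarrow> 'a set) \<Rightarrow> bool" where
  "set_assignment E \<longleftrightarrow> (\<forall>Y. E Y \<in> Sets)"

definition ACA :: bool where
  "ACA \<longleftrightarrow> (\<forall>\<phi> x e E. arithmetical \<phi> \<and> set_assignment E
     \<longrightarrow> (\<exists>Y\<in>Sets. \<forall>a. a \<in> Y \<longleftrightarrow> sat (e(x := a)) E \<phi>))"

end

text \<open>
  Structures satisfying \<open>RCA\<^sub>0\<close>.  An axiom scheme holds when every instance holds under every
  assignment of the parameters.  Since the comprehension variable is interpreted outside the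
  assignment \<open>E\<close>, the usual proviso that it is not free in the formula is built in.
\<close>

locale RCA0 = l2 +
  assumes succ_nonzero: "n \<oplus> \<one> \<noteq> \<zero>"
    and succ_inject: "m \<oplus> \<one> = n \<oplus> \<one> \<Longrightarrow> m = n"
    and add_zero: "m \<oplus> \<zero> = m"
    and add_succ: "m \<oplus> (n \<oplus> \<one>) = (m \<oplus> n) \<oplus> \<one>"
    and mul_zero: "m \<otimes> \<zero> = \<zero>"
    and mul_succ: "m \<otimes> (n \<oplus> \<one>) = m \<otimes> n \<oplus> m"
    and not_less_zero: "\<not> m \<prec> \<zero>"
    and less_succ: "m \<prec> n \<oplus> \<one> \<longleftrightarrow> m \<prec> n \<or> m = n"
    and Sigma01_induction:
      "\<lbrakk>Sigma01 \<phi>; set_assignment E; sat (e(x := \<zero>)) E \<phi>;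
        \<And>a. sat (e(x := a)) E \<phi> \<Longrightarrow> sat (e(x := a \<oplus> \<one>)) E \<phi>\<rbrakk>
       \<Longrightarrow> sat (e(x := b)) E \<phi>"
    and Delta01_comprehension:
      "\<lbrakk>Sigma01 \<phi>; Pi01 \<psi>; set_assignment E;
        \<And>a. sat (e(x := a)) E \<phi> \<longleftrightarrow> sat (e(x := a)) E \<psi>\<rbrakk>
       \<Longrightarrow> \<exists>Y\<in>Sets. \<forall>a. a \<in> Y \<longleftrightarrow> sat (e(x := a)) E \<phi>"


section \<open>Coding inside a structure\<close>

text \<open>
  All notions below are the relativisations to \<open>M\<close> of statements of second-order arithmetic:
  number quantifiers range over the type \<open>'a\<close>, quantifiers over sets, functions and sequences of
  sets over \<open>Sets\<close>, and ``finite'', ``length'' and ``cardinality'' are those of the structure.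
  HOL sets that are not asserted to lie in \<open>Sets\<close> are only definable classes.
\<close>

context l2
begin

definition le :: "'a \<Rightarrow> 'a \<Rightarrow> bool"  (infix "\<preceq>" 50) where
  "m \<preceq> n \<longleftrightarrow> m \<prec> n \<or> m = n"

primrec num :: "nat \<Rightarrow> 'a" where
  "num 0 = \<zero>"
| "num (Suc n) = num n \<oplus> \<one>"

definition pair :: "'a \<Rightarrow> 'a \<Rightarrow> 'a" where
  "pair m n = (m \<oplus> n) \<otimes> (m \<oplus> n) \<oplus> m"

definition pprod :: "'a set \<Rightarrow> 'a set \<Rightarrow> 'a set" where
  "pprod B C = {pair x y | x y. x \<in> B \<and> y \<in> C}"

definition sect :: "'a set \<Rightarrow> 'a \<Rightarrow> 'a set" where
  "sect Y i = {v. pair i v \<in> Y}"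

definition is_fun :: "'a set \<Rightarrow> 'a set \<Rightarrow> 'a set \<Rightarrow> bool" where
  "is_fun f B C \<longleftrightarrow> f \<subseteq> pprod B C \<and> (\<forall>x\<in>B. \<exists>!y. pair x y \<in> f)"

definition app :: "'a set \<Rightarrow> 'a \<Rightarrow> 'a" where
  "app f x = (THE y. pair x y \<in> f)"

definition fin_set :: "'a set \<Rightarrow> bool" where
  "fin_set Y \<longleftrightarrow> (\<exists>k. \<forall>i\<in>Y. i \<prec> k)"

text \<open>
  Finite sets are coded as in Simpson's book: the number \<open>(k,(m,n))\<close> represents
  \<open>{i < k. m(i+1)+1 divides n}\<close>, and the code of a finite set is its least representation.
\<close>

definition is_triple :: "'a \<Rightarrow> bool" where
  "is_triple c \<longleftrightarrow> (\<exists>k m n. c = pair k (pair m n))"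

definition elems :: "'a \<Rightarrow> 'a set" where
  "elems c = {i. \<exists>k m n. c = pair k (pair m n) \<and> i \<prec> k \<and>
                  (\<exists>q. n = (m \<otimes> (i \<oplus> \<one>) \<oplus> \<one>) \<otimes> q)}"

definition fin_code :: "'a \<Rightarrow> bool" where
  "fin_code c \<longleftrightarrow> is_triple c \<and> (\<forall>d. is_triple d \<and> elems d = elems c \<longrightarrow> c \<preceq> d)"

text \<open>A finite sequence is (the code of) a finite function with domain \<open>{i. i < l}\<close>.\<close>

definition is_seq :: "'a \<Rightarrow> 'a \<Rightarrow> bool" where
  "is_seq s l \<longleftrightarrow> fin_code s \<and> is_fun (elems s) {i. i \<prec> l} UNIV"

definition Seq :: "'a set" where
  "Seq = {s. \<exists>l. is_seq s l}"

definition lh :: "'a \<Rightarrow> 'a" where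
  "lh s = (THE l. is_seq s l)"

definition entry :: "'a \<Rightarrow> 'a \<Rightarrow> 'a" where
  "entry s i = app (elems s) i"

definition has_card :: "'a set \<Rightarrow> 'a \<Rightarrow> bool" where
  "has_card Y n \<longleftrightarrow> (\<exists>s\<in>Seq. lh s = n \<and> (\<forall>i. i \<prec> n \<longrightarrow> entry s i \<in> Y)
                        \<and> (\<forall>y\<in>Y. \<exists>!i. i \<prec> n \<and> entry s i = y))"

definition cardinality :: "'a set \<Rightarrow> 'a" where
  "cardinality Y = (THE n. has_card Y n)"


section \<open>Countable societies and social welfare functions\<close>

definition countable_algebra :: "'a set \<Rightarrow> 'a set \<Rightarrow> bool" where
  "countable_algebra V A \<longleftrightarrow>
     (\<forall>n. sect A n \<subseteq> V) \<and>
     (\<exists>n. sect A n = V) \<and>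
     (\<forall>m n. \<exists>k. sect A k = sect A m \<union> sect A n) \<and>
     (\<forall>m n. \<exists>k. sect A k = sect A m \<inter> sect A n) \<and>
     (\<forall>n. \<exists>k. sect A k = V - sect A n)"

definition atomic :: "'a set \<Rightarrow> 'a set \<Rightarrow> bool" where
  "atomic V A \<longleftrightarrow> (\<forall>v\<in>V. \<exists>k. sect A k = {v})"

text \<open>\<open>wle r x y\<close> and \<open>wlt r x y\<close> are \<open>x \<lesssim>\<^sub>r y\<close> and \<open>x <\<^sub>r y\<close> for the coded relation \<open>r\<close>.\<close>

definition wle :: "'a \<Rightarrow> 'a \<Rightarrow> 'a \<Rightarrow> bool" where
  "wle r x y \<longleftrightarrow> pair x y \<in> elems r"

definition wlt :: "'a \<Rightarrow> 'a \<Rightarrow> 'a \<Rightarrow> bool" where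
  "wlt r x y \<longleftrightarrow> wle r x y \<and> \<not> wle r y x"

definition weak_orders :: "'a set \<Rightarrow> 'a set" where
  "weak_orders X = {r. fin_code r \<and> elems r \<subseteq> pprod X X \<and>
     (\<forall>x\<in>X. \<forall>y\<in>X. \<forall>z\<in>X. wle r x y \<and> wle r y z \<longrightarrow> wle r x z) \<and>
     (\<forall>x\<in>X. \<forall>y\<in>X. wle r x y \<or> wle r y x)}"

definition agree_on :: "'a \<Rightarrow> 'a \<Rightarrow> 'a \<Rightarrow> 'a \<Rightarrow> bool" where
  "agree_on x y r r' \<longleftrightarrow> (\<forall>a\<in>{x, y}. \<forall>b\<in>{x, y}. wle r a b \<longleftrightarrow> wle r' a b)"

definition profile :: "'a set \<Rightarrow> 'a set \<Rightarrow> 'a set \<Rightarrow> bool" where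
  "profile V X f \<longleftrightarrow> is_fun f V (weak_orders X)"

text \<open>\<open>prof_at F i v\<close> is \<open>f\<^sub>i(v)\<close> for the sequence of profiles \<open>F = \<langle>f\<^sub>i\<rangle>\<close>.\<close>

definition prof_at :: "'a set \<Rightarrow> 'a \<Rightarrow> 'a \<Rightarrow> 'a" where
  "prof_at F i v = app (sect F i) v"

definition uniformly_measurable :: "'a set \<Rightarrow> 'a set \<Rightarrow> 'a set \<Rightarrow> 'a set \<Rightarrow> bool" where
  "uniformly_measurable V X A F \<longleftrightarrow>
     (\<exists>\<mu>\<in>Sets. is_fun \<mu> (pprod UNIV (pprod X X)) UNIV \<and>
        (\<forall>n. \<forall>x\<in>X. \<forall>y\<in>X. \<forall>v\<in>V.
           wle (prof_at F n v) x y \<longleftrightarrow> v \<in> sect A (app \<mu> (pair n (pair x y)))))"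

definition Perm :: "'a set \<Rightarrow> 'a set" where
  "Perm W = {p \<in> Seq. (\<forall>i. i \<prec> lh p \<longrightarrow> entry p i \<in> W) \<and>
                      (\<forall>r\<in>W. \<exists>!i. i \<prec> lh p \<and> entry p i = r)}"

definition QPart :: "'a \<Rightarrow> 'a set" where
  "QPart k = {s \<in> Seq. \<one> \<preceq> lh s \<and> lh s \<preceq> k}"

text \<open>
  \<open>cell A s v i\<close>: \<open>i < lh(s) - 1\<close> and \<open>v \<in> A\<^bsub>s(i)\<^esub>\<close>.  The condition \<open>l \<oplus> \<one> = lh s\<close> in
  \<open>qp_embedded\<close> says \<open>l = lh(s) - 1\<close>.
\<close>

definition cell :: "'a set \<Rightarrow> 'a \<Rightarrow> 'a \<Rightarrow> 'a \<Rightarrow> bool" where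
  "cell A s v i \<longleftrightarrow> i \<oplus> \<one> \<prec> lh s \<and> v \<in> sect A (entry s i)"

definition qp_embedded :: "'a set \<Rightarrow> 'a set \<Rightarrow> 'a set \<Rightarrow> 'a set \<Rightarrow> bool" where
  "qp_embedded V X A F \<longleftrightarrow>
     (let W = weak_orders X; P = Perm W; Q = QPart (cardinality W) in
      \<exists>e\<in>Sets. is_fun e (pprod P Q) UNIV \<and>
        (\<forall>p\<in>P. \<forall>s\<in>Q. \<forall>v\<in>V.
           ((\<exists>!i. cell A s v i) \<longrightarrow>
              (\<forall>i. cell A s v i \<longrightarrow> prof_at F (app e (pair p s)) v = entry p i)) \<and>
           (\<not> (\<exists>!i. cell A s v i) \<longrightarrow>
              (\<forall>l. l \<oplus> \<one> = lh s \<longrightarrow> prof_at F (app e (pair p s)) v = entry p l))))"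

definition society :: "'a set \<Rightarrow> 'a set \<Rightarrow> 'a set \<Rightarrow> 'a set \<Rightarrow> bool" where
  "society V X A F \<longleftrightarrow>
     V \<in> Sets \<and> X \<in> Sets \<and> A \<in> Sets \<and> F \<in> Sets \<and>
     V \<noteq> {} \<and>
     fin_set X \<and> num 3 \<preceq> cardinality X \<and>
     countable_algebra V A \<and> atomic V A \<and>
     (\<forall>i. profile V X (sect F i)) \<and>
     uniformly_measurable V X A F \<and>
     qp_embedded V X A F"

definition swf :: "'a set \<Rightarrow> 'a set \<Rightarrow> 'a set \<Rightarrow> 'a set \<Rightarrow> bool" where
  "swf V X F \<sigma> \<longleftrightarrow>
     \<sigma> \<in> Sets \<and> is_fun \<sigma> UNIV (weak_orders X) \<and>
     (\<forall>x\<in>X. \<forall>y\<in>X. \<forall>i. (\<forall>v\<in>V. wlt (prof_at F i v) x y) \<longrightarrow> wlt (app \<sigma> i) x y) \<and>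
     (\<forall>x\<in>X. \<forall>y\<in>X. \<forall>i j. (\<forall>v\<in>V. agree_on x y (prof_at F i v) (prof_at F j v))
                          \<longrightarrow> agree_on x y (app \<sigma> i) (app \<sigma> j))"

definition non_dictatorial :: "'a set \<Rightarrow> 'a set \<Rightarrow> 'a set \<Rightarrow> 'a set \<Rightarrow> bool" where
  "non_dictatorial V X F \<sigma> \<longleftrightarrow>
     (\<forall>v\<in>V. \<exists>i. \<exists>x\<in>X. \<exists>y\<in>X. wlt (prof_at F i v) x y \<and> wle (app \<sigma> i) y x)"

definition k_non_dictatorial :: "'a \<Rightarrow> 'a set \<Rightarrow> 'a set \<Rightarrow> 'a set \<Rightarrow> 'a set \<Rightarrow> bool" where
  "k_non_dictatorial k V X F \<sigma> \<longleftrightarrow>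
     (\<forall>s\<in>Seq. lh s \<preceq> k \<and> (\<forall>i. i \<prec> lh s \<longrightarrow> entry s i \<in> V) \<longrightarrow>
        (\<exists>j. \<exists>x\<in>X. \<exists>y\<in>X. (\<forall>i. i \<prec> lh s \<longrightarrow> wlt (prof_at F j (entry s i)) x y)
                         \<and> wlt (app \<sigma> j) y x))"

text \<open>Here \<open>k\<close> ranges over all numbers of the structure, standard or not.\<close>

definition finitely_non_dictatorial :: "'a set \<Rightarrow> 'a set \<Rightarrow> 'a set \<Rightarrow> 'a set \<Rightarrow> bool" where
  "finitely_non_dictatorial V X F \<sigma> \<longleftrightarrow> (\<forall>k. \<one> \<preceq> k \<longrightarrow> k_non_dictatorial k V X F \<sigma>)"

definition cofinite_coalitions :: "'a set \<Rightarrow> 'a set \<Rightarrow> 'a set \<Rightarrow> 'a set \<Rightarrow> bool" where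
  "cofinite_coalitions V X F \<sigma> \<longleftrightarrow>
     (\<forall>j. \<forall>x\<in>X. \<forall>y\<in>X. fin_set {v \<in> V. \<not> wlt (prof_at F j v) x y} \<longrightarrow> wlt (app \<sigma> j) x y)"

definition possibility ::
    "('a set \<Rightarrow> 'a set \<Rightarrow> 'a set \<Rightarrow> 'a set \<Rightarrow> bool) \<Rightarrow> bool" where
  "possibility \<Phi> \<longleftrightarrow>
     (\<forall>V X A F. society V X A F \<and> \<not> fin_set V \<longrightarrow> (\<exists>\<sigma>. swf V X F \<sigma> \<and> \<Phi> V X F \<sigma>))"

definition FPT :: bool where
  "FPT \<longleftrightarrow> possibility non_dictatorial"

text \<open>The superscript \<open>k\<close> is a metatheoretic natural number, denoted by a numeral.\<close>

definition FPT_k :: "nat \<Rightarrow> bool" where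
  "FPT_k k \<longleftrightarrow> possibility (k_non_dictatorial (num k))"

definition FPT_fin :: bool where
  "FPT_fin \<longleftrightarrow> possibility finitely_non_dictatorial"

definition FPT_plus :: bool where
  "FPT_plus \<longleftrightarrow> possibility cofinite_coalitions"

end

end

theory Submission
  imports Defs
begin

text \<open>
  For the direction from arithmetical comprehension to the possibility theorems, one builds by
  recursion a set \<open>U\<close> of indices that behaves like a nonprincipal ultrafilter on the algebra, and
  lets society weakly prefer \<open>y\<close> to \<open>x\<close> when the set of voters doing so has its index in \<open>U\<close>.
  Conversely, let \<open>P\<close> be the projection of a set \<open>R\<close>.  Take a society with voters \<open>\<nat>\<close> whose algebra
  contains, uniformly in \<open>n\<close>, the set of stages \<open>v\<close> at which some witness for \<open>n \<in> P\<close> below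
  \<open>v\<close> has been seen; this set is a final segment or empty.  By the pivotal voter argument for
  Arrow's theorem, deleting a single voter from a decisive coalition cannot destroy its power unless
  that voter is a dictator.  By induction every final segment is decisive for a non-dictatorial
  social welfare function, which therefore computes \<open>P\<close>.  Closure under projections gives
  arithmetical comprehension by induction on formulas.

  Definability is handled semantically: a predicate is decidable when it defines an element of
  \<open>Sets\<close>, several arguments being coded into one by \<open>pair\<close>; \<open>\<Delta>\<^sub>1\<close>-comprehension and
  \<open>\<Sigma>\<^sub>1\<close>-induction are then used only through closure properties of such predicates.
\<close>

text \<open>Only the weakest principle has to be reversed: \<open>FPT\<close> follows from each of
  the others, because a single voter is a sequence of length one and, by atomicity, also a finite
  coalition that its complement can outvote. The obstacle in building the society is a circularity.
  Measurability puts every set of voters defined by a profile into the algebra, while the embedding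
  turns every quasi-partition of the algebra into a profile. Both demands are met by one recursion
  on indices, run separately for each voter: whether \<open>v\<close> lies in the set with index
  \<open>k\<close> depends only on the status of the same \<open>v\<close> at smaller indices. A
  second obstacle is that final segments may start at nonstandard numbers, so the induction over
  them must concern a decidable statement. Therefore each coalition index is sent recursively to one
  profile index, and only the social verdict there is tested, on one pair of alternatives;
  independence makes this single test representative.\<close>

named_theorems recs

section \<open>Arithmetic of the structure\<close>

context RCA0
begin

text \<open>Induction demands a set assignment even for formulas without set variables; any member
  of \<open>Sets\<close> serves. Later the actual parameters are written over it.\<close>

definition some_assignment :: "nat \<Rightarrow> 'a set" where
  "some_assignment = (\<lambda>_. SOME Y. Y \<in> Sets)"

lemma set_assignment_some: "set_assignment some_assignment"
  unfolding set_assignment_def some_assignment_def using Sets_nonempty by (simp add: some_in_eq)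

lemma Sigma01_ExN: "Sigma00 \<theta> \<Longrightarrow> Sigma01 (ExN x \<theta>)"
  unfolding Sigma01_def by blast

text \<open>Variable 0 is the induction variable and variables from 2 on carry parameters. The
  existential quantifier that \<open>Sigma01\<close> demands binds variable 1, mostly a dummy; in
  \<open>zero_or_succ\<close> and \<open>less_iff\<close> it is a genuine witness.\<close>

lemmas induct_formula = Sigma01_induction[OF Sigma01_ExN set_assignment_some, where x = 0]

lemma add_0_left: "\<zero> \<oplus> n = n"
  using induct_formula[of "Eq (Add Zero (Var 0)) (Var 0)" "\<lambda>_. \<zero>" 1 n]
  by (simp add: Sigma00.intros add_zero add_succ[symmetric]) (metis add_succ)

lemma succ_add: "(m \<oplus> \<one>) \<oplus> n = (m \<oplus> n) \<oplus> \<one>"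
  using induct_formula[of "Eq (Add (Add (Var 2) One) (Var 0)) (Add (Add (Var 2) (Var 0)) One)"
      "(\<lambda>_. \<zero>)(2 := m)" 1 n]
  by (simp add: Sigma00.intros add_zero) (metis add_succ)

lemma add_comm: "m \<oplus> n = n \<oplus> m"
  using induct_formula[of "Eq (Add (Var 2) (Var 0)) (Add (Var 0) (Var 2))" "(\<lambda>_. \<zero>)(2 := m)" 1 n]
  by (simp add: Sigma00.intros add_zero add_0_left succ_add) (metis add_succ)

lemma add_assoc: "(k \<oplus> m) \<oplus> n = k \<oplus> (m \<oplus> n)"
  using induct_formula[of "Eq (Add (Add (Var 2) (Var 3)) (Var 0)) (Add (Var 2) (Add (Var 3) (Var 0)))"
      "(\<lambda>_. \<zero>)(2 := k, 3 := m)" 1 n]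
  by (simp add: Sigma00.intros add_zero) (metis add_succ)

lemma mul_0_left: "\<zero> \<otimes> n = \<zero>"
  using induct_formula[of "Eq (Mul Zero (Var 0)) Zero" "\<lambda>_. \<zero>" 1 n]
  by (simp add: Sigma00.intros mul_zero mul_succ add_zero)

lemma succ_mul: "(m \<oplus> \<one>) \<otimes> n = m \<otimes> n \<oplus> n"
proof -
  have *: "(a \<oplus> m) \<oplus> (c \<oplus> \<one>) = (a \<oplus> c) \<oplus> (m \<oplus> \<one>)" for a c
    by (metis add_assoc add_comm)
  show ?thesis
    using induct_formula[of "Eq (Mul (Add (Var 2) One) (Var 0)) (Add (Mul (Var 2) (Var 0)) (Var 0))"
      "(\<lambda>_. \<zero>)(2 := m)" 1 n]
    by (simp add: Sigma00.intros mul_zero add_zero mul_succ *)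
qed

lemma mul_comm: "m \<otimes> n = n \<otimes> m"
  using induct_formula[of "Eq (Mul (Var 2) (Var 0)) (Mul (Var 0) (Var 2))" "(\<lambda>_. \<zero>)(2 := m)" 1 n]
  by (simp add: Sigma00.intros mul_zero mul_0_left succ_mul mul_succ)

lemma distrib: "k \<otimes> (m \<oplus> n) = k \<otimes> m \<oplus> k \<otimes> n"
  using induct_formula[of "Eq (Mul (Var 2) (Add (Var 3) (Var 0))) (Add (Mul (Var 2) (Var 3)) (Mul (Var 2) (Var 0)))"
      "(\<lambda>_. \<zero>)(2 := k, 3 := m)" 1 n]
  by (simp add: Sigma00.intros mul_zero add_zero mul_succ add_succ) (simp add: add_assoc)

lemma mul_one: "\<one> \<otimes> n = n"
  by (metis mul_0_left mul_comm mul_succ add_0_left)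

lemma mul_one_right: "n \<otimes> \<one> = n"
  by (metis mul_one mul_comm)

lemma mul_assoc: "(k \<otimes> m) \<otimes> n = k \<otimes> (m \<otimes> n)"
  using induct_formula[of "Eq (Mul (Mul (Var 2) (Var 3)) (Var 0)) (Mul (Var 2) (Mul (Var 3) (Var 0)))"
      "(\<lambda>_. \<zero>)(2 := k, 3 := m)" 1 n]
  by (simp add: Sigma00.intros mul_zero distrib mul_one_right)

lemma zero_or_succ: "n = \<zero> \<or> (\<exists>m. n = m \<oplus> \<one>)"
  using induct_formula[of "Dis (Eq (Var 0) Zero) (Eq (Var 0) (Add (Var 1) One))" "\<lambda>_. \<zero>" 1 n]
  by (auto simp: Sigma00.intros)

lemma add_cancel: "a \<oplus> c = b \<oplus> c \<Longrightarrow> a = b"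
  using induct_formula[of "Imp (Eq (Add (Var 2) (Var 0)) (Add (Var 3) (Var 0))) (Eq (Var 2) (Var 3))"
      "(\<lambda>_. \<zero>)(2 := a, 3 := b)" 1 c]
  by (simp add: Sigma00.intros add_zero) (metis add_succ succ_inject)

lemma less_iff: "m \<prec> n \<longleftrightarrow> (\<exists>d. n = (m \<oplus> d) \<oplus> \<one>)"
proof
  show "m \<prec> n \<Longrightarrow> \<exists>d. n = m \<oplus> d \<oplus> \<one>"
    using induct_formula[of "Imp (Less (Var 2) (Var 0)) (Eq (Var 0) (Add (Add (Var 2) (Var 1)) One))"
      "(\<lambda>_. \<zero>)(2 := m)" 1 n]
    by (simp add: Sigma00.intros not_less_zero less_succ) (metis add_succ add_zero)
next
  have "m \<prec> m \<oplus> d \<oplus> \<one>" for d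
    using induct_formula[of "Less (Var 2) (Add (Add (Var 2) (Var 0)) One)"
      "(\<lambda>_. \<zero>)(2 := m)" 1 d]
    by (simp add: Sigma00.intros add_zero less_succ) (metis add_succ less_succ)
  then show "\<exists>d. n = m \<oplus> d \<oplus> \<one> \<Longrightarrow> m \<prec> n"
    by blast
qed

lemma less_irrefl: "\<not> m \<prec> m"
  by (metis less_iff add_cancel add_comm add_assoc add_zero succ_nonzero)

lemma less_trans: "\<lbrakk>k \<prec> m; m \<prec> n\<rbrakk> \<Longrightarrow> k \<prec> n"
  unfolding less_iff by (metis add_assoc)

lemma less_linear: "m \<prec> n \<or> m = n \<or> n \<prec> m"
proof -
  have *: "a \<oplus> \<one> \<prec> b \<or> a \<oplus> \<one> = b" if "a \<prec> b" for a b
  proof -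
    obtain d where d: "b = a \<oplus> d \<oplus> \<one>" using \<open>a \<prec> b\<close> less_iff by blast
    show ?thesis
    proof (cases "d = \<zero>")
      case False
      then obtain m where "d = m \<oplus> \<one>" using zero_or_succ by blast
      then have "b = (a \<oplus> \<one>) \<oplus> m \<oplus> \<one>" by (simp only: d succ_add[of a m] add_succ)
      then show ?thesis unfolding less_iff by blast
    qed (simp add: d add_zero)
  qed
  have z: "\<zero> \<prec> b \<or> \<zero> = b" for b
    using zero_or_succ[of b] unfolding less_iff by (metis add_0_left)
  show ?thesis
    using induct_formula[of "Dis (Less (Var 0) (Var 2)) (Dis (Eq (Var 0) (Var 2)) (Less (Var 2) (Var 0)))"
      "(\<lambda>_. \<zero>)(2 := n)" 1 m] z[of n]
    by (simp add: Sigma00.intros less_succ) (use * in blast)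
qed

lemma le_iff: "m \<preceq> n \<longleftrightarrow> (\<exists>d. n = m \<oplus> d)"
  unfolding le_def less_iff by (metis add_zero add_assoc zero_or_succ)

definition monus :: "'a \<Rightarrow> 'a \<Rightarrow> 'a" where
  "monus a b = (if b \<preceq> a then THE c. a = b \<oplus> c else \<zero>)"

lemma add_cancel_left: "b \<oplus> a = b \<oplus> c \<Longrightarrow> a = c"
  by (metis add_cancel add_comm)

lemma monus_add: "monus (b \<oplus> c) b = c"
proof -
  have "(THE x. b \<oplus> c = b \<oplus> x) = c"
    by (rule the_equality) (auto dest: add_cancel_left)
  moreover have "b \<preceq> b \<oplus> c" using le_iff by blast
  ultimately show ?thesis by (simp add: monus_def)
qed

lemma monus_0: "\<not> b \<preceq> a \<Longrightarrow> monus a b = \<zero>"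
  unfolding monus_def by simp

lemma le_cases: "(\<exists>d. n = m \<oplus> d) \<or> (\<exists>d. m = n \<oplus> d)"
  by (metis le_def le_iff less_linear)

lemma mul_eq_0: "a \<otimes> b = \<zero> \<Longrightarrow> a = \<zero> \<or> b = \<zero>"
  by (metis add_succ mul_succ succ_nonzero zero_or_succ)

lemma add_eq_0: "a \<oplus> b = \<zero> \<Longrightarrow> b = \<zero>"
  by (metis add_succ succ_nonzero zero_or_succ)

lemma monus_eq_0: "monus b (b \<oplus> d) = \<zero>"
proof (cases "b \<oplus> d \<preceq> b")
  case True
  then obtain e where "b \<oplus> \<zero> = b \<oplus> (d \<oplus> e)" by (metis add_assoc add_zero le_iff)
  then have "d = \<zero>" by (metis add_cancel_left add_comm add_eq_0)
  then show ?thesis by (metis add_zero monus_add)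
qed (rule monus_0)

lemma monus_monus: "monus (monus a b) c = monus a (b \<oplus> c)"
proof -
  consider e where "a = (b \<oplus> c) \<oplus> e" | d e where "a = b \<oplus> d" "c = d \<oplus> e" | d where "b = a \<oplus> d"
    by (metis add_assoc le_cases)
  then show ?thesis
  proof cases
    case 1
    then show ?thesis by (metis add_assoc monus_add)
  next
    case (2 d e)
    then have "monus a (b \<oplus> c) = \<zero>" by (metis add_assoc monus_eq_0)
    with 2 show ?thesis by (simp only: monus_add monus_eq_0)
  next
    case (3 d)
    then have "monus a (b \<oplus> c) = \<zero>" by (metis add_assoc monus_eq_0)
    moreover have "monus \<zero> c = \<zero>" by (metis monus_eq_0 add_0_left)
    ultimately show ?thesis using 3 by (simp only: monus_eq_0)
  qed
qed

lemma mul_monus: "a \<otimes> monus b c = monus (a \<otimes> b) (a \<otimes> c)"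
  using le_cases[of b c] by (auto simp only: distrib monus_add monus_eq_0 mul_zero)

lemma mul_less:
  assumes "a \<prec> b" "\<zero> \<prec> c"
  shows "c \<otimes> a \<prec> c \<otimes> b"
proof -
  obtain d where d: "b = a \<oplus> d \<oplus> \<one>" using \<open>a \<prec> b\<close> less_iff by blast
  obtain e where e: "c = e \<oplus> \<one>" using \<open>\<zero> \<prec> c\<close> less_irrefl zero_or_succ[of c] by blast
  have "c \<otimes> b = c \<otimes> a \<oplus> c \<otimes> d \<oplus> c" unfolding d distrib mul_one_right ..
  also have "\<dots> = c \<otimes> a \<oplus> (c \<otimes> d \<oplus> e) \<oplus> \<one>" by (subst (3) e) (simp only: add_assoc)
  finally show ?thesis unfolding less_iff by blast
qed

lemma le_trans: "\<lbrakk>k \<preceq> m; m \<preceq> n\<rbrakk> \<Longrightarrow> k \<preceq> n"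
  unfolding le_def using less_trans by blast

lemma le_antisym: "\<lbrakk>m \<preceq> n; n \<preceq> m\<rbrakk> \<Longrightarrow> m = n"
  unfolding le_def using less_irrefl less_trans[of m n m] by blast

lemma less_le_not_le: "m \<prec> n \<longleftrightarrow> m \<preceq> n \<and> \<not> n \<preceq> m"
  unfolding le_def using less_irrefl less_trans[of m n m] by blast

text \<open>This makes the library of ordered semirings, including divisibility, available for the
  structure; \<open>monus\<close> supplies the subtraction that the class asks for.\<close>

sublocale ar: linordered_semidom where plus = "(\<oplus>)" and zero = "\<zero>" and times = "(\<otimes>)" and one = "\<one>"
  and less_eq = "(\<preceq>)" and less = "(\<prec>)" and minus = monus
proof
  show "a \<oplus> b \<oplus> c = a \<oplus> (b \<oplus> c)" for a b c by (rule add_assoc)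
  show "a \<oplus> b = b \<oplus> a" for a b by (rule add_comm)
  show "\<zero> \<oplus> a = a" for a by (rule add_0_left)
  show "monus (a \<oplus> b) a = b" for a b by (rule monus_add)
  show "monus (monus a b) c = monus a (b \<oplus> c)" for a b c by (rule monus_monus)
  show "(a \<otimes> b) \<otimes> c = a \<otimes> (b \<otimes> c)" for a b c by (rule mul_assoc)
  show "a \<otimes> b = b \<otimes> a" for a b by (rule mul_comm)
  show "\<one> \<otimes> a = a" for a by (rule mul_one)
  show "(a \<oplus> b) \<otimes> c = a \<otimes> c \<oplus> b \<otimes> c" for a b c by (metis distrib mul_comm)
  show "a \<otimes> (b \<oplus> c) = a \<otimes> b \<oplus> a \<otimes> c" for a b c by (rule distrib)
  show "\<zero> \<otimes> a = \<zero>" for a by (rule mul_0_left)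
  show "a \<otimes> \<zero> = \<zero>" for a by (rule mul_zero)
  show "\<zero> \<noteq> \<one>" by (metis add_0_left succ_nonzero)
  show "a \<otimes> monus b c = monus (a \<otimes> b) (a \<otimes> c)" for a b c by (rule mul_monus)
  show "a \<noteq> \<zero> \<Longrightarrow> b \<noteq> \<zero> \<Longrightarrow> a \<otimes> b \<noteq> \<zero>" for a b using mul_eq_0 by blast
  show "(x \<prec> y) = (x \<preceq> y \<and> \<not> y \<preceq> x)" for x y by (rule less_le_not_le)
  show "x \<preceq> x" for x by (simp add: le_def)
  show "x \<preceq> y \<Longrightarrow> y \<preceq> z \<Longrightarrow> x \<preceq> z" for x y z by (rule le_trans)
  show "x \<preceq> y \<Longrightarrow> y \<preceq> x \<Longrightarrow> x = y" for x y by (rule le_antisym)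
  show "x \<preceq> y \<or> y \<preceq> x" for x y unfolding le_def using less_linear[of x y] by blast
  show "a \<preceq> b \<Longrightarrow> c \<oplus> a \<preceq> c \<oplus> b" for a b c unfolding le_iff by (auto simp: add_assoc)
  show "\<zero> \<prec> \<one>" unfolding less_iff by (metis add_0_left)
  show "b \<preceq> a \<Longrightarrow> monus a b \<oplus> b = a" for a b by (metis add_comm le_iff monus_add)
  show "a \<prec> b \<Longrightarrow> \<zero> \<prec> c \<Longrightarrow> c \<otimes> a \<prec> c \<otimes> b" for a b c by (rule mul_less)
qed

lemma zero_le [simp]: "\<zero> \<preceq> a"
  by (simp add: le_iff add_0_left)

lemma less_succ_iff: "a \<prec> b \<oplus> \<one> \<longleftrightarrow> a \<preceq> b"
  by (auto simp: less_succ le_def)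

lemma succ_le_iff: "a \<oplus> \<one> \<preceq> b \<longleftrightarrow> a \<prec> b"
  by (metis ar.not_le less_succ_iff)

lemma le_zero_iff [simp]: "a \<preceq> \<zero> \<longleftrightarrow> a = \<zero>"
  by (metis le_def not_less_zero)

lemma le_add1 [simp]: "a \<preceq> a \<oplus> b" and le_add2 [simp]: "a \<preceq> b \<oplus> a"
  using le_iff ar.add.commute by auto

lemma le_mult_pos: "\<zero> \<prec> b \<Longrightarrow> a \<preceq> b \<otimes> a"
  by (metis le_add2 less_iff add_0_left succ_mul)

lemma le_square: "a \<preceq> a \<otimes> a"
  by (cases "a = \<zero>") (auto simp: le_mult_pos ar.less_le)

section \<open>Bounds and injectivity of the pairing function\<close>

lemma pair_le1: "m \<preceq> pair m n"
  unfolding pair_def by simp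

lemma pair_le2: "n \<preceq> pair m n"
  unfolding pair_def by (meson ar.order_trans le_add1 le_add2 le_square)

lemma pair_less2: "\<zero> \<prec> m \<Longrightarrow> n \<prec> pair m n"
proof -
  assume "\<zero> \<prec> m"
  then have "n \<prec> n \<oplus> m" by simp
  also have "n \<oplus> m = m \<oplus> n" by (rule ar.add.commute)
  also have "\<dots> \<preceq> pair m n" unfolding pair_def by (meson ar.order_trans le_add1 le_square)
  finally show ?thesis .
qed

lemma pair_mono: "m \<preceq> m' \<Longrightarrow> n \<preceq> n' \<Longrightarrow> pair m n \<preceq> pair m' n'"
  unfolding pair_def by (intro ar.add_mono ar.mult_mono) auto

text \<open>With \<open>s\<close> the sum of the components, the code lies between the square of
  \<open>s\<close> and that square plus \<open>s\<close>, hence below the square of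
  \<open>s + 1\<close>. So the code determines the sum, and then the first component.\<close>

lemma pair_inject [simp]: "pair m n = pair m' n' \<longleftrightarrow> m = m' \<and> n = n'"
proof
  assume eq: "pair m n = pair m' n'"
  have aux: False if "m \<oplus> n \<prec> m' \<oplus> n'" "pair m n = pair m' n'" for m n m' n'
  proof -
    let ?s = "m \<oplus> n"
    have "?s \<oplus> \<one> \<preceq> m' \<oplus> n'" using that by (simp add: succ_le_iff)
    then have "(?s \<oplus> \<one>) \<otimes> (?s \<oplus> \<one>) \<preceq> (m' \<oplus> n') \<otimes> (m' \<oplus> n')"
      by (intro ar.mult_mono) auto
    moreover have "(?s \<oplus> \<one>) \<otimes> (?s \<oplus> \<one>) = (?s \<otimes> ?s \<oplus> ?s) \<oplus> (?s \<oplus> \<one>)"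
      by (simp add: ar.distrib_left ar.distrib_right ar.add_ac)
    moreover have "pair m n \<preceq> ?s \<otimes> ?s \<oplus> ?s"
      unfolding pair_def by simp
    moreover have "(m' \<oplus> n') \<otimes> (m' \<oplus> n') \<preceq> pair m' n'" unfolding pair_def by simp
    ultimately have "?s \<otimes> ?s \<oplus> ?s \<oplus> (?s \<oplus> \<one>) \<preceq> ?s \<otimes> ?s \<oplus> ?s"
      using that by (metis ar.order_trans)
    then show False
      by (metis ar.add.right_neutral ar.add_le_cancel_left le_zero_iff succ_nonzero)
  qed
  have "m \<oplus> n = m' \<oplus> n'"
    using aux[of m n m' n'] aux[of m' n' m n] eq less_linear by metis
  then show "m = m' \<and> n = n'" using eq unfolding pair_def by simp
qed auto

end

section \<open>Recursive predicates and functions\<close>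

context RCA0
begin

text \<open>The default zero is compatible with later uses: the bounds \<open>p1_le\<close> and
  \<open>p2_le\<close> hold for it as well, and it never equals one of the positive tags.\<close>

definition p1 :: "'a \<Rightarrow> 'a" where
  "p1 z = (if \<exists>m n. z = pair m n then THE m. \<exists>n. z = pair m n else \<zero>)"

definition p2 :: "'a \<Rightarrow> 'a" where
  "p2 z = (if \<exists>m n. z = pair m n then THE n. \<exists>m. z = pair m n else \<zero>)"

lemma p1_pair [simp]: "p1 (pair m n) = m" and p2_pair [simp]: "p2 (pair m n) = n"
  by (auto simp: p1_def p2_def)

definition dec :: "('a \<Rightarrow> bool) \<Rightarrow> bool" where
  "dec P \<longleftrightarrow> {x. P x} \<in> Sets"

definition graph :: "('a \<Rightarrow> 'a) \<Rightarrow> 'a set" where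
  "graph f = {z. \<exists>x. z = pair x (f x)}"

definition recf :: "('a \<Rightarrow> 'a) \<Rightarrow> bool" where
  "recf f \<longleftrightarrow> graph f \<in> Sets"

lemma pair_in_graph [simp]: "pair x y \<in> graph f \<longleftrightarrow> y = f x"
  by (auto simp: graph_def)

abbreviation (input) PairT :: "l2_term \<Rightarrow> l2_term \<Rightarrow> l2_term" where
  "PairT s t \<equiv> Add (Mul (Add s t) (Add s t)) s"

abbreviation (input) LeExN :: "nat \<Rightarrow> nat \<Rightarrow> l2_form \<Rightarrow> l2_form" where
  "LeExN x y \<phi> \<equiv> ExN x (Con (Less (Var x) (Add (Var y) One)) \<phi>)"

abbreviation (input) LeAllN :: "nat \<Rightarrow> nat \<Rightarrow> l2_form \<Rightarrow> l2_form" where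
  "LeAllN x y \<phi> \<equiv> AllN x (Imp (Less (Var x) (Add (Var y) One)) \<phi>)"

lemma pair_fold: "(m \<oplus> n) \<otimes> (m \<oplus> n) \<oplus> m = pair m n"
  by (simp add: pair_def)

text \<open>The only place where comprehension is applied. Variable 0 is the argument and variable 1
  the unbounded witness. For a total function given by its graph the witness is the value, which is
  demanded in \<open>\<phi>\<close> and assumed in \<open>\<psi>\<close>; this gives both forms of
  the predicate.\<close>

lemma dec_Delta01:
  assumes "Sigma00 \<phi>" "Sigma00 \<psi>" "set_assignment E"
    and "\<And>a. P a \<longleftrightarrow> (\<exists>b. sat (e(0 := a, 1 := b)) E \<phi>)"
    and "\<And>a. P a \<longleftrightarrow> (\<forall>b. sat (e(0 := a, 1 := b)) E \<psi>)"
  shows "dec P"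
proof -
  have ex: "sat (e(0 := a)) E (ExN 1 \<phi>) \<longleftrightarrow> P a" for a by (simp only: sat.simps assms(4))
  have all: "sat (e(0 := a)) E (AllN 1 \<psi>) \<longleftrightarrow> P a" for a by (simp only: sat.simps assms(5))
  have "\<exists>Y\<in>Sets. \<forall>a. a \<in> Y \<longleftrightarrow> sat (e(0 := a)) E (ExN 1 \<phi>)"
    by (rule Delta01_comprehension[where \<psi> = "AllN 1 \<psi>"])
      (use assms(1-3) in \<open>auto simp only: Sigma01_def Pi01_def ex all\<close>)
  then obtain Y where "Y \<in> Sets" "\<forall>a. a \<in> Y \<longleftrightarrow> P a"
    unfolding ex by blast
  moreover from this have "Y = {a. P a}" by blast
  ultimately show ?thesis by (simp add: dec_def)
qed

lemma dec_Sigma00: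
  assumes "Sigma00 \<phi>" "set_assignment E" "\<And>a b. P a \<longleftrightarrow> sat (e(0 := a, 1 := b)) E \<phi>"
  shows "dec P"
  by (rule dec_Delta01[of \<phi> \<phi> E P e]) (use assms in auto)

lemma set_assignment_upd: "\<lbrakk>set_assignment E; Y \<in> Sets\<rbrakk> \<Longrightarrow> set_assignment (E(n := Y))"
  by (simp add: set_assignment_def)

lemmas sas = set_assignment_upd set_assignment_some

section \<open>Closure properties of decidable predicates and recursive functions\<close>

lemma dec_in: "Y \<in> Sets \<Longrightarrow> dec (\<lambda>x. x \<in> Y)"
  by (simp add: dec_def)

lemma dec_not [recs]: "dec P \<Longrightarrow> dec (\<lambda>x. \<not> P x)"
  by (rule dec_Sigma00[of "Neg (Mem (Var 0) 0)" "some_assignment(0 := {x. P x})"])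
    (auto intro!: Sigma00.intros sas simp: dec_def)

lemma dec_conj [recs]: "\<lbrakk>dec P; dec Q\<rbrakk> \<Longrightarrow> dec (\<lambda>x. P x \<and> Q x)"
  by (rule dec_Sigma00[of "Con (Mem (Var 0) 0) (Mem (Var 0) 1)" "some_assignment(0 := {x. P x}, 1 := {x. Q x})"])
    (auto intro!: Sigma00.intros sas simp: dec_def)

lemma dec_disj [recs]: "\<lbrakk>dec P; dec Q\<rbrakk> \<Longrightarrow> dec (\<lambda>x. P x \<or> Q x)"
  using dec_not[OF dec_conj[OF dec_not dec_not], of P Q] by simp

lemma dec_imp [recs]: "\<lbrakk>dec P; dec Q\<rbrakk> \<Longrightarrow> dec (\<lambda>x. P x \<longrightarrow> Q x)"
  using dec_disj[OF dec_not, of P Q] by simp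

lemma dec_iff [recs]: "\<lbrakk>dec P; dec Q\<rbrakk> \<Longrightarrow> dec (\<lambda>x. P x \<longleftrightarrow> Q x)"
  using dec_conj[OF dec_imp dec_imp, of P Q Q P] by (simp only: iff_conv_conj_imp)

lemma dec_const [recs]: "dec (\<lambda>x. b)"
proof -
  obtain Y where "dec (\<lambda>x. x \<in> Y)" using Sets_nonempty dec_in by blast
  then have "dec (\<lambda>x. x \<in> Y \<and> \<not> x \<in> Y)" by (intro recs)
  then have "dec (\<lambda>x. False)" by simp
  moreover from dec_not[OF this] have "dec (\<lambda>x. True)" by simp
  ultimately show ?thesis by (cases b) auto
qed

lemma dec_comp:
  assumes "dec P" "recf f"
  shows "dec (\<lambda>x. P (f x))"
  by (rule dec_Delta01[of "Con (Mem (PairT (Var 0) (Var 1)) 0) (Mem (Var 1) 1)"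
     "Imp (Mem (PairT (Var 0) (Var 1)) 0) (Mem (Var 1) 1)"
     "some_assignment(0 := graph f, 1 := {x. P x})"])
    (use assms in \<open>auto intro!: Sigma00.intros sas simp: pair_fold dec_def recf_def\<close>)

lemma dec_mem [recs]: "\<lbrakk>Y \<in> Sets; recf f\<rbrakk> \<Longrightarrow> dec (\<lambda>x. f x \<in> Y)"
  using dec_comp[OF dec_in] .

lemma dec_eq [recs]:
  assumes "recf f" "recf g"
  shows "dec (\<lambda>x. f x = g x)"
  by (rule dec_Delta01[of "Con (Mem (PairT (Var 0) (Var 1)) 0) (Mem (PairT (Var 0) (Var 1)) 1)"
     "Imp (Mem (PairT (Var 0) (Var 1)) 0) (Mem (PairT (Var 0) (Var 1)) 1)"
     "some_assignment(0 := graph f, 1 := graph g)"])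
    (use assms in \<open>auto intro!: Sigma00.intros sas simp: pair_fold recf_def\<close>)

lemma dec_ball_less [recs]:
  assumes "dec (\<lambda>z. Q (p1 z) (p2 z))" "recf f"
  shows "dec (\<lambda>x. \<forall>y. y \<prec> f x \<longrightarrow> Q x y)"
  by (rule dec_Delta01[of "Con (Mem (PairT (Var 0) (Var 1)) 0) (AllN 2 (Imp (Less (Var 2) (Var 1)) (Mem (PairT (Var 0) (Var 2)) 1)))"
     "Imp (Mem (PairT (Var 0) (Var 1)) 0) (AllN 2 (Imp (Less (Var 2) (Var 1)) (Mem (PairT (Var 0) (Var 2)) 1)))"
     "some_assignment(0 := graph f, 1 := {z. Q (p1 z) (p2 z)})"])
    (use assms in \<open>auto intro!: Sigma00.intros sas simp: pair_fold dec_def recf_def\<close>)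

lemma dec_bex_less [recs]:
  assumes "dec (\<lambda>z. Q (p1 z) (p2 z))" "recf f"
  shows "dec (\<lambda>x. \<exists>y. y \<prec> f x \<and> Q x y)"
  using dec_not[OF dec_ball_less[OF dec_not[OF assms(1)] assms(2)]] by simp

lemma dec_Delta1:
  assumes "dec (\<lambda>z. Q (p1 z) (p2 z))" "dec (\<lambda>z. R (p1 z) (p2 z))"
    and "\<And>x. P x \<longleftrightarrow> (\<exists>y. Q x y)" "\<And>x. P x \<longleftrightarrow> (\<forall>y. R x y)"
  shows "dec P"
  by (rule dec_Delta01[of "Mem (PairT (Var 0) (Var 1)) 0" "Mem (PairT (Var 0) (Var 1)) 1"
     "some_assignment(0 := {z. Q (p1 z) (p2 z)}, 1 := {z. R (p1 z) (p2 z)})"])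
    (use assms(1,2) in \<open>auto intro!: Sigma00.intros sas simp: pair_fold dec_def assms(3,4)[symmetric]\<close>)

lemma val_cong: "(\<And>x. x \<in> vars t \<Longrightarrow> e x = e' x) \<Longrightarrow> val e t = val e' t"
  by (induction t) auto

lemma less_succ_pair [simp]: "x \<prec> pair x y \<oplus> \<one>" "y \<prec> pair x y \<oplus> \<one>"
  by (simp_all add: less_succ_iff pair_le1 pair_le2)

text \<open>Two values have to be guessed but only one unbounded quantifier is available, so
  variable 1 is a common bound for both. Variables 4 and 5 are the values of \<open>f\<close> and
  \<open>g\<close> below it; variables 2 and 3 are the argument and the result.\<close>

lemma recf_binop:
  assumes "recf f" "recf g" "vars t \<subseteq> {4, 5}"
  shows "recf (\<lambda>x. val ((\<lambda>_. \<zero>)(4 := f x, 5 := g x)) t)"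
proof -
  define h where "h u v = val ((\<lambda>_. \<zero>)(4 := u, 5 := v)) t" for u v
  have h: "val ((\<lambda>_. \<zero>)(0 := a, 1 := b, 2 := x, 3 := y, 4 := u, 5 := v)) t = h u v" for a b x y u v
    unfolding h_def by (rule val_cong) (use assms(3) in auto)
  let ?P = "\<lambda>z. \<exists>x. z = pair x (h (f x) (g x))"
  let ?args = "\<lambda>\<chi>. Con (Mem (PairT (Var 2) (Var 4)) 0) (Con (Mem (PairT (Var 2) (Var 5)) 1) \<chi>)"
  let ?argi = "\<lambda>\<chi>. Imp (Mem (PairT (Var 2) (Var 4)) 0) (Imp (Mem (PairT (Var 2) (Var 5)) 1) \<chi>)"
  let ?\<phi> = "LeExN 2 0 (LeExN 3 0 (Con (Eq (Var 0) (PairT (Var 2) (Var 3)))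
      (LeExN 4 1 (LeExN 5 1 (?args (Eq (Var 3) t))))))"
  let ?\<psi> = "LeExN 2 0 (LeExN 3 0 (Con (Eq (Var 0) (PairT (Var 2) (Var 3)))
      (LeAllN 4 1 (LeAllN 5 1 (?argi (Eq (Var 3) t))))))"
  let ?E = "some_assignment(0 := graph f, 1 := graph g)"
  have "dec ?P"
  proof (rule dec_Delta01[of ?\<phi> ?\<psi> ?E _ "\<lambda>_. \<zero>"])
    show "Sigma00 ?\<phi>" "Sigma00 ?\<psi>"
      by (auto intro!: Sigma00.intros)
    show "set_assignment ?E" using assms by (auto intro!: sas simp: recf_def)
    have bd: "\<exists>b. f x \<preceq> b \<and> g x \<preceq> b" for x
      by (intro exI[of _ "f x \<oplus> g x"]) simp
    have "sat ((\<lambda>_. \<zero>)(0 := a, 1 := b)) ?E ?\<phi> \<longleftrightarrow>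
        (\<exists>x y. a = pair x y \<and> f x \<preceq> b \<and> g x \<preceq> b \<and> y = h (f x) (g x))" for a b
      using pair_le1 pair_le2 by (simp add: pair_fold h less_succ_iff del: One_nat_def) blast
    then show "?P a = (\<exists>b. sat ((\<lambda>_. \<zero>)(0 := a, 1 := b)) ?E ?\<phi>)" for a
      using bd by (simp only:) blast
    have "sat ((\<lambda>_. \<zero>)(0 := a, 1 := b)) ?E ?\<psi> \<longleftrightarrow>
        (\<exists>x y. a = pair x y \<and> (f x \<preceq> b \<longrightarrow> g x \<preceq> b \<longrightarrow> y = h (f x) (g x)))" for a b
      using pair_le1 pair_le2 by (simp add: pair_fold h less_succ_iff del: One_nat_def) blast
    then show "?P a = (\<forall>b. sat ((\<lambda>_. \<zero>)(0 := a, 1 := b)) ?E ?\<psi>)" for a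
      using bd by (simp only:) (metis pair_inject)
  qed
  then show ?thesis by (simp add: recf_def graph_def dec_def h_def)
qed

lemma recf_add [recs]: "\<lbrakk>recf f; recf g\<rbrakk> \<Longrightarrow> recf (\<lambda>x. f x \<oplus> g x)"
  using recf_binop[of f g "Add (Var 4) (Var 5)"] by simp

lemma recf_mul [recs]: "\<lbrakk>recf f; recf g\<rbrakk> \<Longrightarrow> recf (\<lambda>x. f x \<otimes> g x)"
  using recf_binop[of f g "Mul (Var 4) (Var 5)"] by simp

lemma recf_pair [recs]: "\<lbrakk>recf f; recf g\<rbrakk> \<Longrightarrow> recf (\<lambda>x. pair (f x) (g x))"
  using recf_binop[of f g "PairT (Var 4) (Var 5)"] by (simp add: pair_def)

lemma recf_Sigma00:
  assumes "Sigma00 \<phi>" "\<And>x y b. y = f x \<longleftrightarrow> sat (e(0 := pair x y, 1 := b, 2 := x, 3 := y)) some_assignment \<phi>"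
  shows "recf f"
proof -
  have "dec (\<lambda>z. \<exists>x. z = pair x (f x))"
  proof (rule dec_Sigma00[OF _ set_assignment_some])
    show "Sigma00 (LeExN 2 0 (LeExN 3 0 (Con (Eq (Var 0) (PairT (Var 2) (Var 3))) \<phi>)))"
      using assms(1) by (auto intro!: Sigma00.intros)
    show "(\<exists>x. a = pair x (f x)) \<longleftrightarrow> sat (e(0 := a, 1 := b)) some_assignment
      (LeExN 2 0 (LeExN 3 0 (Con (Eq (Var 0) (PairT (Var 2) (Var 3))) \<phi>)))" for a b
      using assms(2) by (auto simp: pair_fold)
  qed
  then show ?thesis by (simp add: recf_def graph_def dec_def)
qed

lemma recf_id [recs]: "recf (\<lambda>x. x)"
  by (rule recf_Sigma00[of "Eq (Var 2) (Var 3)"]) (auto intro!: Sigma00.intros)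

lemma recf_const [recs]: "recf (\<lambda>x. c)"
  by (rule recf_Sigma00[of "Eq (Var 3) (Var 4)" _ "\<lambda>_. c"]) (auto intro!: Sigma00.intros)

lemma p1_iff: "y = p1 x \<longleftrightarrow> (\<exists>n. x = pair y n) \<or> \<not> (\<exists>m n. x = pair m n) \<and> y = \<zero>"
  by (cases "\<exists>m n. x = pair m n") (auto simp: p1_def)

lemma p2_iff: "y = p2 x \<longleftrightarrow> (\<exists>m. x = pair m y) \<or> \<not> (\<exists>m n. x = pair m n) \<and> y = \<zero>"
  by (cases "\<exists>m n. x = pair m n") (auto simp: p2_def)

lemma recf_p1': "recf p1"
  apply (rule recf_Sigma00[of "Dis (LeExN 4 2 (Eq (Var 2) (PairT (Var 3) (Var 4))))
     (Con (Neg (LeExN 4 2 (LeExN 5 2 (Eq (Var 2) (PairT (Var 4) (Var 5)))))) (Eq (Var 3) Zero))"])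
   apply (auto intro!: Sigma00.intros)[1]
  apply (subst p1_iff)
  by (auto simp: pair_fold) (metis less_succ_pair)+

lemma recf_p2': "recf p2"
  apply (rule recf_Sigma00[of "Dis (LeExN 4 2 (Eq (Var 2) (PairT (Var 4) (Var 3))))
     (Con (Neg (LeExN 4 2 (LeExN 5 2 (Eq (Var 2) (PairT (Var 4) (Var 5)))))) (Eq (Var 3) Zero))"])
   apply (auto intro!: Sigma00.intros)[1]
  apply (subst p2_iff)
  by (auto simp: pair_fold) (metis less_succ_pair)+

lemma dec_less [recs]:
  assumes "recf f" "recf g"
  shows "dec (\<lambda>x. f x \<prec> g x)"
proof -
  have "dec (\<lambda>z. \<exists>x y. z = pair x y \<and> x \<prec> y)"
    apply (rule dec_Sigma00[of "LeExN 2 0 (LeExN 3 0 (Con (Eq (Var 0) (PairT (Var 2) (Var 3))) (Less (Var 2) (Var 3))))"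
      some_assignment])
    by (auto intro!: Sigma00.intros sas simp: pair_fold)
  from dec_comp[OF this recf_pair[OF assms]] show ?thesis by simp
qed

lemma dec_le [recs]: "\<lbrakk>recf f; recf g\<rbrakk> \<Longrightarrow> dec (\<lambda>x. f x \<preceq> g x)"
  unfolding le_def by (intro recs)

lemma dec_is_pair: "dec (\<lambda>z. \<exists>m n. z = pair m n)"
proof -
  have "(\<exists>m n. z = pair m n) \<longleftrightarrow> z = pair (p1 z) (p2 z)" for z by auto
  then show ?thesis using dec_eq[OF recf_id recf_pair[OF recf_p1' recf_p2']] by simp
qed

lemma recf_graph:
  assumes "dec (\<lambda>z. R (p1 z) (p2 z))" "\<And>x y. R x y \<longleftrightarrow> y = f x"
  shows "recf f"
proof -
  have "(\<exists>x. z = pair x (f x)) \<longleftrightarrow> (\<exists>m n. z = pair m n) \<and> R (p1 z) (p2 z)" for z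
    using assms(2) by auto
  then have "dec (\<lambda>z. \<exists>x. z = pair x (f x))"
    using dec_conj[OF dec_is_pair assms(1)] by simp
  then show ?thesis by (simp add: recf_def graph_def dec_def)
qed

lemma recf_comp:
  assumes "recf f" "recf g"
  shows "recf (\<lambda>x. f (g x))"
proof -
  let ?\<phi> = "\<lambda>c. LeExN 2 0 (LeExN 3 0 (Con (Eq (Var 0) (PairT (Var 2) (Var 3)))
      (c (Mem (PairT (Var 2) (Var 1)) 0) (Mem (PairT (Var 1) (Var 3)) 1))))"
  have "dec (\<lambda>z. \<exists>x. z = pair x (f (g x)))"
  proof (rule dec_Delta01[of "?\<phi> Con" "?\<phi> Imp" "some_assignment(0 := graph g, 1 := graph f)" _ "\<lambda>_. \<zero>"])
    show "Sigma00 (?\<phi> Con)" "Sigma00 (?\<phi> Imp)"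
      by (auto intro!: Sigma00.intros)
    show "set_assignment (some_assignment(0 := graph g, 1 := graph f))"
      using assms by (auto intro!: sas simp: recf_def)
  qed (auto simp: pair_fold, metis pair_inject)
  then show ?thesis by (simp add: recf_def graph_def dec_def)
qed

lemma recf_p1 [recs]: "recf f \<Longrightarrow> recf (\<lambda>x. p1 (f x))"
  and recf_p2 [recs]: "recf f \<Longrightarrow> recf (\<lambda>x. p2 (f x))"
  using recf_comp recf_p1' recf_p2' by blast+

text \<open>Under a bounded quantifier the argument becomes the pair of the old argument and the
  bound variable. A function from a hypothesis then occurs composed with the first
  projection.\<close>

lemma recf_comp_p1: "\<lbrakk>recf f; recf g\<rbrakk> \<Longrightarrow> recf (\<lambda>x. f (p1 (g x)))"
  by (rule recf_comp[OF _ recf_p1])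

lemma dec_ball_le [recs]:
  assumes "dec (\<lambda>z. Q (p1 z) (p2 z))" "recf f"
  shows "dec (\<lambda>x. \<forall>y. y \<preceq> f x \<longrightarrow> Q x y)"
  using dec_ball_less[OF assms(1) recf_add[OF assms(2) recf_const, of \<one>]] by (simp add: less_succ_iff)

lemma dec_bex_le [recs]:
  assumes "dec (\<lambda>z. Q (p1 z) (p2 z))" "recf f"
  shows "dec (\<lambda>x. \<exists>y. y \<preceq> f x \<and> Q x y)"
  using dec_bex_less[OF assms(1) recf_add[OF assms(2) recf_const, of \<one>]] by (simp add: less_succ_iff)

lemma dec_fin_ball [recs]:
  assumes "fin_set X" "X \<in> Sets" "dec (\<lambda>z. Q (p1 z) (p2 z))"
  shows "dec (\<lambda>x. \<forall>y\<in>X. Q x y)"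
proof -
  obtain k where k: "\<forall>i\<in>X. i \<prec> k" using assms(1) by (auto simp: fin_set_def)
  have "dec (\<lambda>x. \<forall>y. y \<prec> k \<longrightarrow> y \<in> X \<longrightarrow> Q x y)"
    by (intro recs assms)
  moreover have "(\<forall>y. y \<prec> k \<longrightarrow> y \<in> X \<longrightarrow> Q x y) \<longleftrightarrow> (\<forall>y\<in>X. Q x y)" for x using k by blast
  ultimately show ?thesis by simp
qed

lemma dec_fin_bex [recs]:
  assumes "fin_set X" "X \<in> Sets" "dec (\<lambda>z. Q (p1 z) (p2 z))"
  shows "dec (\<lambda>x. \<exists>y\<in>X. Q x y)"
  using dec_not[OF dec_fin_ball[OF assms(1,2) dec_not[OF assms(3)]]] by simp

lemma dec_section2:
  assumes "dec (\<lambda>z. Q (p1 z) (p2 z))" "recf f" "recf g"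
  shows "dec (\<lambda>x. Q (f x) (g x))"
  using dec_comp[OF assms(1) recf_pair[OF assms(2,3)]] by simp

section \<open>Induction, least elements and uniformization\<close>

lemma sig_induct:
  assumes "dec (\<lambda>z. Q (p1 z) (p2 z))"
    and "\<exists>y. Q \<zero> y" "\<And>a. \<exists>y. Q a y \<Longrightarrow> \<exists>y. Q (a \<oplus> \<one>) y"
  shows "\<exists>y. Q b y"
proof -
  let ?E = "some_assignment(0 := {z. Q (p1 z) (p2 z)})"
  let ?\<phi> = "ExN 1 (Mem (PairT (Var 0) (Var 1)) 0)"
  have E: "set_assignment ?E" using assms(1) by (intro sas) (simp add: dec_def)
  have S: "Sigma01 ?\<phi>" by (intro Sigma01_ExN Sigma00.intros)
  have sat: "sat (e(0 := a)) ?E ?\<phi> \<longleftrightarrow> (\<exists>y. Q a y)" for e a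
    by (simp add: pair_fold)
  show ?thesis
    using Sigma01_induction[OF S E, of "\<lambda>_. \<zero>" 0 b] assms(2,3) unfolding sat by blast
qed

lemma dec_induct [consumes 1, case_names zero succ]:
  assumes "dec P" "P \<zero>" "\<And>a. P a \<Longrightarrow> P (a \<oplus> \<one>)"
  shows "P b"
  using sig_induct[where Q = "\<lambda>x y. P x" and b = b] dec_comp[OF assms(1) recf_p1'] assms(2,3) by blast

lemma dec_less_induct [consumes 1, case_names less]:
  assumes "dec P" "\<And>a. (\<And>b. b \<prec> a \<Longrightarrow> P b) \<Longrightarrow> P a"
  shows "P b"
proof -
  have "dec (\<lambda>a. \<forall>b. b \<prec> a \<longrightarrow> P b)"
    by (intro recs dec_comp[OF assms(1)])
  then have "\<forall>c. c \<prec> b \<oplus> \<one> \<longrightarrow> P c"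
    by (induct rule: dec_induct) (auto simp: not_less_zero less_succ assms(2))
  then show ?thesis using less_succ by blast
qed

lemma dec_least:
  assumes "dec P" "P b"
  obtains a where "P a" "a \<preceq> b" "\<And>c. P c \<Longrightarrow> a \<preceq> c"
proof -
  have "\<exists>a. P a \<and> (\<forall>c. c \<prec> a \<longrightarrow> \<not> P c)"
    using dec_less_induct[OF dec_not[OF assms(1)], of b] assms(2) by blast
  then show thesis using that ar.not_le assms(2) by metis
qed

lemma recf_least:
  assumes "dec (\<lambda>z. Q (p1 z) (p2 z))" "\<And>x. Q x (f x)" "\<And>x y. Q x y \<Longrightarrow> f x \<preceq> y"
  shows "recf f"
proof (rule recf_graph)
  show "dec (\<lambda>z. Q (p1 z) (p2 z) \<and> (\<forall>y. y \<prec> p2 z \<longrightarrow> \<not> Q (p1 z) y))"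
    by (intro recs assms(1) dec_section2[where Q = Q, OF assms(1)])
  show "Q x y \<and> (\<forall>y'. y' \<prec> y \<longrightarrow> \<not> Q x y') \<longleftrightarrow> y = f x" for x y
    using assms(2,3) by (metis le_antisym ar.not_le)
qed

text \<open>Decidability provides least witnesses and makes the graph of the least witness
  decidable, so no choice principle inside the structure is required.\<close>

lemma recf_uniformize:
  assumes "dec (\<lambda>z. Q (p1 z) (p2 z))" "\<And>x. \<exists>y. Q x y"
  obtains f where "recf f" "\<And>x. Q x (f x)"
proof -
  have "\<exists>a. Q x a \<and> (\<forall>c. Q x c \<longrightarrow> a \<preceq> c)" for x
  proof -
    have "dec (\<lambda>y. Q x y)" by (rule dec_section2[OF assms(1)]) (intro recs)+
    then show ?thesis using assms(2)[of x] by (metis dec_least)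
  qed
  then obtain f where "\<And>x. Q x (f x) \<and> (\<forall>c. Q x c \<longrightarrow> f x \<preceq> c)" by metis
  then show thesis using recf_least[OF assms(1), of f] that by blast
qed

lemma recf_if [recs]:
  assumes "dec P" "recf f" "recf g"
  shows "recf (\<lambda>x. if P x then f x else g x)"
proof (rule recf_graph)
  show "dec (\<lambda>z. P (p1 z) \<and> p2 z = f (p1 z) \<or> \<not> P (p1 z) \<and> p2 z = g (p1 z))"
    by (intro recs dec_comp[OF assms(1)] recf_comp[OF assms(2)] recf_comp[OF assms(3)])
qed auto

lemma dec_Sets: "dec P \<Longrightarrow> {x. P x} \<in> Sets"
  by (simp add: dec_def)

lemma dec_sect [recs]: "\<lbrakk>A \<in> Sets; recf f; recf g\<rbrakk> \<Longrightarrow> dec (\<lambda>x. f x \<in> sect A (g x))"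
  unfolding sect_def mem_Collect_eq by (intro recs)

lemma UNIV_Sets: "UNIV \<in> Sets"
  using dec_const[of True] by (simp add: dec_def)

lemma pprod_Sets: "\<lbrakk>B \<in> Sets; C \<in> Sets\<rbrakk> \<Longrightarrow> pprod B C \<in> Sets"
proof -
  assume "B \<in> Sets" "C \<in> Sets"
  then have "dec (\<lambda>z. (\<exists>m n. z = pair m n) \<and> p1 z \<in> B \<and> p2 z \<in> C)"
    by (intro recs dec_is_pair)
  moreover have "(\<exists>m n. z = pair m n) \<and> p1 z \<in> B \<and> p2 z \<in> C \<longleftrightarrow> z \<in> pprod B C" for z
    by (auto simp: pprod_def)
  ultimately show ?thesis by (simp add: dec_def)
qed

lemma pair_in_pprod [simp]: "pair x y \<in> pprod B C \<longleftrightarrow> x \<in> B \<and> y \<in> C"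
  by (auto simp: pprod_def)

lemma fin_set_less: "fin_set {i. i \<prec> n}"
  by (auto simp: fin_set_def)

section \<open>Coding of finite sets\<close>

lemma dvd_iff: "ar.dvd a b \<longleftrightarrow> (\<exists>q. b = a \<otimes> q)"
  by (simp add: ar.dvd_def)

text \<open>The bound on the quotient makes divisibility decidable. If \<open>a\<close> is zero, any
  quotient can be replaced by zero.\<close>

lemma dvd_iff_bounded: "ar.dvd a b \<longleftrightarrow> (\<exists>q. q \<preceq> b \<and> b = a \<otimes> q)"
proof
  assume "ar.dvd a b"
  then obtain q where q: "b = a \<otimes> q" unfolding dvd_iff by blast
  show "\<exists>q. q \<preceq> b \<and> b = a \<otimes> q"
  proof (cases "a = \<zero>")
    case True
    then show ?thesis using q by (intro exI[of _ \<zero>]) simp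
  next
    case False
    then have "\<zero> \<prec> a" by (simp add: ar.less_le)
    then show ?thesis using q le_mult_pos by blast
  qed
qed (auto simp: dvd_iff)

lemma dec_dvd [recs]:
  assumes "recf f" "recf g"
  shows "dec (\<lambda>x. ar.dvd (f x) (g x))"
  unfolding dvd_iff_bounded by (intro recs assms assms[THEN recf_comp_p1])

lemma division:
  assumes "\<zero> \<prec> b"
  obtains q r where "a = b \<otimes> q \<oplus> r" "r \<prec> b"
proof -
  have "\<exists>q. q \<preceq> a \<and> (\<exists>r. r \<prec> b \<and> a = b \<otimes> q \<oplus> r)"
  proof (rule dec_induct[where P = "\<lambda>a. \<exists>q. q \<preceq> a \<and> (\<exists>r. r \<prec> b \<and> a = b \<otimes> q \<oplus> r)"])
    show "dec (\<lambda>a. \<exists>q. q \<preceq> a \<and> (\<exists>r. r \<prec> b \<and> a = b \<otimes> q \<oplus> r))"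
      by (intro recs)
    show "\<exists>q. q \<preceq> \<zero> \<and> (\<exists>r. r \<prec> b \<and> \<zero> = b \<otimes> q \<oplus> r)"
      using assms by (intro exI[of _ \<zero>]) auto
    fix a assume "\<exists>q. q \<preceq> a \<and> (\<exists>r. r \<prec> b \<and> a = b \<otimes> q \<oplus> r)"
    then obtain q r where qr: "q \<preceq> a" "r \<prec> b" "a = b \<otimes> q \<oplus> r" by blast
    show "\<exists>q. q \<preceq> a \<oplus> \<one> \<and> (\<exists>r. r \<prec> b \<and> a \<oplus> \<one> = b \<otimes> q \<oplus> r)"
    proof (cases "r \<oplus> \<one> \<prec> b")
      case True
      moreover have "a \<oplus> \<one> = b \<otimes> q \<oplus> (r \<oplus> \<one>)" using qr(3) by (simp add: ar.add.assoc)
      moreover have "q \<preceq> a \<oplus> \<one>" using qr(1) le_add1 by (rule ar.order_trans)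
      ultimately show ?thesis by blast
    next
      case False
      then have "r \<oplus> \<one> = b" using qr(2) by (metis le_def succ_le_iff)
      then have "a \<oplus> \<one> = b \<otimes> (q \<oplus> \<one>) \<oplus> \<zero>"
        using qr(3) by (simp add: mul_succ ar.add.assoc add_zero)
      moreover have "q \<oplus> \<one> \<preceq> a \<oplus> \<one>" using qr(1) by simp
      ultimately show ?thesis using assms by blast
    qed
  qed
  then show thesis using that by blast
qed

text \<open>Goedel's moduli: those with indices below \<open>b\<close> behave as pairwise coprime
  once every positive number up to \<open>b\<close> divides \<open>m\<close>.\<close>

definition beta :: "'a \<Rightarrow> 'a \<Rightarrow> 'a" where
  "beta m i = m \<otimes> (i \<oplus> \<one>) \<oplus> \<one>"

lemma elems_pair: "i \<in> elems (pair k (pair m n)) \<longleftrightarrow> i \<prec> k \<and> ar.dvd (beta m i) n"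
  by (auto simp: elems_def dvd_iff beta_def)

text \<open>A substitute for the factorial of \<open>b\<close>, built by \<Sigma>1
  induction.\<close>

lemma common_multiple: "\<exists>m. \<zero> \<prec> m \<and> (\<forall>j. j \<preceq> b \<longrightarrow> \<zero> \<prec> j \<longrightarrow> ar.dvd j m)"
proof (rule sig_induct[where b = b and Q = "\<lambda>b m. \<zero> \<prec> m \<and> (\<forall>j. j \<preceq> b \<longrightarrow> \<zero> \<prec> j \<longrightarrow> ar.dvd j m)"])
  show "dec (\<lambda>z. \<zero> \<prec> p2 z \<and> (\<forall>j. j \<preceq> p1 z \<longrightarrow> \<zero> \<prec> j \<longrightarrow> ar.dvd j (p2 z)))"
    by (intro recs)
  show "\<exists>m. \<zero> \<prec> m \<and> (\<forall>j. j \<preceq> \<zero> \<longrightarrow> \<zero> \<prec> j \<longrightarrow> ar.dvd j m)"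
    by (intro exI[of _ \<one>]) auto
  fix b assume "\<exists>m. \<zero> \<prec> m \<and> (\<forall>j. j \<preceq> b \<longrightarrow> \<zero> \<prec> j \<longrightarrow> ar.dvd j m)"
  then obtain m where m: "\<zero> \<prec> m" "\<And>j. j \<preceq> b \<Longrightarrow> \<zero> \<prec> j \<Longrightarrow> ar.dvd j m" by blast
  have "\<zero> \<prec> m \<otimes> (b \<oplus> \<one>)" using m(1) by (simp add: less_succ_iff)
  moreover have "ar.dvd j (m \<otimes> (b \<oplus> \<one>))" if "j \<preceq> b \<oplus> \<one>" "\<zero> \<prec> j" for j
    using that m(2)[of j] by (auto simp: le_def less_succ)
  ultimately show "\<exists>m. \<zero> \<prec> m \<and> (\<forall>j. j \<preceq> b \<oplus> \<one> \<longrightarrow> \<zero> \<prec> j \<longrightarrow> ar.dvd j m)"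
    by blast
qed

text \<open>Euclid's lemma without greatest common divisors. The products of each modulus with the
  successor of the other index differ exactly by the distance \<open>d\<close> of the indices, so
  \<open>beta m i\<close> divides \<open>n \<otimes> d\<close>. As \<open>d\<close> divides
  \<open>m\<close> and \<open>beta m i\<close> is one more than a multiple of \<open>m\<close>, the
  factor \<open>d\<close> can be cancelled.\<close>

lemma beta_coprime:
  assumes m: "\<And>j. j \<preceq> b \<Longrightarrow> \<zero> \<prec> j \<Longrightarrow> ar.dvd j m"
    and "i \<prec> b" "j \<prec> b" "i \<noteq> j" "ar.dvd (beta m i) (n \<otimes> beta m j)"
  shows "ar.dvd (beta m i) n"
proof -
  have cross: "(j \<oplus> \<one>) \<otimes> beta m i \<oplus> i = (i \<oplus> \<one>) \<otimes> beta m j \<oplus> j" for i j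
    by (simp add: beta_def ar.distrib_left ar.distrib_right ar.add_ac ar.mult_ac)
  have "\<exists>d. \<zero> \<prec> d \<and> d \<preceq> b \<and> ar.dvd (beta m i) (n \<otimes> d)"
  proof (cases "i \<prec> j")
    case True
    then obtain d where d: "j = i \<oplus> d" "\<zero> \<prec> d"
      by (metis add_zero ar.less_le le_iff zero_le)
    have "(j \<oplus> \<one>) \<otimes> beta m i = (i \<oplus> \<one>) \<otimes> beta m j \<oplus> d"
      using cross[of j i] unfolding d(1) by (metis add_assoc add_cancel add_comm)
    then have "n \<otimes> (j \<oplus> \<one>) \<otimes> beta m i = (i \<oplus> \<one>) \<otimes> (n \<otimes> beta m j) \<oplus> n \<otimes> d"
      by (metis distrib mul_assoc mul_comm)
    then have "ar.dvd (beta m i) (n \<otimes> d)"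
      by (metis assms(5) ar.dvd_add_right_iff ar.dvd_mult ar.dvd_triv_right)
    then show ?thesis using d \<open>j \<prec> b\<close> by (metis ar.le_less_trans ar.less_imp_le le_add2)
  next
    case False
    then have "j \<prec> i" using assms(4) less_linear by blast
    then obtain d where d: "i = j \<oplus> d" "\<zero> \<prec> d"
      by (metis add_zero ar.less_le le_iff zero_le)
    have "(i \<oplus> \<one>) \<otimes> beta m j = (j \<oplus> \<one>) \<otimes> beta m i \<oplus> d"
      using cross[of j i] unfolding d(1) by (metis add_assoc add_cancel add_comm)
    then have "(i \<oplus> \<one>) \<otimes> (n \<otimes> beta m j) = n \<otimes> (j \<oplus> \<one>) \<otimes> beta m i \<oplus> n \<otimes> d"
      by (metis distrib mul_assoc mul_comm)
    then have "ar.dvd (beta m i) (n \<otimes> d)"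
      by (metis assms(5) ar.dvd_add_right_iff ar.dvd_mult ar.dvd_triv_right)
    then show ?thesis using d \<open>i \<prec> b\<close> by (metis ar.le_less_trans ar.less_imp_le le_add2)
  qed
  then obtain d where "\<zero> \<prec> d" "d \<preceq> b" and d: "ar.dvd (beta m i) (n \<otimes> d)" by blast
  then obtain q where q: "m = d \<otimes> q" using m dvd_iff by blast
  have "n \<otimes> d \<otimes> (q \<otimes> (i \<oplus> \<one>)) \<oplus> n = n \<otimes> beta m i"
    by (simp add: q beta_def distrib mul_assoc mul_one_right)
  moreover have "ar.dvd (beta m i) (n \<otimes> d \<otimes> (q \<otimes> (i \<oplus> \<one>)))"
    using d by (rule ar.dvd_mult2)
  ultimately show ?thesis
    by (metis ar.dvd_add_right_iff ar.dvd_triv_right)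
qed

text \<open>At stage \<open>c\<close> the product is multiplied by \<open>beta m c\<close> if
  \<open>c\<close> belongs to \<open>T\<close>. By \<open>beta_coprime\<close> this creates no other
  divisor among the moduli below \<open>b\<close>. The bound \<open>b\<close> stays fixed during the
  induction so that \<open>m\<close> remains suitable.\<close>

lemma beta_product:
  assumes m: "\<zero> \<prec> m" "\<And>j. j \<preceq> b \<Longrightarrow> \<zero> \<prec> j \<Longrightarrow> ar.dvd j m" and T: "T \<in> Sets"
  shows "\<exists>n. \<zero> \<prec> n \<and> (\<forall>i. i \<prec> b \<longrightarrow> ar.dvd (beta m i) n \<longleftrightarrow> i \<in> T \<and> i \<prec> c)"
proof (rule sig_induct[where b = c and Q = "\<lambda>c n. \<zero> \<prec> n \<and> (\<forall>i. i \<prec> b \<longrightarrow> ar.dvd (beta m i) n \<longleftrightarrow> i \<in> T \<and> i \<prec> c)"])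
  show "dec (\<lambda>z. \<zero> \<prec> p2 z \<and> (\<forall>i. i \<prec> b \<longrightarrow> ar.dvd (beta m i) (p2 z) \<longleftrightarrow> i \<in> T \<and> i \<prec> p1 z))"
    unfolding beta_def by (intro recs T)
  have "\<not> ar.dvd (beta m i) \<one>" for i
  proof
    assume "ar.dvd (beta m i) \<one>"
    then obtain q where q: "\<one> = beta m i \<otimes> q" unfolding dvd_iff by blast
    then have "\<zero> \<prec> q" using mul_zero[of "beta m i"] ar.zero_neq_one by (cases "q = \<zero>") (auto simp: ar.less_le)
    then have "beta m i \<preceq> \<one>" using le_mult_pos[of q "beta m i"] q by (simp add: mul_comm)
    then have "m \<otimes> (i \<oplus> \<one>) = \<zero>" by (simp add: beta_def)
    then have "m = \<zero>" using mul_eq_0 succ_nonzero by blast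
    then show False using m(1) less_irrefl by blast
  qed
  then show "\<exists>n. \<zero> \<prec> n \<and> (\<forall>i. i \<prec> b \<longrightarrow> ar.dvd (beta m i) n \<longleftrightarrow> i \<in> T \<and> i \<prec> \<zero>)"
    by (intro exI[of _ \<one>]) (auto simp: not_less_zero)
  fix c assume "\<exists>n. \<zero> \<prec> n \<and> (\<forall>i. i \<prec> b \<longrightarrow> ar.dvd (beta m i) n \<longleftrightarrow> i \<in> T \<and> i \<prec> c)"
  then obtain n where n: "\<zero> \<prec> n" "\<And>i. i \<prec> b \<Longrightarrow> ar.dvd (beta m i) n \<longleftrightarrow> i \<in> T \<and> i \<prec> c" by blast
  show "\<exists>n. \<zero> \<prec> n \<and> (\<forall>i. i \<prec> b \<longrightarrow> ar.dvd (beta m i) n \<longleftrightarrow> i \<in> T \<and> i \<prec> c \<oplus> \<one>)"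
  proof (cases "c \<in> T \<and> c \<prec> b")
    case True
    have "\<zero> \<prec> n \<otimes> beta m c" using n(1) by (simp add: beta_def less_succ_iff)
    moreover have "ar.dvd (beta m i) (n \<otimes> beta m c) \<longleftrightarrow> i \<in> T \<and> i \<prec> c \<oplus> \<one>" if "i \<prec> b" for i
    proof (cases "i = c")
      case True
      then show ?thesis using \<open>c \<in> T \<and> c \<prec> b\<close> by (simp add: less_succ)
    next
      case False
      then show ?thesis
        using n(2)[OF that] beta_coprime[OF m(2) that, of c n] True ar.dvd_mult2[of "beta m i" n "beta m c"]
        unfolding less_succ by blast
    qed
    ultimately show ?thesis by blast
  next
    case False
    then show ?thesis using n by (auto simp: less_succ)
  qed
qed

lemma elems_less: "i \<in> elems c \<Longrightarrow> i \<prec> c"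
  unfolding elems_def using pair_le1 ar.less_le_trans by blast

lemma elems_iff: "i \<in> elems c \<longleftrightarrow> is_triple c \<and> i \<prec> p1 c \<and> ar.dvd (beta (p1 (p2 c)) i) (p2 (p2 c))"
  by (auto simp: elems_def dvd_iff is_triple_def beta_def)

lemma is_triple_iff: "is_triple c \<longleftrightarrow> c = pair (p1 c) (pair (p1 (p2 c)) (p2 (p2 c)))"
  by (auto simp: is_triple_def)

lemma dec_is_triple [recs]:
  assumes "recf f"
  shows "dec (\<lambda>x. is_triple (f x))"
  unfolding is_triple_iff by (intro recs assms)

lemma dec_elems [recs]:
  assumes "recf f" "recf g"
  shows "dec (\<lambda>x. f x \<in> elems (g x))"
  unfolding elems_iff beta_def by (intro recs assms)

lemma elems_eq_iff: "elems c = elems d \<longleftrightarrow> (\<forall>i. i \<prec> c \<oplus> d \<longrightarrow> (i \<in> elems c \<longleftrightarrow> i \<in> elems d))"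
  using elems_less ar.less_le_trans[OF _ le_add1] ar.less_le_trans[OF _ le_add2] by blast

lemma dec_elems_eq [recs]:
  assumes "recf f" "recf g"
  shows "dec (\<lambda>x. elems (f x) = elems (g x))"
  unfolding elems_eq_iff by (intro recs assms assms[THEN recf_comp_p1])

lemma fin_code_iff: "fin_code c \<longleftrightarrow> is_triple c \<and> (\<forall>d. d \<prec> c \<longrightarrow> \<not> (is_triple d \<and> elems d = elems c))"
  unfolding fin_code_def using ar.not_le by blast

lemma dec_fin_code [recs]:
  assumes "recf f"
  shows "dec (\<lambda>x. fin_code (f x))"
  unfolding fin_code_iff by (intro recs assms assms[THEN recf_comp_p1])

lemma fin_code_unique: "\<lbrakk>fin_code c; fin_code d; elems c = elems d\<rbrakk> \<Longrightarrow> c = d"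
  unfolding fin_code_def using le_antisym by metis

definition beta_multiple :: "'a \<Rightarrow> 'a \<Rightarrow> 'a set \<Rightarrow> 'a \<Rightarrow> bool" where
  "beta_multiple b m T n \<longleftrightarrow> \<zero> \<prec> n \<and> (\<forall>i. i \<prec> b \<longrightarrow> i \<in> T \<longrightarrow> ar.dvd (beta m i) n)"

text \<open>The product from \<open>beta_product\<close> has exactly the moduli of \<open>T\<close>
  as divisors. Dividing it by the least multiple leaves a remainder that would be a smaller multiple
  unless it is zero. So the least multiple divides the product and inherits having no further moduli
  as divisors.\<close>

lemma least_beta_multiple:
  assumes m: "\<zero> \<prec> m" "\<And>j. j \<preceq> b \<Longrightarrow> \<zero> \<prec> j \<Longrightarrow> ar.dvd j m" and T: "T \<in> Sets"
  obtains n where "beta_multiple b m T n" "\<And>n'. beta_multiple b m T n' \<Longrightarrow> n \<preceq> n'"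
    "\<And>i. i \<prec> b \<Longrightarrow> ar.dvd (beta m i) n \<Longrightarrow> i \<in> T"
proof -
  obtain n' where n': "\<zero> \<prec> n'" "\<And>i. i \<prec> b \<Longrightarrow> ar.dvd (beta m i) n' \<longleftrightarrow> i \<in> T"
    using beta_product[of m b T b, OF m T] by auto
  have D: "dec (\<lambda>n. beta_multiple b m T n)" unfolding beta_multiple_def beta_def by (intro recs T)
  have "beta_multiple b m T n'" using n' by (simp add: beta_multiple_def)
  from dec_least[OF D this] obtain n where n: "beta_multiple b m T n" "\<And>n'. beta_multiple b m T n' \<Longrightarrow> n \<preceq> n'"
    by metis
  have "\<zero> \<prec> n" using n(1) by (simp add: beta_multiple_def)
  then obtain q r where qr: "n' = n \<otimes> q \<oplus> r" "r \<prec> n" using division by metis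
  have "ar.dvd (beta m i) r" if "i \<prec> b" "i \<in> T" for i
  proof -
    have "ar.dvd (beta m i) (n \<otimes> q)" using that n(1) ar.dvd_mult2 unfolding beta_multiple_def by metis
    moreover have "ar.dvd (beta m i) (n \<otimes> q \<oplus> r)" using that n'(2)[of i] qr(1) by simp
    ultimately show ?thesis by (simp only: ar.dvd_add_right_iff)
  qed
  moreover have "\<not> n \<preceq> r" using qr(2) by (simp add: ar.not_le)
  ultimately have "\<not> \<zero> \<prec> r" using n(2)[of r] unfolding beta_multiple_def by metis
  then have "r = \<zero>" using zero_le[of r] by (simp add: le_def)
  then have "n' = n \<otimes> q" using qr(1) by (simp only: add_zero)
  then have dvd: "ar.dvd n n'" unfolding dvd_iff by (rule exI)
  have "i \<in> T" if i: "i \<prec> b" "ar.dvd (beta m i) n" for i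
    using ar.dvd_trans[OF i(2) dvd] n'(2)[OF i(1)] by simp
  from that[OF n this] show thesis .
qed

text \<open>
  Taking the least number divisible by all \<open>beta m i\<close> with \<open>i \<in> T\<close> bounds the codes of all
  subsets of \<open>{i. i < b}\<close> simultaneously, without exponentiation.
\<close>

lemma fin_code_bound:
  "\<exists>B. \<forall>T\<in>Sets. (\<forall>i\<in>T. i \<prec> b) \<longrightarrow> (\<exists>c. c \<preceq> B \<and> fin_code c \<and> elems c = T)"
proof -
  obtain m where m: "\<zero> \<prec> m" "\<And>j. j \<preceq> b \<Longrightarrow> \<zero> \<prec> j \<Longrightarrow> ar.dvd j m"
    using common_multiple[of b] by metis
  obtain N where N: "beta_multiple b m UNIV N" using least_beta_multiple[OF m UNIV_Sets] by metis
  show ?thesis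
  proof (rule exI[of _ "pair b (pair m N)"], intro ballI impI)
    fix T assume T: "T \<in> Sets" "\<forall>i\<in>T. i \<prec> b"
    obtain n where n: "beta_multiple b m T n" "\<And>n'. beta_multiple b m T n' \<Longrightarrow> n \<preceq> n'"
        "\<And>i. i \<prec> b \<Longrightarrow> ar.dvd (beta m i) n \<Longrightarrow> i \<in> T"
      using least_beta_multiple[OF m T(1)] by metis
    define c where "c = pair b (pair m n)"
    have elems_c: "elems c = T"
      using n(1,3) T(2) unfolding c_def beta_multiple_def set_eq_iff elems_pair by blast
    have "is_triple c" unfolding is_triple_def c_def by blast
    have D: "dec (\<lambda>d. is_triple d \<and> elems d = elems c)" by (intro recs)
    from \<open>is_triple c\<close> have "is_triple c \<and> elems c = elems c" by simp
    from dec_least[OF D this] obtain d where d: "is_triple d" "elems d = elems c" "d \<preceq> c"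
        "\<And>d'. is_triple d' \<and> elems d' = elems c \<Longrightarrow> d \<preceq> d'"
      by metis
    have "beta_multiple b m T N" using N by (simp add: beta_multiple_def)
    then have "n \<preceq> N" by (rule n(2))
    then have "c \<preceq> pair b (pair m N)" unfolding c_def by (intro pair_mono) auto
    with d(3) have "d \<preceq> pair b (pair m N)" by (rule ar.order_trans)
    moreover have "fin_code d" using d unfolding fin_code_def by simp
    ultimately show "\<exists>c. c \<preceq> pair b (pair m N) \<and> fin_code c \<and> elems c = T"
      using d(2) elems_c by metis
  qed
qed

lemma fin_code_ex: "\<lbrakk>T \<in> Sets; fin_set T\<rbrakk> \<Longrightarrow> \<exists>c. fin_code c \<and> elems c = T"
  using fin_code_bound unfolding fin_set_def by blast

lemma elems_Sets: "elems c \<in> Sets"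
  using dec_elems[OF recf_id recf_const, of c] by (simp add: dec_def)

section \<open>Sequences and cardinalities\<close>

text \<open>Elements of a coded set lie below its code, so every quantifier can be bounded by the
  code or by the length; this is the form that shows decidability.\<close>

lemma is_seq_iff: "is_seq s l \<longleftrightarrow> fin_code s \<and>
  (\<forall>z. z \<prec> s \<longrightarrow> z \<in> elems s \<longrightarrow> (\<exists>i. i \<prec> l \<and> (\<exists>y. y \<prec> s \<and> z = pair i y))) \<and>
  (\<forall>i. i \<prec> l \<longrightarrow> (\<exists>y. y \<prec> s \<and> pair i y \<in> elems s \<and> (\<forall>y'. y' \<prec> s \<longrightarrow> pair i y' \<in> elems s \<longrightarrow> y' = y)))"
  (is "?L \<longleftrightarrow> ?R")
proof -
  have less: "y \<prec> s" if "pair i y \<in> elems s" for i y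
    using elems_less[OF that] pair_le2 ar.le_less_trans by blast
  have "elems s \<subseteq> pprod {i. i \<prec> l} UNIV \<longleftrightarrow>
      (\<forall>z. z \<prec> s \<longrightarrow> z \<in> elems s \<longrightarrow> (\<exists>i. i \<prec> l \<and> (\<exists>y. y \<prec> s \<and> z = pair i y)))" (is "?A \<longleftrightarrow> ?B")
  proof
    assume ?A then show ?B using less unfolding pprod_def by blast
  next
    assume ?B then show ?A using elems_less[of _ s] unfolding pprod_def by blast
  qed
  moreover have "(\<exists>!y. pair i y \<in> elems s) \<longleftrightarrow> (\<exists>y. y \<prec> s \<and> pair i y \<in> elems s \<and>
      (\<forall>y'. y' \<prec> s \<longrightarrow> pair i y' \<in> elems s \<longrightarrow> y' = y))" for i
    using less[of i] by metis
  ultimately show ?thesis unfolding is_seq_def is_fun_def by simp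
qed

lemma dec_is_seq [recs]:
  assumes "recf f" "recf g"
  shows "dec (\<lambda>x. is_seq (f x) (g x))"
  unfolding is_seq_iff by (intro recs assms assms[THEN recf_comp_p1])

lemma is_seq_ex1: "\<lbrakk>is_seq s l; i \<prec> l\<rbrakk> \<Longrightarrow> \<exists>!y. pair i y \<in> elems s"
  by (auto simp: is_seq_def is_fun_def)

lemma entry_iff: "\<lbrakk>is_seq s l; i \<prec> l\<rbrakk> \<Longrightarrow> pair i y \<in> elems s \<longleftrightarrow> y = entry s i"
  unfolding entry_def app_def using theI'[OF is_seq_ex1] is_seq_ex1 by metis

lemma is_seq_pair_less: "\<lbrakk>is_seq s l; pair i y \<in> elems s\<rbrakk> \<Longrightarrow> i \<prec> l"
  by (auto simp: is_seq_def is_fun_def)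

lemma entry_less: "\<lbrakk>is_seq s l; i \<prec> l\<rbrakk> \<Longrightarrow> entry s i \<prec> s"
  using entry_iff[of s l i "entry s i"] elems_less pair_le2 ar.le_less_trans by blast

lemma is_seq_unique: "\<lbrakk>is_seq s l; is_seq s l'\<rbrakk> \<Longrightarrow> l = l'"
proof -
  have "\<not> l \<prec> l'" if "is_seq s l" "is_seq s l'" for l l'
    using is_seq_ex1[OF that(2)] is_seq_pair_less[OF that(1)] less_irrefl by blast
  then show "\<lbrakk>is_seq s l; is_seq s l'\<rbrakk> \<Longrightarrow> l = l'" using less_linear by blast
qed

lemma lh_eq: "is_seq s l \<Longrightarrow> lh s = l"
  unfolding lh_def using is_seq_unique by blast

lemma is_seq_lh: "s \<in> Seq \<Longrightarrow> is_seq s (lh s)"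
  unfolding Seq_def using lh_eq by blast

lemma is_seq_Seq: "is_seq s l \<Longrightarrow> s \<in> Seq"
  unfolding Seq_def by blast

text \<open>The collection principle for recursive functions. The bound is an existential witness,
  so \<Sigma>1 induction applies. It makes the restricted graph in \<open>seq_ex\<close> a finite
  set, which then has a code.\<close>

lemma recf_bounded:
  assumes "recf f"
  shows "\<exists>b. \<forall>i. i \<prec> l \<longrightarrow> f i \<prec> b"
proof (rule sig_induct[where b = l and Q = "\<lambda>l b. \<forall>i. i \<prec> l \<longrightarrow> f i \<prec> b"])
  show "dec (\<lambda>z. \<forall>i. i \<prec> p1 z \<longrightarrow> f i \<prec> p2 z)"
    by (intro recs recf_comp[OF assms])
  show "\<exists>b. \<forall>i. i \<prec> \<zero> \<longrightarrow> f i \<prec> b" by (simp add: not_less_zero)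
  fix l assume "\<exists>b. \<forall>i. i \<prec> l \<longrightarrow> f i \<prec> b"
  then obtain b where b: "\<And>i. i \<prec> l \<Longrightarrow> f i \<prec> b" by blast
  have "f i \<prec> b \<oplus> f l \<oplus> \<one>" if "i \<prec> l \<oplus> \<one>" for i
    using that b[of i] unfolding less_succ_iff[of "f i"] less_succ[of i]
    by (meson ar.less_imp_le ar.order_trans le_add1 le_add2 ar.eq_refl)
  then show "\<exists>b. \<forall>i. i \<prec> l \<oplus> \<one> \<longrightarrow> f i \<prec> b" by blast
qed

lemma seq_ex:
  assumes "recf f"
  obtains s where "is_seq s l" "\<And>i. i \<prec> l \<Longrightarrow> entry s i = f i"
proof -
  obtain b where b: "\<And>i. i \<prec> l \<Longrightarrow> f i \<prec> b" using recf_bounded[OF assms] by metis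
  let ?T = "{z. z \<in> graph f \<and> p1 z \<prec> l}"
  have "graph f \<in> Sets" using assms by (simp add: recf_def)
  then have "?T \<in> Sets" by (intro dec_Sets recs)
  moreover have "fin_set ?T"
    unfolding fin_set_def
  proof (intro exI[of _ "pair l b \<oplus> \<one>"] ballI)
    fix z assume "z \<in> ?T"
    then obtain i where "z = pair i (f i)" "i \<prec> l" by (auto simp: graph_def)
    then show "z \<prec> pair l b \<oplus> \<one>"
      using b[of i] pair_mono[of i l "f i" b] by (simp add: less_succ_iff ar.less_imp_le)
  qed
  ultimately obtain s where s: "fin_code s" "elems s = ?T" using fin_code_ex by blast
  have "is_seq s l"
    unfolding is_seq_def is_fun_def s(2) using s(1) by (auto simp: graph_def)
  moreover from this have "entry s i = f i" if "i \<prec> l" for i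
    using entry_iff[OF _ that, of s "f i"] that by (simp add: s(2))
  ultimately show thesis using that by blast
qed

lemma recf_entry:
  assumes "is_seq s l"
  shows "recf (\<lambda>i. if i \<prec> l then entry s i else d)"
proof (rule recf_graph)
  show "dec (\<lambda>z. p1 z \<prec> l \<and> pair (p1 z) (p2 z) \<in> elems s \<or> \<not> p1 z \<prec> l \<and> p2 z = d)"
    by (intro recs)
  show "i \<prec> l \<and> pair i y \<in> elems s \<or> \<not> i \<prec> l \<and> y = d \<longleftrightarrow> y = (if i \<prec> l then entry s i else d)" for i y
    using entry_iff[OF assms] by auto
qed

text \<open>The bound \<open>b\<close> keeps the quantifier over \<open>Y\<close> bounded, so the
  relation is decidable in \<open>s\<close>, \<open>l\<close> and \<open>b\<close>. For
  \<open>Y = UNIV\<close> it expresses that \<open>s\<close> is a bijection from the numbers below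
  \<open>l\<close> to those below \<open>b\<close>.\<close>

definition enumerates :: "'a set \<Rightarrow> 'a \<Rightarrow> 'a \<Rightarrow> 'a \<Rightarrow> bool" where
  "enumerates Y s l b \<longleftrightarrow> is_seq s l \<and> (\<forall>i. i \<prec> l \<longrightarrow> entry s i \<in> Y \<and> entry s i \<prec> b) \<and>
    (\<forall>y. y \<prec> b \<longrightarrow> y \<in> Y \<longrightarrow> (\<exists>!i. i \<prec> l \<and> entry s i = y))"

lemma dec_enumerates:
  assumes "Y \<in> Sets" "recf f" "recf g" "recf h"
  shows "dec (\<lambda>x. enumerates Y (f x) (g x) (h x))" (is "dec ?P")
proof -
  let ?Q = "\<lambda>s l b. is_seq s l \<and>
    (\<forall>i. i \<prec> l \<longrightarrow> (\<exists>y. y \<prec> b \<and> y \<in> Y \<and> pair i y \<in> elems s)) \<and>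
    (\<forall>y. y \<prec> b \<longrightarrow> y \<in> Y \<longrightarrow> (\<exists>i. i \<prec> l \<and> pair i y \<in> elems s \<and>
       (\<forall>j. j \<prec> l \<longrightarrow> pair j y \<in> elems s \<longrightarrow> j = i)))"
  have "dec (\<lambda>x. ?Q (f x) (g x) (h x))"
    by (intro recs assms assms(2-)[THEN recf_comp_p1])
  moreover have "?P x \<longleftrightarrow> ?Q (f x) (g x) (h x)" for x
  proof (cases "is_seq (f x) (g x)")
    case True
    have 1: "(\<exists>y. y \<prec> h x \<and> y \<in> Y \<and> pair i y \<in> elems (f x)) \<longleftrightarrow> entry (f x) i \<in> Y \<and> entry (f x) i \<prec> h x"
      if "i \<prec> g x" for i
      using entry_iff[OF True that] by auto
    have 2: "(\<exists>!i. i \<prec> g x \<and> entry (f x) i = y) \<longleftrightarrow> (\<exists>i. i \<prec> g x \<and> pair i y \<in> elems (f x) \<and>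
       (\<forall>j. j \<prec> g x \<longrightarrow> pair j y \<in> elems (f x) \<longrightarrow> j = i))" for y
      unfolding Ex1_def using entry_iff[OF True] by auto
    show ?thesis using True 1 2 unfolding enumerates_def by auto
  qed (simp add: enumerates_def)
  ultimately show ?thesis by simp
qed

lemma has_card_iff: "has_card Y n \<longleftrightarrow> (\<exists>s. is_seq s n \<and> (\<forall>i. i \<prec> n \<longrightarrow> entry s i \<in> Y) \<and>
    (\<forall>y\<in>Y. \<exists>!i. i \<prec> n \<and> entry s i = y))"
proof -
  have "s \<in> Seq \<and> lh s = n \<longleftrightarrow> is_seq s n" for s
    using lh_eq is_seq_lh is_seq_Seq by blast
  then show ?thesis by (simp only: has_card_def Bex_def conj_assoc[symmetric])
qed

lemma has_cardI:
  assumes "recf f" "\<And>i. i \<prec> n \<Longrightarrow> f i \<in> Y" "\<And>y. y \<in> Y \<Longrightarrow> \<exists>!i. i \<prec> n \<and> f i = y"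
  shows "has_card Y n"
proof -
  obtain s where "is_seq s n" "\<And>i. i \<prec> n \<Longrightarrow> entry s i = f i" using seq_ex[OF assms(1)] by metis
  moreover from this have "i \<prec> n \<and> entry s i = y \<longleftrightarrow> i \<prec> n \<and> f i = y" for i y by auto
  ultimately show ?thesis unfolding has_card_iff using assms(2,3) by (intro exI[of _ s]) simp
qed

lemma enumerates_snoc:
  assumes Q: "enumerates Y s l c" and "c \<in> Y"
  shows "\<exists>s'. enumerates Y s' (l \<oplus> \<one>) (c \<oplus> \<one>)"
proof -
  have "is_seq s l" using Q by (simp add: enumerates_def)
  \<comment> \<open>With \<open>c\<close> as default value, the function of
    \<open>recf_entry\<close> already takes the value \<open>c\<close> at the new last
    index.\<close>
  from seq_ex[OF recf_entry[OF this, of c], of "l \<oplus> \<one>"] obtain s' where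
    s': "is_seq s' (l \<oplus> \<one>)" "\<And>i. i \<prec> l \<oplus> \<one> \<Longrightarrow> entry s' i = (if i \<prec> l then entry s i else c)"
    by metis
  then have e1: "entry s' i = entry s i" if "i \<prec> l" for i
    using that by (simp add: less_succ)
  have e2: "entry s' l = c" using s'(2)[of l] by simp
  have "entry s' i \<in> Y \<and> entry s' i \<prec> c \<oplus> \<one>" if "i \<prec> l \<oplus> \<one>" for i
    using that Q e1[of i] e2 \<open>c \<in> Y\<close> unfolding less_succ enumerates_def by auto
  moreover have "\<exists>!i. i \<prec> l \<oplus> \<one> \<and> entry s' i = y" if y: "y \<prec> c \<oplus> \<one>" "y \<in> Y" for y
  proof (cases "y = c")
    case True
    have "i = l" if "i \<prec> l \<oplus> \<one>" "entry s' i = y" for i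
      using that e1[of i] Q True unfolding less_succ enumerates_def by (metis less_irrefl)
    then show ?thesis using e2 True by (intro ex1I[of _ l]) auto
  next
    case False
    then have "y \<prec> c" using y by (simp add: less_succ)
    then have "\<exists>!i. i \<prec> l \<and> entry s i = y" using Q y unfolding enumerates_def by blast
    then obtain i where i: "i \<prec> l" "entry s i = y" "\<And>j. j \<prec> l \<Longrightarrow> entry s j = y \<Longrightarrow> j = i" by blast
    have "j = i" if "j \<prec> l \<oplus> \<one>" "entry s' j = y" for j
      using that e1[of j] e2 False i(3)[of j] unfolding less_succ by auto
    then show ?thesis using e1[OF i(1)] i(1,2) by (intro ex1I[of _ i]) (auto simp: less_succ)
  qed
  ultimately show ?thesis using s'(1) unfolding enumerates_def by blast
qed

lemma enumerates_ex:
  assumes "Y \<in> Sets"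
  shows "\<exists>s l. enumerates Y s l b"
proof -
  have "\<exists>w. enumerates Y (p1 w) (p2 w) b"
  proof (rule sig_induct[where b = b and Q = "\<lambda>b w. enumerates Y (p1 w) (p2 w) b"])
    show "dec (\<lambda>z. enumerates Y (p1 (p2 z)) (p2 (p2 z)) (p1 z))"
      by (rule dec_enumerates[OF assms]) (intro recs)+
    obtain s where "is_seq s \<zero>" using seq_ex[OF recf_id] by metis
    then show "\<exists>w. enumerates Y (p1 w) (p2 w) \<zero>"
      by (intro exI[of _ "pair s \<zero>"]) (simp add: enumerates_def not_less_zero)
    fix c assume "\<exists>w. enumerates Y (p1 w) (p2 w) c"
    then obtain s l where Q: "enumerates Y s l c" by metis
    have "\<exists>s l. enumerates Y s l (c \<oplus> \<one>)"
    proof (cases "c \<in> Y")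
      case True
      then show ?thesis using enumerates_snoc[OF Q] by metis
    next
      case False
      then have "enumerates Y s l (c \<oplus> \<one>)" using Q unfolding less_succ enumerates_def by auto
      then show ?thesis by metis
    qed
    then show "\<exists>w. enumerates Y (p1 w) (p2 w) (c \<oplus> \<one>)" by (metis p1_pair p2_pair)
  qed
  then show ?thesis by metis
qed

lemma has_card_ex:
  assumes "Y \<in> Sets" "fin_set Y"
  obtains n where "has_card Y n"
proof -
  obtain b where b: "\<And>i. i \<in> Y \<Longrightarrow> i \<prec> b" using assms(2) fin_set_def by metis
  obtain s l where "enumerates Y s l b" using enumerates_ex[OF assms(1)] by metis
  then have "has_card Y l" unfolding has_card_iff enumerates_def using b by (intro exI[of _ s]) auto
  then show thesis by (rule that)
qed

text \<open>The index that is mapped to \<open>b\<close> takes over the value of the last index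
  \<open>a\<close>, and then \<open>a\<close> is dropped.\<close>

lemma bijection_pred:
  assumes "enumerates UNIV s (a \<oplus> \<one>) (b \<oplus> \<one>)"
  shows "\<exists>s. enumerates UNIV s a b"
proof -
  have s1: "is_seq s (a \<oplus> \<one>)"
    and s2: "\<And>i. i \<preceq> a \<Longrightarrow> entry s i \<preceq> b"
    and s3: "\<And>y. y \<preceq> b \<Longrightarrow> \<exists>!i. i \<preceq> a \<and> entry s i = y"
    using assms unfolding enumerates_def less_succ_iff by simp_all
  let ?f = "\<lambda>i. if i \<prec> a \<oplus> \<one> then entry s i else \<zero>"
  let ?g = "\<lambda>i. if ?f i = b then ?f a else ?f i"
  have f: "recf ?f" using s1 by (rule recf_entry)
  have "recf ?g" by (intro recf_if dec_eq f recf_const)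
  from seq_ex[OF this, of a] obtain s' where s'0: "is_seq s' a" "\<And>i. i \<prec> a \<Longrightarrow> entry s' i = ?g i"
    by metis
  have s': "entry s' i = (if entry s i = b then entry s a else entry s i)" if "i \<prec> a" for i
    using s'0(2)[OF that] that by (simp add: less_succ)
  have inj: "i = j" if "i \<preceq> a" "j \<preceq> a" "entry s i = entry s j" for i j
    using s3[OF s2[OF that(1)]] that by metis
  have 1: "entry s' i \<prec> b" if "i \<prec> a" for i
  proof -
    have "entry s a \<noteq> b" if "entry s i = b"
      using inj[of a i] \<open>i \<prec> a\<close> that less_irrefl by (auto simp: le_def)
    then show ?thesis using s2[of a] s2[of i] s'[OF that] that by (auto simp: le_def)
  qed
  have 2: "\<exists>!i. i \<prec> a \<and> entry s' i = y" if y: "y \<prec> b" for y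
  proof -
    have yb: "y \<noteq> b" using y less_irrefl by metis
    obtain i where i: "i \<preceq> a" "entry s i = y" using s3[of y] y by (auto simp: le_def)
    obtain j where j: "j \<preceq> a" "entry s j = b" using s3[of b] by auto
    have "\<exists>k. k \<prec> a \<and> entry s' k = y"
    proof (cases "i = a")
      case True
      then have "j \<prec> a" using i j yb by (auto simp: le_def)
      then show ?thesis using s'[of j] j i True by auto
    next
      case False
      then have "i \<prec> a" using i by (auto simp: le_def)
      then show ?thesis using s'[of i] i yb by auto
    qed
    moreover have "k = k'" if k: "k \<prec> a" "k' \<prec> a" "entry s' k = y" "entry s' k' = y" for k k'
    proof -
      have l: "k \<preceq> a" "k' \<preceq> a" "a \<preceq> a" using k by (auto simp: le_def)
      have ne: "k \<noteq> a" "k' \<noteq> a" using k less_irrefl by auto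
      show ?thesis
        using s'[OF k(1)] s'[OF k(2)] k(3,4) inj[OF l(1,2)] inj[OF l(1,3)] inj[OF l(2,3)] ne
        by (cases "entry s k = b"; cases "entry s k' = b") auto
    qed
    ultimately show ?thesis by metis
  qed
  show ?thesis unfolding enumerates_def using s'0(1) 1 2 by auto
qed

text \<open>The pigeonhole principle for possibly nonstandard numbers. Removing \<open>k\<close>
  elements from both sides by \<open>bijection_pred\<close> is an induction on the existence of a
  code, hence \<Sigma>1. When \<open>k\<close> is the smaller of the two numbers, a bijection
  between an empty and a nonempty initial segment would remain.\<close>

lemma bijection_eq:
  assumes "has_card {i. i \<prec> b} a"
  shows "a = b"
proof -
  let ?bij = "enumerates UNIV"
  let ?Q = "\<lambda>k w. k \<preceq> a \<longrightarrow> k \<preceq> b \<longrightarrow> ?bij w (monus a k) (monus b k)"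
  have monus: "recf (\<lambda>x. monus c (f x))" if "recf f" for c f
  proof -
    have "recf (\<lambda>k. monus c k)"
    proof (rule recf_graph)
      show "dec (\<lambda>z. p1 z \<preceq> c \<and> c = p1 z \<oplus> p2 z \<or> \<not> p1 z \<preceq> c \<and> p2 z = \<zero>)" by (intro recs)
      show "k \<preceq> c \<and> c = k \<oplus> y \<or> \<not> k \<preceq> c \<and> y = \<zero> \<longleftrightarrow> y = monus c k" for k y
      proof (cases "k \<preceq> c")
        case True
        then obtain d where d: "c = k \<oplus> d" unfolding le_iff by metis
        show ?thesis unfolding d monus_add by auto
      qed (simp add: monus_0)
    qed
    from recf_comp[OF this that] show ?thesis .
  qed
  have "\<exists>w. ?Q k w" for k
  proof (rule sig_induct[where b = k and Q = ?Q])
    show "dec (\<lambda>z. ?Q (p1 z) (p2 z))"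
      by (rule dec_imp[OF _ dec_imp[OF _ dec_enumerates[OF UNIV_Sets]]]) (intro recs monus)+
    show "\<exists>w. ?Q \<zero> w" using assms unfolding has_card_iff enumerates_def by auto
    fix k assume "\<exists>w. ?Q k w"
    then obtain s where s: "?Q k s" by blast
    show "\<exists>w. ?Q (k \<oplus> \<one>) w"
    proof (cases "k \<oplus> \<one> \<preceq> a \<and> k \<oplus> \<one> \<preceq> b")
      case True
      then obtain a' b' where ab: "a = k \<oplus> \<one> \<oplus> a'" "b = k \<oplus> \<one> \<oplus> b'" unfolding le_iff by blast
      then have ab': "a = k \<oplus> (a' \<oplus> \<one>)" "b = k \<oplus> (b' \<oplus> \<one>)"
        by (simp_all only: ar.add_ac)
      have "k \<preceq> a" "k \<preceq> b" unfolding ab' by simp_all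
      then have "?bij s (a' \<oplus> \<one>) (b' \<oplus> \<one>)" using s monus_add unfolding ab' by metis
      from bijection_pred[OF this] have "\<exists>w. ?bij w (monus a (k \<oplus> \<one>)) (monus b (k \<oplus> \<one>))"
        unfolding ab monus_add .
      then show ?thesis by blast
    qed blast
  qed
  note bij = this
  show ?thesis
  proof (rule ccontr)
    assume "a \<noteq> b"
    then consider "a \<prec> b" | "b \<prec> a" using less_linear by blast
    then show False
    proof cases
      case 1
      then obtain d where d: "b = a \<oplus> (d \<oplus> \<one>)" using less_iff add_assoc by auto
      have "a \<preceq> b" unfolding d by simp
      moreover have "monus a a = \<zero>" using monus_add[of a \<zero>] by (simp add: add_zero)
      moreover have "monus b a = d \<oplus> \<one>" unfolding d by (rule monus_add)
      moreover have "\<zero> \<prec> d \<oplus> \<one>" by (simp add: less_succ_iff)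
      ultimately show False using bij[of a] not_less_zero unfolding enumerates_def by auto
    next
      case 2
      then obtain d where d: "a = b \<oplus> (d \<oplus> \<one>)" using less_iff add_assoc by auto
      have "b \<preceq> a" unfolding d by simp
      moreover have "monus b b = \<zero>" using monus_add[of b \<zero>] by (simp add: add_zero)
      moreover have "monus a b = d \<oplus> \<one>" unfolding d by (rule monus_add)
      moreover have "\<zero> \<prec> d \<oplus> \<one>" by (simp add: less_succ_iff)
      ultimately show False using bij[of b] not_less_zero unfolding enumerates_def by auto
    qed
  qed
qed

lemma ex1_unique: "\<lbrakk>\<exists>!x. P x; P a; P b\<rbrakk> \<Longrightarrow> a = b"
  by blast

lemma enumerations_comparable:
  assumes s: "is_seq s n" and s': "is_seq s' n'"
    and ex: "\<And>i. i \<prec> n \<Longrightarrow> \<exists>j. j \<prec> n' \<and> entry s' j = entry s i"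
  obtains f where "recf f" "\<And>i. i \<prec> n \<Longrightarrow> f i \<prec> n'" "\<And>i. i \<prec> n \<Longrightarrow> entry s' (f i) = entry s i"
proof -
  let ?e = "\<lambda>i. if i \<prec> n then entry s i else \<zero>"
  let ?e' = "\<lambda>i. if i \<prec> n' then entry s' i else \<zero>"
  define Q where "Q i j \<longleftrightarrow> (i \<prec> n \<longrightarrow> j \<prec> n' \<and> ?e' j = ?e i)" for i j
  have "recf (\<lambda>z. ?e (p1 z))" by (rule recf_comp[OF recf_entry[OF s] recf_p1'])
  moreover have "recf (\<lambda>z. ?e' (p2 z))" by (rule recf_comp[OF recf_entry[OF s'] recf_p2'])
  ultimately have D: "dec (\<lambda>z. Q (p1 z) (p2 z))"
    unfolding Q_def by (intro dec_imp dec_conj dec_less dec_eq recf_p1 recf_p2 recf_id recf_const)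
  have "\<exists>j. Q i j" for i unfolding Q_def using ex[of i] by auto
  from recf_uniformize[OF D this] obtain f where f: "recf f" "\<And>i. Q i (f i)" by metis
  have "f i \<prec> n' \<and> entry s' (f i) = entry s i" if "i \<prec> n" for i
    using f(2)[of i] that unfolding Q_def by auto
  with f(1) show thesis using that by metis
qed

lemma has_card_unique:
  assumes "has_card Y n" "has_card Y n'"
  shows "n = n'"
proof (rule bijection_eq)
  obtain s where s: "is_seq s n" "\<And>i. i \<prec> n \<Longrightarrow> entry s i \<in> Y" "\<And>y. y \<in> Y \<Longrightarrow> \<exists>!i. i \<prec> n \<and> entry s i = y"
    using assms(1) unfolding has_card_iff by auto
  obtain s' where s': "is_seq s' n'" "\<And>i. i \<prec> n' \<Longrightarrow> entry s' i \<in> Y" "\<And>y. y \<in> Y \<Longrightarrow> \<exists>!i. i \<prec> n' \<and> entry s' i = y"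
    using assms(2) unfolding has_card_iff by auto
  have "\<exists>j. j \<prec> n' \<and> entry s' j = entry s i" if "i \<prec> n" for i
    using s'(3)[OF s(2)[OF that]] by (rule ex1_implies_ex)
  from enumerations_comparable[OF s(1) s'(1) this] obtain f where
    f: "recf f" "\<And>i. i \<prec> n \<Longrightarrow> f i \<prec> n'" "\<And>i. i \<prec> n \<Longrightarrow> entry s' (f i) = entry s i"
    by metis
  show "has_card {i. i \<prec> n'} n"
  proof (rule has_cardI[OF f(1)])
    show "i \<prec> n \<Longrightarrow> f i \<in> {i. i \<prec> n'}" for i using f(2) by simp
    fix j assume "j \<in> {i. i \<prec> n'}"
    then have j: "j \<prec> n'" by simp
    note u = s(3)[OF s'(2)[OF j]] and u' = s'(3)[OF s'(2)[OF j]]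
    from u obtain i where i: "i \<prec> n" "entry s i = entry s' j" by auto
    show "\<exists>!i. i \<prec> n \<and> f i = j"
    proof (rule ex1I[of _ i])
      have "f i = j" by (rule ex1_unique[OF u']) (use f(2,3)[OF i(1)] i j in auto)
      with i show "i \<prec> n \<and> f i = j" by simp
      show "k = i" if "k \<prec> n \<and> f k = j" for k
        by (rule ex1_unique[OF u]) (use f(3)[of k] that i in auto)
    qed
  qed
qed

lemma cardinality_eq: "has_card Y n \<Longrightarrow> cardinality Y = n"
  unfolding cardinality_def using has_card_unique by blast

section \<open>Course-of-values recursion\<close>

text \<open>The recursion runs on \<open>k\<close> for each parameter \<open>v\<close>, with one
  resulting set for all \<open>v\<close>. Correct initial segments exist as coded finite sets by
  \<Sigma>1 induction and agree wherever both are defined. Hence membership can be read off from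
  some correct segment or from every correct segment, which are the two forms needed for
  comprehension. Locality transfers \<open>Cl\<close> from the coded segment to the whole
  set.\<close>

lemma course_of_values:
  assumes D: "dec (\<lambda>z. Cl (p1 z) (p1 (p2 z)) (elems (p2 (p2 z))))"
    and local: "\<And>v k S S'. (\<And>j. j \<prec> k \<Longrightarrow> j \<in> S \<longleftrightarrow> j \<in> S') \<Longrightarrow> Cl v k S = Cl v k S'"
  obtains A where "A \<in> Sets" "\<And>k v. pair k v \<in> A \<longleftrightarrow> Cl v k {j. pair j v \<in> A}"
proof -
  define correct where "correct v l t \<longleftrightarrow> (\<forall>i. i \<prec> l \<longrightarrow> (i \<in> elems t \<longleftrightarrow> Cl v i (elems t)))" for v l t
  have DC: "dec (\<lambda>x. Cl (f x) (g x) (elems (h x)))" if "recf f" "recf g" "recf h" for f g h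
    using dec_comp[OF D recf_pair[OF that(1) recf_pair[OF that(2,3)]]] by simp
  have dec_correct: "dec (\<lambda>x. correct (f x) (g x) (h x))" if r: "recf f" "recf g" "recf h" for f g h
    unfolding correct_def
    by (intro dec_ball_less dec_iff dec_elems DC recf_p2 recf_id r r[THEN recf_comp_p1])
  have ex: "\<exists>t. correct v l t" for v l
  proof (rule sig_induct[where b = l and Q = "correct v"])
    show "dec (\<lambda>z. correct v (p1 z) (p2 z))" by (intro dec_correct recs)
    show "\<exists>t. correct v \<zero> t" by (simp add: correct_def not_less_zero)
    fix l assume "\<exists>t. correct v l t"
    then obtain t where t: "correct v l t" by metis
    define T where "T = {i. i \<prec> l \<and> i \<in> elems t \<or> i = l \<and> Cl v l (elems t)}"
    have "dec (\<lambda>i. i \<prec> l \<and> i \<in> elems t \<or> i = l \<and> Cl v l (elems t))" by (intro recs)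
    then have "T \<in> Sets" unfolding T_def by (rule dec_Sets)
    moreover have "fin_set T" unfolding fin_set_def T_def
      by (intro exI[of _ "l \<oplus> \<one>"]) (auto simp: less_succ)
    ultimately obtain t' where "elems t' = T" using fin_code_ex by metis
    then have t': "i \<in> elems t' \<longleftrightarrow> i \<in> elems t" "l \<in> elems t' \<longleftrightarrow> Cl v l (elems t)" if "i \<prec> l" for i
      using that less_irrefl by (auto simp: T_def)
    have t'l: "l \<in> elems t' \<longleftrightarrow> Cl v l (elems t)"
      using \<open>elems t' = T\<close> less_irrefl by (auto simp: T_def)
    have "Cl v i (elems t') = Cl v i (elems t)" if "i \<preceq> l" for i
      by (rule local) (use t' that ar.less_le_trans in metis)
    then have "correct v (l \<oplus> \<one>) t'"
      using t t' t'l unfolding correct_def less_succ by (auto simp: le_def)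
    then show "\<exists>t. correct v (l \<oplus> \<one>) t" by metis
  qed
  have unique: "i \<in> elems t \<longleftrightarrow> i \<in> elems t'"
    if t: "correct v l t" "correct v l' t'" and i: "i \<prec> l" "i \<prec> l'" for v l l' t t' i
  proof -
    have "i \<prec> l \<longrightarrow> i \<prec> l' \<longrightarrow> (i \<in> elems t \<longleftrightarrow> i \<in> elems t')"
    proof (rule dec_less_induct[where P = "\<lambda>i. i \<prec> l \<longrightarrow> i \<prec> l' \<longrightarrow> (i \<in> elems t \<longleftrightarrow> i \<in> elems t')"])
      show "dec (\<lambda>i. i \<prec> l \<longrightarrow> i \<prec> l' \<longrightarrow> (i \<in> elems t \<longleftrightarrow> i \<in> elems t'))" by (intro recs)
      fix a assume IH: "\<And>b. b \<prec> a \<Longrightarrow> b \<prec> l \<longrightarrow> b \<prec> l' \<longrightarrow> (b \<in> elems t \<longleftrightarrow> b \<in> elems t')"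
      show "a \<prec> l \<longrightarrow> a \<prec> l' \<longrightarrow> (a \<in> elems t \<longleftrightarrow> a \<in> elems t')"
      proof (intro impI)
        assume a: "a \<prec> l" "a \<prec> l'"
        have "Cl v a (elems t) = Cl v a (elems t')"
          by (rule local) (use IH a ar.less_trans in metis)
        with a t show "a \<in> elems t \<longleftrightarrow> a \<in> elems t'" unfolding correct_def by simp
      qed
    qed
    with i show ?thesis by simp
  qed
  define mem where "mem k v \<longleftrightarrow> (\<exists>t. correct v (k \<oplus> \<one>) t \<and> k \<in> elems t)" for k v
  have less: "k \<prec> k \<oplus> \<one>" for k by (simp add: less_succ)
  have mem: "mem k v \<longleftrightarrow> k \<in> elems t" if "correct v l t" "k \<prec> l" for k v l t
    using unique[OF that(1) _ that(2) less] ex[of v "k \<oplus> \<one>"] unfolding mem_def by metis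
  have "dec (\<lambda>z. mem (p1 z) (p2 z))"
  proof (rule dec_Delta1)
    show "dec (\<lambda>z. correct (p2 (p1 z)) (p1 (p1 z) \<oplus> \<one>) (p2 z) \<and> p1 (p1 z) \<in> elems (p2 z))"
      by (intro dec_correct recs)
    show "dec (\<lambda>z. correct (p2 (p1 z)) (p1 (p1 z) \<oplus> \<one>) (p2 z) \<longrightarrow> p1 (p1 z) \<in> elems (p2 z))"
      by (intro dec_correct recs)
    show "mem (p1 x) (p2 x) \<longleftrightarrow> (\<exists>t. correct (p2 x) (p1 x \<oplus> \<one>) t \<and> p1 x \<in> elems t)" for x
      by (simp add: mem_def)
    show "mem (p1 x) (p2 x) \<longleftrightarrow> (\<forall>t. correct (p2 x) (p1 x \<oplus> \<one>) t \<longrightarrow> p1 x \<in> elems t)" for x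
      using mem[OF _ less] ex by metis
  qed
  then have A: "{z. mem (p1 z) (p2 z)} \<in> Sets" by (rule dec_Sets)
  have eq: "mem k v \<longleftrightarrow> Cl v k {j. mem j v}" for k v
  proof -
    obtain t where t: "correct v (k \<oplus> \<one>) t" using ex by metis
    have "mem k v \<longleftrightarrow> Cl v k (elems t)" using mem[OF t less] t less unfolding correct_def by simp
    also have "\<dots> \<longleftrightarrow> Cl v k {j. mem j v}"
      by (rule local) (use mem[OF t] in \<open>simp add: less_succ\<close>)
    finally show ?thesis .
  qed
  show thesis by (rule that[OF A]) (simp only: mem_Collect_eq p1_pair p2_pair eq[symmetric])
qed

section \<open>Permutations with prescribed initial entries\<close>

lemma num_less [simp]: "num i \<prec> num j \<longleftrightarrow> i < j"
proof (induction j arbitrary: i)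
  case (Suc j)
  show ?case
  proof (cases i)
    case 0
    then show ?thesis by (simp add: less_succ_iff)
  qed (use Suc in simp)
qed (simp add: not_less_zero)

lemma num_inject [simp]: "num i = num j \<longleftrightarrow> i = j"
  using num_less less_irrefl by (metis nat_neq_iff)

lemma num_le [simp]: "num i \<preceq> num j \<longleftrightarrow> i \<le> j"
  by (auto simp: le_def)

lemma less_num: "a \<prec> num m \<longleftrightarrow> (\<exists>i<m. a = num i)"
  by (induction m) (auto simp: not_less_zero less_succ less_Suc_eq)

lemma recf_list: "\<exists>h. recf h \<and> (\<forall>i<length ks. h (num i) = ks ! i)"
proof (induction ks rule: rev_induct)
  case (snoc k ks)
  then obtain h where h: "recf h" "\<And>i. i < length ks \<Longrightarrow> h (num i) = ks ! i" by metis
  have "recf (\<lambda>i. if i = num (length ks) then k else h i)" by (intro recs h)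
  moreover have "(if num i = num (length ks) then k else h (num i)) = (ks @ [k]) ! i" if "i < Suc (length ks)" for i
    using that h(2) by (auto simp: nth_append less_Suc_eq)
  ultimately show ?case by (intro exI conjI) auto
qed (use recf_id in auto)

lemma Perm_iff: "p \<in> Perm W \<longleftrightarrow> is_seq p (lh p) \<and> (\<forall>i. i \<prec> lh p \<longrightarrow> entry p i \<in> W) \<and>
    (\<forall>r\<in>W. \<exists>!i. i \<prec> lh p \<and> entry p i = r)"
  unfolding Perm_def using is_seq_lh is_seq_Seq by auto

lemma PermD:
  assumes "p \<in> Perm W"
  shows "is_seq p (cardinality W)" "lh p = cardinality W"
    "\<And>i. i \<prec> cardinality W \<Longrightarrow> entry p i \<in> W"
    "\<And>r. r \<in> W \<Longrightarrow> \<exists>!i. i \<prec> cardinality W \<and> entry p i = r"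
proof -
  have "has_card W (lh p)" unfolding has_card_iff using assms[unfolded Perm_iff] by (intro exI[of _ p]) auto
  then have "lh p = cardinality W" using cardinality_eq by simp
  then show "is_seq p (cardinality W)" "lh p = cardinality W"
    "\<And>i. i \<prec> cardinality W \<Longrightarrow> entry p i \<in> W"
    "\<And>r. r \<in> W \<Longrightarrow> \<exists>!i. i \<prec> cardinality W \<and> entry p i = r"
    using assms unfolding Perm_iff by auto
qed

lemma Perm_swap:
  assumes p: "p \<in> Perm W" and ab: "a \<prec> cardinality W" "b \<prec> cardinality W"
  obtains q where "q \<in> Perm W" "entry q a = entry p b"
    "\<And>i. i \<prec> cardinality W \<Longrightarrow> i \<noteq> a \<Longrightarrow> i \<noteq> b \<Longrightarrow> entry q i = entry p i"
proof -
  let ?l = "cardinality W"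
  let ?t = "\<lambda>i. if i = a then b else if i = b then a else i"
  let ?e = "\<lambda>i. if i \<prec> ?l then entry p i else \<zero>"
  have "recf ?t" by (intro recs)
  then have "recf (\<lambda>i. ?e (?t i))" by (rule recf_comp[OF recf_entry[OF PermD(1)[OF p]]])
  from seq_ex[OF this, of ?l] obtain q where q0: "is_seq q ?l" "\<And>i. i \<prec> ?l \<Longrightarrow> entry q i = ?e (?t i)"
    by metis
  have t: "?t i \<prec> ?l" if "i \<prec> ?l" for i using that ab by auto
  have q: "entry q i = entry p (?t i)" if "i \<prec> ?l" for i using q0(2)[OF that] t[OF that] by auto
  have "\<exists>!i. i \<prec> ?l \<and> entry q i = r" if "r \<in> W" for r
  proof -
    note u = PermD(4)[OF p that]
    then obtain i where i: "i \<prec> ?l" "entry p i = r" by auto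
    show ?thesis
    proof (rule ex1I[of _ "?t i"])
      have "?t (?t i) = i" by auto
      then show "?t i \<prec> ?l \<and> entry q (?t i) = r" using t[OF i(1)] q[OF t[OF i(1)]] i by auto
      fix j assume j: "j \<prec> ?l \<and> entry q j = r"
      have "?t j = i" by (rule ex1_unique[OF u]) (use j i q[of j] t[of j] in auto)
      then show "j = ?t i" by (auto split: if_splits)
    qed
  qed
  moreover have "entry q i \<in> W" if "i \<prec> ?l" for i
    using q[OF that] PermD(3)[OF p t[OF that]] by simp
  ultimately have "q \<in> Perm W" unfolding Perm_iff lh_eq[OF q0(1)] using q0(1) by auto
  then show thesis using q that ab by auto
qed

lemma Perm_ex:
  assumes "W \<in> Sets" "fin_set W"
  obtains p where "p \<in> Perm W"
proof -
  obtain n where "has_card W n" using has_card_ex[OF assms] by metis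
  then obtain p where p: "is_seq p n" "\<And>i. i \<prec> n \<Longrightarrow> entry p i \<in> W" "\<And>r. r \<in> W \<Longrightarrow> \<exists>!i. i \<prec> n \<and> entry p i = r"
    unfolding has_card_iff by auto
  then have "p \<in> Perm W" unfolding Perm_iff lh_eq[OF p(1)] by auto
  then show thesis by (rule that)
qed

text \<open>\<open>W\<close> may have nonstandard size, but \<open>rs\<close> is a HOL list, so the
  induction is external. The new entry occurs in the permutation no earlier than position
  \<open>length rs\<close>, since the earlier positions hold other entries; a swap brings it there
  without disturbing them.\<close>

lemma Perm_prefix:
  assumes W: "W \<in> Sets" "fin_set W" and "distinct rs" "set rs \<subseteq> W"
  shows "\<exists>p\<in>Perm W. \<forall>i<length rs. num i \<prec> cardinality W \<and> entry p (num i) = rs ! i"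
  using assms(3,4)
proof (induction rs rule: rev_induct)
  case Nil
  then show ?case using Perm_ex[OF W] by auto
next
  case (snoc r rs)
  let ?l = "cardinality W" and ?m = "length rs"
  from snoc obtain p where p: "p \<in> Perm W"
      "\<And>i. i < ?m \<Longrightarrow> num i \<prec> ?l \<and> entry p (num i) = rs ! i"
    by auto
  have "r \<in> W" using snoc by simp
  then obtain a where a: "a \<prec> ?l" "entry p a = r" using PermD(4)[OF p(1)] by metis
  have na: "a \<noteq> num i" if "i < ?m" for i using that p(2)[OF that] a snoc.prems(1) by auto
  then have "num ?m \<preceq> a" using less_num ar.not_le by metis
  then have m: "num ?m \<prec> ?l" using a(1) ar.le_less_trans by metis
  obtain q where q: "q \<in> Perm W" "entry q (num ?m) = entry p a"
    "\<And>i. i \<prec> ?l \<Longrightarrow> i \<noteq> num ?m \<Longrightarrow> i \<noteq> a \<Longrightarrow> entry q i = entry p i"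
    using Perm_swap[OF p(1) m a(1)] by metis
  have "num i \<prec> ?l \<and> entry q (num i) = (rs @ [r]) ! i" if "i < Suc ?m" for i
  proof (cases "i = ?m")
    case True
    then show ?thesis using m q(2) a(2) by simp
  next
    case False
    then have i: "i < ?m" using that by simp
    show ?thesis using p(2)[OF i] q(3)[of "num i"] na[OF i] i by (auto simp: nth_append)
  qed
  then show ?case using q(1) by auto
qed

section \<open>Weak orders\<close>

lemma weak_ordersD:
  assumes "r \<in> weak_orders X"
  shows "fin_code r" "elems r \<subseteq> pprod X X"
    "\<And>x y z. \<lbrakk>x \<in> X; y \<in> X; z \<in> X; wle r x y; wle r y z\<rbrakk> \<Longrightarrow> wle r x z"
    "\<And>x y. \<lbrakk>x \<in> X; y \<in> X\<rbrakk> \<Longrightarrow> wle r x y \<or> wle r y x"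
  using assms unfolding weak_orders_def mem_Collect_eq by metis+

lemma dec_wle [recs]: "\<lbrakk>recf f; recf g; recf h\<rbrakk> \<Longrightarrow> dec (\<lambda>x. wle (f x) (g x) (h x))"
  unfolding wle_def by (intro recs)

lemma dec_wlt [recs]: "\<lbrakk>recf f; recf g; recf h\<rbrakk> \<Longrightarrow> dec (\<lambda>x. wlt (f x) (g x) (h x))"
  unfolding wlt_def by (intro recs)

lemma fin_set_pprod: "\<lbrakk>fin_set X; fin_set Y\<rbrakk> \<Longrightarrow> fin_set (pprod X Y)"
proof -
  assume "fin_set X" "fin_set Y"
  then obtain k l where k: "\<And>i. i \<in> X \<Longrightarrow> i \<prec> k" and l: "\<And>i. i \<in> Y \<Longrightarrow> i \<prec> l"
    unfolding fin_set_def by metis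
  have "z \<prec> pair k l \<oplus> \<one>" if "z \<in> pprod X Y" for z
    using that pair_mono k l unfolding pprod_def less_succ_iff by (auto simp: ar.less_imp_le)
  then show ?thesis unfolding fin_set_def by metis
qed

lemma fin_set_subset: "\<lbrakk>fin_set Y; X \<subseteq> Y\<rbrakk> \<Longrightarrow> fin_set X"
  unfolding fin_set_def by blast

lemma weak_orders_Sets:
  assumes X: "X \<in> Sets" "fin_set X"
  shows "weak_orders X \<in> Sets"
proof -
  have "elems r \<subseteq> pprod X X \<longleftrightarrow> (\<forall>z. z \<prec> r \<longrightarrow> z \<in> elems r \<longrightarrow> z \<in> pprod X X)" for r
    using elems_less by blast
  then show ?thesis unfolding weak_orders_def
    by (simp only:) (intro dec_Sets recs X pprod_Sets)
qed

text \<open>All weak orders are subsets of one finite product. \<open>fin_code_bound\<close> bounds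
  the codes of all its subsets at once, and canonical codes are unique.\<close>

lemma weak_orders_fin:
  assumes X: "X \<in> Sets" "fin_set X"
  shows "fin_set (weak_orders X)"
proof -
  obtain b where b: "\<And>z. z \<in> pprod X X \<Longrightarrow> z \<prec> b"
    using fin_set_pprod[OF X(2) X(2)] unfolding fin_set_def by metis
  obtain B where B: "\<And>T. T \<in> Sets \<Longrightarrow> \<forall>i\<in>T. i \<prec> b \<Longrightarrow> \<exists>c. c \<preceq> B \<and> fin_code c \<and> elems c = T"
    using fin_code_bound by metis
  have "r \<prec> B \<oplus> \<one>" if "r \<in> weak_orders X" for r
  proof -
    have r: "fin_code r" "\<forall>i\<in>elems r. i \<prec> b" using weak_ordersD(1,2)[OF that] b by auto
    obtain c where "c \<preceq> B" "fin_code c" "elems c = elems r" using B[OF elems_Sets r(2)] by metis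
    then show ?thesis using fin_code_unique[OF r(1), of c] by (simp add: less_succ_iff)
  qed
  then show ?thesis unfolding fin_set_def by metis
qed

lemma weak_order_ex:
  assumes X: "X \<in> Sets" "fin_set X" and D: "dec (\<lambda>z. P (p1 z) (p2 z))"
    and "\<And>x y z. \<lbrakk>x \<in> X; y \<in> X; z \<in> X; P x y; P y z\<rbrakk> \<Longrightarrow> P x z"
    and "\<And>x y. \<lbrakk>x \<in> X; y \<in> X\<rbrakk> \<Longrightarrow> P x y \<or> P y x"
  obtains r where "r \<in> weak_orders X" "\<And>x y. \<lbrakk>x \<in> X; y \<in> X\<rbrakk> \<Longrightarrow> wle r x y \<longleftrightarrow> P x y"
proof -
  let ?T = "{z. z \<in> pprod X X \<and> P (p1 z) (p2 z)}"
  have "?T \<in> Sets" by (rule dec_Sets[OF dec_conj[OF dec_mem[OF pprod_Sets[OF X(1) X(1)] recf_id] D]])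
  moreover have "fin_set ?T" by (rule fin_set_subset[OF fin_set_pprod[OF X(2) X(2)]]) auto
  ultimately have "\<exists>r. fin_code r \<and> elems r = ?T" by (rule fin_code_ex)
  then obtain r where r: "fin_code r" "elems r = ?T" by (elim exE conjE)
  have wle: "wle r x y \<longleftrightarrow> x \<in> X \<and> y \<in> X \<and> P x y" for x y
    unfolding wle_def r(2) by auto
  have "\<forall>x\<in>X. \<forall>y\<in>X. \<forall>z\<in>X. wle r x y \<and> wle r y z \<longrightarrow> wle r x z"
    unfolding wle by (intro ballI impI, elim conjE, intro conjI, simp, simp, rule assms(4))
  moreover have "\<forall>x\<in>X. \<forall>y\<in>X. wle r x y \<or> wle r y x"
    unfolding wle by (simp add: assms(5))
  moreover have "elems r \<subseteq> pprod X X" unfolding r(2) by (rule Collect_restrict)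
  ultimately have "r \<in> weak_orders X"
    unfolding weak_orders_def using r(1) by (intro CollectI conjI)
  then show thesis by (rule that) (simp add: wle)
qed

lemma weak_order_eqI:
  assumes "r \<in> weak_orders X" "r' \<in> weak_orders X" "\<And>x y. \<lbrakk>x \<in> X; y \<in> X\<rbrakk> \<Longrightarrow> wle r x y \<longleftrightarrow> wle r' x y"
  shows "r = r'"
proof (rule fin_code_unique)
  show "fin_code r" "fin_code r'" using assms(1,2) weak_ordersD(1) by metis+
  have "elems r \<subseteq> pprod X X" "elems r' \<subseteq> pprod X X" using assms(1,2) weak_ordersD(2) by metis+
  then show "elems r = elems r'"
    using assms(3) unfolding wle_def pprod_def by blast
qed

section \<open>Functions as sets of the structure\<close>

lemma app_eq: "\<lbrakk>is_fun f B C; x \<in> B\<rbrakk> \<Longrightarrow> pair x y \<in> f \<longleftrightarrow> y = app f x"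
  unfolding is_fun_def app_def using theI'[of "\<lambda>y. pair x y \<in> f"] by metis

lemma app_in: "\<lbrakk>is_fun f B C; x \<in> B\<rbrakk> \<Longrightarrow> app f x \<in> C"
  using app_eq[of f B C x "app f x"] unfolding is_fun_def by auto

lemma recf_app:
  assumes "f \<in> Sets" "is_fun f B C" "recf h" "\<And>x. h x \<in> B"
  shows "recf (\<lambda>x. app f (h x))"
proof (rule recf_graph)
  show "dec (\<lambda>z. pair (h (p1 z)) (p2 z) \<in> f)"
    by (intro recs assms recf_comp[OF assms(3)])
  show "pair (h x) y \<in> f \<longleftrightarrow> y = app f (h x)" for x y
    using app_eq[OF assms(2,4)] .
qed

lemma graph_is_fun:
  assumes "\<And>x. x \<in> B \<Longrightarrow> f x \<in> C"
  shows "is_fun {z. z \<in> graph f \<and> p1 z \<in> B} B C" "\<And>x. x \<in> B \<Longrightarrow> app {z. z \<in> graph f \<and> p1 z \<in> B} x = f x"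
proof -
  let ?g = "{z. z \<in> graph f \<and> p1 z \<in> B}"
  have "?g \<subseteq> pprod B C" using assms unfolding graph_def by auto
  then show isf: "is_fun ?g B C" unfolding is_fun_def by auto
  show "app ?g x = f x" if "x \<in> B" for x
    using app_eq[OF isf that, of "f x"] that by auto
qed

lemma graph_restrict_Sets: "\<lbrakk>recf f; B \<in> Sets\<rbrakk> \<Longrightarrow> {z. z \<in> graph f \<and> p1 z \<in> B} \<in> Sets"
  unfolding recf_def by (intro dec_Sets recs)

section \<open>Societies\<close>

lemma recf_app_total:
  assumes "f \<in> Sets" "is_fun f B C" "B \<in> Sets"
  shows "recf (\<lambda>x. if x \<in> B then app f x else \<zero>)"
proof (rule recf_graph)
  show "dec (\<lambda>z. p1 z \<in> B \<and> pair (p1 z) (p2 z) \<in> f \<or> p1 z \<notin> B \<and> p2 z = \<zero>)"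
    by (intro recs assms)
  show "x \<in> B \<and> pair x y \<in> f \<or> x \<notin> B \<and> y = \<zero> \<longleftrightarrow> y = (if x \<in> B then app f x else \<zero>)" for x y
    using app_eq[OF assms(2)] by auto
qed

end

locale countable_society = RCA0 +
  fixes V X A F :: "'a set"
  assumes society: "society V X A F"
begin

lemma V_Sets: "V \<in> Sets" and X_Sets: "X \<in> Sets" and A_Sets: "A \<in> Sets" and F_Sets: "F \<in> Sets"
  and V_nonempty: "V \<noteq> {}" and X_fin: "fin_set X"
  using society unfolding society_def by auto

lemma W_Sets: "weak_orders X \<in> Sets" and W_fin: "fin_set (weak_orders X)"
  using weak_orders_Sets weak_orders_fin X_Sets X_fin by auto

lemma prof_in: "v \<in> V \<Longrightarrow> prof_at F i v \<in> weak_orders X"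
  using society unfolding society_def profile_def prof_at_def using app_in by metis

lemma measure_function:
  obtains m where "recf m"
    "\<And>n x y v. \<lbrakk>x \<in> X; y \<in> X; v \<in> V\<rbrakk> \<Longrightarrow> wle (prof_at F n v) x y \<longleftrightarrow> v \<in> sect A (m (pair n (pair x y)))"
proof -
  obtain \<mu> where \<mu>: "\<mu> \<in> Sets" "is_fun \<mu> (pprod UNIV (pprod X X)) UNIV"
    "\<And>n x y v. \<lbrakk>x \<in> X; y \<in> X; v \<in> V\<rbrakk> \<Longrightarrow> wle (prof_at F n v) x y \<longleftrightarrow> v \<in> sect A (app \<mu> (pair n (pair x y)))"
    using society unfolding society_def uniformly_measurable_def by metis
  have "recf (\<lambda>z. if z \<in> pprod UNIV (pprod X X) then app \<mu> z else \<zero>)"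
    by (intro recf_app_total[OF \<mu>(1,2)] pprod_Sets UNIV_Sets X_Sets)
  then show thesis by (rule that) (simp add: \<mu>(3))
qed

definition alg :: "'a set \<Rightarrow> bool" where
  "alg S \<longleftrightarrow> (\<exists>k. sect A k = S)"

lemma algebra: "countable_algebra V A" "atomic V A"
  using society unfolding society_def by auto

lemma alg_subset: "alg S \<Longrightarrow> S \<subseteq> V"
  using algebra(1) unfolding alg_def countable_algebra_def by auto

lemma alg_sect: "alg (sect A k)"
  unfolding alg_def by auto

lemma alg_V: "alg V"
  using algebra(1) unfolding alg_def countable_algebra_def by auto

lemma alg_Un: "\<lbrakk>alg S; alg T\<rbrakk> \<Longrightarrow> alg (S \<union> T)"
  using algebra(1) unfolding alg_def countable_algebra_def by metis

lemma alg_Int: "\<lbrakk>alg S; alg T\<rbrakk> \<Longrightarrow> alg (S \<inter> T)"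
  using algebra(1) unfolding alg_def countable_algebra_def by metis

lemma alg_Diff: "alg S \<Longrightarrow> alg (V - S)"
  using algebra(1) unfolding alg_def countable_algebra_def by metis

lemma alg_empty: "alg {}"
  using alg_Diff[OF alg_V] by simp

lemma alg_single: "v \<in> V \<Longrightarrow> alg {v}"
  using algebra(2) unfolding alg_def atomic_def by metis

lemma alg_wle: "\<lbrakk>x \<in> X; y \<in> X\<rbrakk> \<Longrightarrow> alg {v \<in> V. wle (prof_at F n v) x y}"
proof -
  assume xy: "x \<in> X" "y \<in> X"
  obtain m where "\<And>n x y v. \<lbrakk>x \<in> X; y \<in> X; v \<in> V\<rbrakk> \<Longrightarrow>
      wle (prof_at F n v) x y \<longleftrightarrow> v \<in> sect A (m (pair n (pair x y)))"
    using measure_function by metis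
  then have "{v \<in> V. wle (prof_at F n v) x y} = sect A (m (pair n (pair x y)))"
    using xy alg_subset[OF alg_sect, of "m (pair n (pair x y))"] by auto
  then show ?thesis using alg_sect by simp
qed

text \<open>Finiteness of the range is meant in HOL, not in the structure. Profiles with standardly
  many values suffice for the voting arguments, and they can be handled through HOL lists.\<close>

definition simple :: "('a \<Rightarrow> 'a) \<Rightarrow> bool" where
  "simple g \<longleftrightarrow> finite (g ` V) \<and> (\<forall>r. alg {v \<in> V. g v = r})"

lemma simple_const: "simple (\<lambda>v. c)"
proof -
  have "alg {v \<in> V. c = r}" for r using alg_V alg_empty by (cases "c = r") auto
  moreover have "finite ((\<lambda>v. c) ` V)" by (rule finite_subset[of _ "{c}"]) auto
  ultimately show ?thesis by (simp add: simple_def)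
qed

lemma simple_if:
  assumes P: "alg {v \<in> V. P v}" and "simple g" "simple h"
  shows "simple (\<lambda>v. if P v then g v else h v)"
proof -
  have "alg {v \<in> V. (if P v then g v else h v) = r}" for r
  proof -
    have "{v \<in> V. (if P v then g v else h v) = r} =
      ({v \<in> V. P v} \<inter> {v \<in> V. g v = r}) \<union> ((V - {v \<in> V. P v}) \<inter> {v \<in> V. h v = r})"
      by auto
    then show ?thesis
      using assms unfolding simple_def by (simp add: alg_Un alg_Int alg_Diff)
  qed
  moreover have "finite ((\<lambda>v. if P v then g v else h v) ` V)"
    by (rule finite_subset[of _ "g ` V \<union> h ` V"]) (use assms in \<open>auto simp: simple_def\<close>)
  ultimately show ?thesis unfolding simple_def by simp
qed

lemma embedding:
  obtains e where "e \<in> Sets" "is_fun e (pprod (Perm (weak_orders X)) (QPart (cardinality (weak_orders X)))) UNIV"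
    "\<And>p s v i. \<lbrakk>p \<in> Perm (weak_orders X); s \<in> QPart (cardinality (weak_orders X)); v \<in> V;
       \<exists>!i. cell A s v i; cell A s v i\<rbrakk> \<Longrightarrow> prof_at F (app e (pair p s)) v = entry p i"
    "\<And>p s v l. \<lbrakk>p \<in> Perm (weak_orders X); s \<in> QPart (cardinality (weak_orders X)); v \<in> V;
       \<not> (\<exists>!i. cell A s v i); l \<oplus> \<one> = lh s\<rbrakk> \<Longrightarrow> prof_at F (app e (pair p s)) v = entry p l"
proof -
  have "qp_embedded V X A F" using society unfolding society_def by simp
  then obtain e where e: "e \<in> Sets" "is_fun e (pprod (Perm (weak_orders X)) (QPart (cardinality (weak_orders X)))) UNIV"
    and prof: "\<forall>p\<in>Perm (weak_orders X). \<forall>s\<in>QPart (cardinality (weak_orders X)). \<forall>v\<in>V.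
      ((\<exists>!i. cell A s v i) \<longrightarrow> (\<forall>i. cell A s v i \<longrightarrow> prof_at F (app e (pair p s)) v = entry p i)) \<and>
      (\<not> (\<exists>!i. cell A s v i) \<longrightarrow> (\<forall>l. l \<oplus> \<one> = lh s \<longrightarrow> prof_at F (app e (pair p s)) v = entry p l))"
    unfolding qp_embedded_def Let_def by (elim bexE conjE)
  show thesis
  proof (rule that[OF e])
    fix p s v i
    assume ps: "p \<in> Perm (weak_orders X)" "s \<in> QPart (cardinality (weak_orders X))" "v \<in> V"
    note prof_v = prof[THEN bspec, OF ps(1), THEN bspec, OF ps(2), THEN bspec, OF ps(3)]
    show "prof_at F (app e (pair p s)) v = entry p i" if "\<exists>!i. cell A s v i" "cell A s v i"
      using prof_v[THEN conjunct1, THEN mp, OF that(1)] that(2) by simp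
    show "prof_at F (app e (pair p s)) v = entry p i" if "\<not> (\<exists>!i. cell A s v i)" "i \<oplus> \<one> = lh s"
      using prof_v[THEN conjunct2, THEN mp, OF that(1)] that(2) by simp
  qed
qed

lemma cell_num:
  assumes s: "is_seq s (num m)"
  shows "cell A s v i \<longleftrightarrow> (\<exists>n. Suc n < m \<and> i = num n \<and> v \<in> sect A (entry s (num n)))"
proof -
  have "i \<oplus> \<one> \<prec> num m \<longleftrightarrow> (\<exists>n. Suc n < m \<and> i = num n)"
  proof
    assume "i \<oplus> \<one> \<prec> num m"
    moreover from this have "i \<prec> num m" using ar.less_trans[of i "i \<oplus> \<one>"] by (simp add: less_succ)
    then obtain n where "i = num n" unfolding less_num by auto
    ultimately show "\<exists>n. Suc n < m \<and> i = num n" using num_less[of "Suc n" m] by (intro exI[of _ n]) simp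
  next
    assume "\<exists>n. Suc n < m \<and> i = num n"
    then show "i \<oplus> \<one> \<prec> num m" using num_less[of "Suc _" m] by auto
  qed
  then show ?thesis unfolding cell_def lh_eq[OF s] by auto
qed

text \<open>The values of \<open>g\<close> are made the first entries of a permutation, and indices
  of their preimages form a quasi-partition. The preimages are disjoint and cover \<open>V\<close>,
  so every voter outside the last one lies in a unique cell, and voters in the last one are caught
  by the default clause.\<close>

lemma realize:
  assumes g: "simple g" "g ` V \<subseteq> weak_orders X"
  obtains j where "\<And>v. v \<in> V \<Longrightarrow> prof_at F j v = g v"
proof -
  let ?W = "weak_orders X"
  obtain rs where rs: "distinct rs" "set rs = g ` V"
    using finite_distinct_list g(1) unfolding simple_def by metis
  obtain ks where ks: "length ks = length rs" "\<And>i. i < length rs \<Longrightarrow> sect A (ks ! i) = {v \<in> V. g v = rs ! i}"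
  proof -
    have "\<exists>k. sect A k = {v \<in> V. g v = r}" for r
      using g(1) unfolding simple_def alg_def by simp
    then obtain k where "\<And>r. sect A (k r) = {v \<in> V. g v = r}" by metis
    then show thesis by (intro that[of "map k rs"]) auto
  qed
  let ?m = "length rs"
  have m: "?m > 0" using rs(2) V_nonempty by auto
  obtain p where p: "p \<in> Perm ?W" "\<And>i. i < ?m \<Longrightarrow> num i \<prec> cardinality ?W \<and> entry p (num i) = rs ! i"
    using Perm_prefix[OF W_Sets W_fin rs(1)] rs(2) g(2) by auto
  obtain h where h: "recf h" "\<And>i. i < ?m \<Longrightarrow> h (num i) = ks ! i"
    using recf_list[of ks] ks(1) by auto
  obtain s where s: "is_seq s (num ?m)" "\<And>i. i \<prec> num ?m \<Longrightarrow> entry s i = h i"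
    using seq_ex[OF h(1), of "num ?m"] by metis
  have sk: "entry s (num i) = ks ! i" if "i < ?m" for i
    using s(2)[of "num i"] h(2)[OF that] that by simp
  obtain m' where m': "?m = Suc m'" using m gr0_conv_Suc by auto
  have Q: "s \<in> QPart (cardinality ?W)"
  proof -
    have "\<one> \<preceq> num ?m" using num_le[of 1 ?m] m by (simp add: add_0_left)
    moreover have "num ?m \<preceq> cardinality ?W" using p(2)[of m'] m' by (simp add: succ_le_iff)
    ultimately show ?thesis unfolding QPart_def using is_seq_Seq[OF s(1)] lh_eq[OF s(1)] by simp
  qed
  obtain e where "e \<in> Sets" "is_fun e (pprod (Perm ?W) (QPart (cardinality ?W))) UNIV"
    and e: "\<And>p s v i. \<lbrakk>p \<in> Perm ?W; s \<in> QPart (cardinality ?W); v \<in> V;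
       \<exists>!i. cell A s v i; cell A s v i\<rbrakk> \<Longrightarrow> prof_at F (app e (pair p s)) v = entry p i"
    "\<And>p s v l. \<lbrakk>p \<in> Perm ?W; s \<in> QPart (cardinality ?W); v \<in> V;
       \<not> (\<exists>!i. cell A s v i); l \<oplus> \<one> = lh s\<rbrakk> \<Longrightarrow> prof_at F (app e (pair p s)) v = entry p l"
    by (rule embedding) (rule that; assumption)
  have "prof_at F (app e (pair p s)) v = g v" if v: "v \<in> V" for v
  proof -
    have "g v \<in> set rs" using rs(2) v by simp
    then obtain i where i: "i < ?m" "g v = rs ! i" by (auto simp: in_set_conv_nth)
    have "v \<in> sect A (entry s (num n)) \<longleftrightarrow> n = i" if "n < ?m" for n
      using ks(2)[OF that] sk[OF that] v i nth_eq_iff_index_eq[OF rs(1) that i(1)] by auto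
    then have cell: "cell A s v j \<longleftrightarrow> Suc i < ?m \<and> j = num i" for j
      unfolding cell_num[OF s(1)] by auto
    show ?thesis
    proof (cases "Suc i < ?m")
      case True
      then have "\<exists>!j. cell A s v j" "cell A s v (num i)" unfolding cell by auto
      then show ?thesis using e(1)[OF p(1) Q v] p(2)[OF i(1)] i(2) by simp
    next
      case False
      then have "\<not> (\<exists>!j. cell A s v j)" unfolding cell by auto
      moreover have "num i \<oplus> \<one> = lh s" using False i(1) m' lh_eq[OF s(1)] by (simp add: less_Suc_eq)
      ultimately show ?thesis using e(2)[OF p(1) Q v] p(2)[OF i(1)] i(2) by simp
    qed
  qed
  then show thesis by (rule that)
qed

text \<open>For two values the profile index is a recursive function of the index of the coalition,
  whereas \<open>realize\<close> gives mere existence. The uniformity keeps statements about these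
  profiles decidable.\<close>

lemma two_cell_index:
  assumes R: "R \<in> weak_orders X" "R' \<in> weak_orders X" "R \<noteq> R'"
  obtains jj where "recf jj"
    "\<And>k v. v \<in> V \<Longrightarrow> prof_at F (jj k) v = (if v \<in> sect A k then R else R')"
proof -
  let ?W = "weak_orders X"
  obtain p where p: "p \<in> Perm ?W" "\<And>i. i < 2 \<Longrightarrow> num i \<prec> cardinality ?W \<and> entry p (num i) = [R, R'] ! i"
    using Perm_prefix[OF W_Sets W_fin, of "[R, R']"] R by auto
  have p0: "entry p \<zero> = R" using p(2)[of 0] by simp
  have p1': "entry p (num 1) = R'" using p(2)[of 1] by simp
  \<comment> \<open>Only the first entry is prescribed: in a quasi-partition of length two the
    second position stands for the default cell.\<close>
  let ?Q = "\<lambda>k s. is_seq s (num 2) \<and> pair \<zero> k \<in> elems s"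
  have D: "dec (\<lambda>z. ?Q (p1 z) (p2 z))" by (intro recs)
  have n2: "num 2 = num 1 \<oplus> \<one>" by (simp only: numeral_2_eq_2 num.simps One_nat_def)
  have z2: "\<zero> \<prec> num 2" using num_less[of 0 2] by simp
  have "\<exists>s. ?Q k s" for k
  proof -
    obtain s where "is_seq s (num 2)" "\<And>i. i \<prec> num 2 \<Longrightarrow> entry s i = k"
      using seq_ex[OF recf_const] by metis
    then show ?thesis using entry_iff z2 by metis
  qed
  from recf_uniformize[OF D this] obtain S where S0: "recf S" "\<And>k. ?Q k (S k)" by metis
  have S: "is_seq (S k) (num 2)" "entry (S k) (num 0) = k" for k
    using S0(2)[of k] entry_iff[OF _ z2, of "S k" k] by auto
  have Q: "S k \<in> QPart (cardinality ?W)" for k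
  proof -
    have "\<one> \<preceq> num 2" using num_le[of 1 2] by (simp add: add_0_left)
    moreover have "num 2 \<preceq> cardinality ?W" using p(2)[of 1] unfolding n2 succ_le_iff by simp
    ultimately show ?thesis unfolding QPart_def using is_seq_Seq[OF S(1)] lh_eq[OF S(1)] by simp
  qed
  obtain e where eS: "e \<in> Sets" and ef: "is_fun e (pprod (Perm ?W) (QPart (cardinality ?W))) UNIV"
    and e: "\<And>p s v i. \<lbrakk>p \<in> Perm ?W; s \<in> QPart (cardinality ?W); v \<in> V;
       \<exists>!i. cell A s v i; cell A s v i\<rbrakk> \<Longrightarrow> prof_at F (app e (pair p s)) v = entry p i"
    "\<And>p s v l. \<lbrakk>p \<in> Perm ?W; s \<in> QPart (cardinality ?W); v \<in> V;
       \<not> (\<exists>!i. cell A s v i); l \<oplus> \<one> = lh s\<rbrakk> \<Longrightarrow> prof_at F (app e (pair p s)) v = entry p l"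
    by (rule embedding) (rule that; assumption)
  have "recf (\<lambda>k. app e (pair p (S k)))"
    by (rule recf_app[OF eS ef]) (use Q p(1) in \<open>auto intro!: recs S0\<close>)
  moreover have "prof_at F (app e (pair p (S k))) v = (if v \<in> sect A k then R else R')" if v: "v \<in> V" for k v
  proof -
    have cell: "cell A (S k) v i \<longleftrightarrow> i = \<zero> \<and> v \<in> sect A k" for i
      unfolding cell_num[OF S(1)] using S(2)[of k] by auto
    show ?thesis
    proof (cases "v \<in> sect A k")
      case True
      then show ?thesis using e(1)[OF p(1) Q v, of k \<zero>] p0 unfolding cell by simp
    next
      case False
      have l: "num 1 \<oplus> \<one> = lh (S k)" unfolding lh_eq[OF S(1)] n2 ..
      have "\<not> (\<exists>!i. cell A (S k) v i)" unfolding cell using False by blast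
      from e(2)[OF p(1) Q v this l] show ?thesis using False p1' by simp
    qed
  qed
  ultimately show thesis by (rule that)
qed

section \<open>Comparison of the non-dictatorship conditions\<close>

lemma two_alternatives: obtains x y where "x \<in> X" "y \<in> X" "x \<noteq> y"
proof -
  obtain n where n: "has_card X n" using has_card_ex[OF X_Sets X_fin] by metis
  have "num 3 \<preceq> n" using society cardinality_eq[OF n] unfolding society_def by simp
  moreover have "num 0 \<prec> num 3" "num 1 \<prec> num 3" unfolding num_less by simp_all
  ultimately have l: "num 0 \<prec> n" "num 1 \<prec> n" using ar.less_le_trans by metis+
  obtain s where "is_seq s n" and s: "\<And>i. i \<prec> n \<Longrightarrow> entry s i \<in> X" "\<And>y. y \<in> X \<Longrightarrow> \<exists>!i. i \<prec> n \<and> entry s i = y"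
    using n unfolding has_card_iff by auto
  have "entry s (num 0) \<noteq> entry s (num 1)"
  proof
    assume "entry s (num 0) = entry s (num 1)"
    then have "num 0 = num 1" using l by (intro ex1_unique[OF s(2)[OF s(1)[OF l(2)]]]) auto
    then show False unfolding num_inject by simp
  qed
  then show thesis using s(1)[OF l(1)] s(1)[OF l(2)] that by metis
qed

lemma top_order: 
  assumes "x \<in> X"
  obtains r where "r \<in> weak_orders X" "\<And>a b. \<lbrakk>a \<in> X; b \<in> X\<rbrakk> \<Longrightarrow> wle r a b \<longleftrightarrow> (a = x \<longrightarrow> b = x)"
proof (rule weak_order_ex[OF X_Sets X_fin, where P = "\<lambda>a b. a = x \<longrightarrow> b = x"])
  show "dec (\<lambda>z. p1 z = x \<longrightarrow> p2 z = x)" by (intro recs)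
qed (use that in auto)

text \<open>Members of \<open>K\<close> put \<open>y\<close> on top and all other voters put
  \<open>x\<close> on top. The voters who fail to rank \<open>y\<close> below \<open>x\<close> all
  lie in the finite set \<open>K\<close>, so the cofinite rest prevails.\<close>

lemma finite_coalition_outvoted:
  assumes \<sigma>: "cofinite_coalitions V X F \<sigma>" and K: "alg K" "fin_set K"
  shows "\<exists>j. \<exists>x\<in>X. \<exists>y\<in>X. (\<forall>v\<in>K. wlt (prof_at F j v) x y) \<and> wlt (app \<sigma> j) y x"
proof -
  obtain x y where xy: "x \<in> X" "y \<in> X" "x \<noteq> y" using two_alternatives by metis
  obtain R where R: "R \<in> weak_orders X" "\<And>a b. \<lbrakk>a \<in> X; b \<in> X\<rbrakk> \<Longrightarrow> wle R a b \<longleftrightarrow> (a = y \<longrightarrow> b = y)"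
    using top_order[OF xy(2)] by metis
  obtain R' where R': "R' \<in> weak_orders X" "\<And>a b. \<lbrakk>a \<in> X; b \<in> X\<rbrakk> \<Longrightarrow> wle R' a b \<longleftrightarrow> (a = x \<longrightarrow> b = x)"
    using top_order[OF xy(1)] by metis
  have lt: "wlt R x y" "wlt R' y x" unfolding wlt_def using R(2) R'(2) xy by auto
  have "{v \<in> V. v \<in> K} = K" using alg_subset[OF K(1)] by auto
  then have simple: "simple (\<lambda>v. if v \<in> K then R else R')" using K(1) by (intro simple_if simple_const) simp
  have "(\<lambda>v. if v \<in> K then R else R') ` V \<subseteq> weak_orders X" using R(1) R'(1) by auto
  from realize[OF simple this] obtain j where j: "\<And>v. v \<in> V \<Longrightarrow> prof_at F j v = (if v \<in> K then R else R')"
    by metis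
  have "fin_set {v \<in> V. \<not> wlt (prof_at F j v) y x}"
    by (rule fin_set_subset[OF K(2)]) (use j lt in \<open>auto split: if_splits\<close>)
  then have "wlt (app \<sigma> j) y x" using \<sigma> xy unfolding cofinite_coalitions_def by simp
  moreover have "\<forall>v\<in>K. wlt (prof_at F j v) x y" using j lt alg_subset[OF K(1)] by auto
  ultimately show ?thesis using xy by auto
qed

lemma cofinite_imp_non_dictatorial:
  assumes "cofinite_coalitions V X F \<sigma>"
  shows "non_dictatorial V X F \<sigma>"
  unfolding non_dictatorial_def
proof
  fix v assume "v \<in> V"
  have "fin_set {v}" unfolding fin_set_def by (intro exI[of _ "v \<oplus> \<one>"]) (simp add: less_succ)
  with finite_coalition_outvoted[OF assms alg_single[OF \<open>v \<in> V\<close>]]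
  show "\<exists>i. \<exists>x\<in>X. \<exists>y\<in>X. wlt (prof_at F i v) x y \<and> wle (app \<sigma> i) y x"
    unfolding wlt_def[of "app \<sigma> _"] by auto
qed

lemma k_imp_non_dictatorial:
  assumes "k_non_dictatorial k V X F \<sigma>" "\<one> \<preceq> k"
  shows "non_dictatorial V X F \<sigma>"
  unfolding non_dictatorial_def
proof
  fix v assume "v \<in> V"
  obtain s where s: "is_seq s \<one>" "\<And>i. i \<prec> \<one> \<Longrightarrow> entry s i = v" using seq_ex[OF recf_const] by metis
  have "s \<in> Seq" "lh s = \<one>" using is_seq_Seq[OF s(1)] lh_eq[OF s(1)] by auto
  then obtain j x y where xy: "x \<in> X" "y \<in> X" "\<And>i. i \<prec> \<one> \<Longrightarrow> wlt (prof_at F j (entry s i)) x y" "wlt (app \<sigma> j) y x"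
    using assms s(2) \<open>v \<in> V\<close> unfolding k_non_dictatorial_def by metis
  have "wlt (prof_at F j v) x y" using xy(3)[of \<zero>] s(2)[of \<zero>] by simp
  then show "\<exists>i. \<exists>x\<in>X. \<exists>y\<in>X. wlt (prof_at F i v) x y \<and> wle (app \<sigma> i) y x"
    using xy(1,2,4) unfolding wlt_def[of "app \<sigma> _"] by auto
qed

end

section \<open>Arithmetical comprehension yields the possibility theorems\<close>

context RCA0
begin

lemma ACA_dec_ex:
  assumes ACA and D: "dec (\<lambda>z. Q (p1 z) (p2 z))"
  shows "dec (\<lambda>x. \<exists>y. Q x y)"
proof -
  let ?E = "some_assignment(0 := {z. Q (p1 z) (p2 z)})"
  let ?\<phi> = "ExN 1 (Mem (PairT (Var 0) (Var 1)) 0)"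
  have "set_assignment ?E" using dec_Sets[OF D] by (rule set_assignment_upd[OF set_assignment_some])
  moreover have "arithmetical ?\<phi>" by simp
  ultimately have "\<exists>Y\<in>Sets. \<forall>a. a \<in> Y \<longleftrightarrow> sat ((\<lambda>_. \<zero>)(0 := a)) ?E ?\<phi>"
    using \<open>ACA\<close>[unfolded ACA_def, rule_format, of ?\<phi> ?E "\<lambda>_. \<zero>" 0] by blast
  then obtain Y where Y: "Y \<in> Sets" "\<And>a. a \<in> Y \<longleftrightarrow> (\<exists>y. Q a y)"
    by (auto simp: pair_fold)
  have "dec (\<lambda>x. x \<in> Y)" using Y(1) by (rule dec_in)
  then show ?thesis unfolding Y(2) .
qed

lemma ACA_dec_all:
  assumes ACA "dec (\<lambda>z. Q (p1 z) (p2 z))"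
  shows "dec (\<lambda>x. \<forall>y. Q x y)"
  using dec_not[OF ACA_dec_ex[OF assms(1) dec_not[OF assms(2)]]] by simp

end

context countable_society
begin

text \<open>
  \<open>U\<close> behaves like a nonprincipal ultrafilter on \<open>A\<close>: a set \<open>A\<^sub>k\<close> is accepted when it has
  unbounded intersection with all sets accepted before it.
\<close>

lemma nonprincipal_ultrafilter:
  assumes ACA and inf: "\<not> fin_set V"
  obtains U where "U \<in> Sets"
    "\<And>k1 k2 k3 b. \<exists>v\<in>V. b \<preceq> v \<and> (v \<in> sect A k1 \<longleftrightarrow> k1 \<in> U) \<and> (v \<in> sect A k2 \<longleftrightarrow> k2 \<in> U) \<and>
       (v \<in> sect A k3 \<longleftrightarrow> k3 \<in> U)"
proof -
  note ACA_recs = ACA_dec_ex[OF \<open>ACA\<close>] ACA_dec_all[OF \<open>ACA\<close>]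
  define P where "P k S w \<longleftrightarrow> w \<in> V \<and> (\<forall>j. j \<prec> k \<longrightarrow> j \<in> S \<longrightarrow> w \<in> sect A j)" for k S w
  \<comment> \<open>The recursion principle carries a parameter \<open>v\<close>; this clause is
    constant in it, and \<open>U\<close> is read off at the parameter zero.\<close>
  define Cl :: "'a \<Rightarrow> 'a \<Rightarrow> 'a set \<Rightarrow> bool"
    where "Cl v k S \<longleftrightarrow> (\<forall>b. \<exists>w. b \<preceq> w \<and> w \<in> sect A k \<and> P k S w)" for v k S
  have D: "dec (\<lambda>z. Cl (p1 z) (p1 (p2 z)) (elems (p2 (p2 z))))"
    unfolding Cl_def P_def
    by (rule ACA_recs | intro recs V_Sets A_Sets)+
  have cong: "P k S w \<longleftrightarrow> P k S' w" if "\<And>j. j \<prec> k \<Longrightarrow> j \<in> S \<longleftrightarrow> j \<in> S'" for k S S' w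
    using that by (simp add: P_def)
  have "Cl v k S = Cl v k S'" if "\<And>j. j \<prec> k \<Longrightarrow> j \<in> S \<longleftrightarrow> j \<in> S'" for v k S S'
  proof -
    have "P k S w \<longleftrightarrow> P k S' w" for w by (rule cong) (rule that)
    then show ?thesis unfolding Cl_def by simp
  qed
  from course_of_values[OF D this] obtain Y where
    Y: "Y \<in> Sets" "\<And>k v. pair k v \<in> Y \<longleftrightarrow> Cl v k {j. pair j v \<in> Y}" by metis
  define U where "U = {k. pair k \<zero> \<in> Y}"
  have U_Sets: "U \<in> Sets" unfolding U_def by (intro dec_Sets recs Y(1))
  have U: "k \<in> U \<longleftrightarrow> (\<forall>b. \<exists>w. b \<preceq> w \<and> w \<in> sect A k \<and> P k U w)" for k
    using Y(2)[of k \<zero>] unfolding U_def Cl_def by simp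
  \<comment> \<open>Accepting \<open>k\<close> preserves unboundedness by the very condition for
    acceptance. The statement is arithmetical, hence decidable under \<open>ACA\<close>, so
    induction applies.\<close>
  have unbounded: "\<forall>b. \<exists>w. b \<preceq> w \<and> P k U w" for k
  proof (rule dec_induct[where P = "\<lambda>k. \<forall>b. \<exists>w. b \<preceq> w \<and> P k U w"])
    show "dec (\<lambda>k. \<forall>b. \<exists>w. b \<preceq> w \<and> P k U w)"
      unfolding P_def by (rule ACA_recs | intro recs V_Sets A_Sets U_Sets)+
    show "\<forall>b. \<exists>w. b \<preceq> w \<and> P \<zero> U w"
      using inf unfolding P_def fin_set_def by (metis ar.not_le not_less_zero)
    fix k assume IH: "\<forall>b. \<exists>w. b \<preceq> w \<and> P k U w"
    have Suc: "P (k \<oplus> \<one>) U w \<longleftrightarrow> P k U w \<and> (k \<in> U \<longrightarrow> w \<in> sect A k)" for w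
      unfolding P_def less_succ by auto
    show "\<forall>b. \<exists>w. b \<preceq> w \<and> P (k \<oplus> \<one>) U w"
    proof (cases "k \<in> U")
      case True
      then show ?thesis using U[THEN iffD1, OF True] unfolding Suc by metis
    next
      case False
      then show ?thesis using IH unfolding Suc by simp
    qed
  qed
  \<comment> \<open>If \<open>k\<close> is rejected, then beyond some bound no voter in the
    intersection formed so far lies in the set with index \<open>k\<close>. These bounds are chosen
    outside the structure, which is harmless because only three of them are combined.\<close>
  have "\<exists>b. k \<notin> U \<longrightarrow> (\<forall>w. b \<preceq> w \<longrightarrow> P k U w \<longrightarrow> w \<notin> sect A k)" for k
    using U[of k] by auto
  then obtain bd where bd: "\<And>k w. \<lbrakk>k \<notin> U; bd k \<preceq> w; P k U w\<rbrakk> \<Longrightarrow> w \<notin> sect A k" by metis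
  have faithful: "w \<in> sect A k \<longleftrightarrow> k \<in> U" if "k \<prec> m" "P m U w" "bd k \<preceq> w" for k m w
  proof (cases "k \<in> U")
    case False
    have "P k U w" using that(1,2) ar.less_trans unfolding P_def by metis
    then show ?thesis using bd[OF False that(3)] False by simp
  qed (use that in \<open>simp add: P_def\<close>)
  show thesis
  proof (rule that[OF U_Sets])
    fix k1 k2 k3 b
    let ?m = "k1 \<oplus> k2 \<oplus> k3 \<oplus> \<one>" and ?b = "b \<oplus> bd k1 \<oplus> bd k2 \<oplus> bd k3"
    obtain w where w: "?b \<preceq> w" "P ?m U w" using unbounded by metis
    have k: "k1 \<prec> ?m" "k2 \<prec> ?m" "k3 \<prec> ?m"
      unfolding less_succ_iff by (metis le_add1 le_add2 ar.order_trans)+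
    have b: "b \<preceq> w" "bd k1 \<preceq> w" "bd k2 \<preceq> w" "bd k3 \<preceq> w"
      using w(1) by (metis le_add1 le_add2 ar.order_trans)+
    show "\<exists>v\<in>V. b \<preceq> v \<and> (v \<in> sect A k1 \<longleftrightarrow> k1 \<in> U) \<and> (v \<in> sect A k2 \<longleftrightarrow> k2 \<in> U) \<and>
       (v \<in> sect A k3 \<longleftrightarrow> k3 \<in> U)"
      using faithful[OF k(1) w(2) b(2)] faithful[OF k(2) w(2) b(3)] faithful[OF k(3) w(2) b(4)] b(1)
      using w(2) by (intro bexI[of _ w]) (simp_all add: P_def)
  qed
qed

text \<open>Every property is read off from a voter who agrees with society on up to three given
  comparisons and can be found arbitrarily far out. Three comparisons give transitivity, two give
  totality and independence, and going beyond all dissenters gives the cofinite coalitions property.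
  Unanimity is its case without dissenters.\<close>

lemma ACA_swf:
  assumes ACA and inf: "\<not> fin_set V"
  obtains \<sigma> where "swf V X F \<sigma>" "cofinite_coalitions V X F \<sigma>"
proof -
  let ?W = "weak_orders X"
  obtain U where U_Sets: "U \<in> Sets"
    and U: "\<And>k1 k2 k3 b. \<exists>v\<in>V. b \<preceq> v \<and> (v \<in> sect A k1 \<longleftrightarrow> k1 \<in> U) \<and> (v \<in> sect A k2 \<longleftrightarrow> k2 \<in> U) \<and>
       (v \<in> sect A k3 \<longleftrightarrow> k3 \<in> U)"
    using nonprincipal_ultrafilter[OF assms] by metis
  obtain m where m: "recf m" and meas: "\<And>n x y v. \<lbrakk>x \<in> X; y \<in> X; v \<in> V\<rbrakk> \<Longrightarrow>
      wle (prof_at F n v) x y \<longleftrightarrow> v \<in> sect A (m (pair n (pair x y)))"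
    by (rule measure_function) (rule that; assumption)
  define acc where "acc i x y \<longleftrightarrow> m (pair i (pair x y)) \<in> U" for i x y
  have faithful: "\<exists>v\<in>V. b \<preceq> v \<and> (wle (prof_at F i v) x y \<longleftrightarrow> acc i x y) \<and>
      (wle (prof_at F i' v) x' y' \<longleftrightarrow> acc i' x' y') \<and> (wle (prof_at F i'' v) x'' y'' \<longleftrightarrow> acc i'' x'' y'')"
    if "x \<in> X" "y \<in> X" "x' \<in> X" "y' \<in> X" "x'' \<in> X" "y'' \<in> X" for b i i' i'' x y x' y' x'' y''
    using U[of b "m (pair i (pair x y))" "m (pair i' (pair x' y'))" "m (pair i'' (pair x'' y''))"]
    by (simp add: acc_def meas that cong: bex_cong)
  have order: "\<exists>r\<in>?W. \<forall>x\<in>X. \<forall>y\<in>X. wle r x y \<longleftrightarrow> acc i x y" for i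
  proof (rule weak_order_ex[OF X_Sets X_fin, where P = "acc i"])
    show "dec (\<lambda>z. acc i (p1 z) (p2 z))"
      unfolding acc_def by (intro recs U_Sets recf_comp[OF m])
    show "acc i x z" if xyz: "x \<in> X" "y \<in> X" "z \<in> X" "acc i x y" "acc i y z" for x y z
      using faithful[OF xyz(1,2) xyz(2,3) xyz(1,3), of \<zero> i i i] xyz(4,5) weak_ordersD(3)[OF prof_in xyz(1-3)] by metis
    show "acc i x y \<or> acc i y x" if xy: "x \<in> X" "y \<in> X" for x y
      using faithful[OF xy(1,2) xy(2,1) xy(1,2), of \<zero> i i i] weak_ordersD(4)[OF prof_in xy] by metis
  qed metis
  then obtain s where s: "\<And>i. s i \<in> ?W" "\<And>i x y. x \<in> X \<Longrightarrow> y \<in> X \<Longrightarrow> wle (s i) x y \<longleftrightarrow> acc i x y" by metis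
  \<comment> \<open>The social order was chosen in HOL, but it is the only coded weak order with
    these comparisons, so its graph is decidable.\<close>
  have "recf s"
  proof (rule recf_graph)
    show "dec (\<lambda>z. p2 z \<in> ?W \<and> (\<forall>x\<in>X. \<forall>y\<in>X. wle (p2 z) x y \<longleftrightarrow> acc (p1 z) x y))"
      unfolding acc_def by (intro recs W_Sets X_fin X_Sets U_Sets recf_comp[OF m])
    show "r \<in> ?W \<and> (\<forall>x\<in>X. \<forall>y\<in>X. wle r x y \<longleftrightarrow> acc i x y) \<longleftrightarrow> r = s i" for i r
      using weak_order_eqI[OF _ s(1), of r i] s by metis
  qed
  define \<sigma> where "\<sigma> = {z. z \<in> graph s \<and> p1 z \<in> UNIV}"
  have \<sigma>: "\<sigma> \<in> Sets" "is_fun \<sigma> UNIV ?W" "\<And>i. app \<sigma> i = s i"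
    unfolding \<sigma>_def using graph_restrict_Sets[OF \<open>recf s\<close> UNIV_Sets] graph_is_fun[of UNIV s ?W] s(1) by simp_all
  have lt: "wlt (s i) x y \<longleftrightarrow> acc i x y \<and> \<not> acc i y x" if "x \<in> X" "y \<in> X" for i x y
    using s(2) that by (simp add: wlt_def)
  have cofin: "wlt (s i) x y" if xy: "x \<in> X" "y \<in> X" and f: "fin_set {v \<in> V. \<not> wlt (prof_at F i v) x y}" for i x y
  proof -
    obtain b where b: "\<forall>v\<in>{v \<in> V. \<not> wlt (prof_at F i v) x y}. v \<prec> b" using f unfolding fin_set_def by metis
    obtain v where v: "v \<in> V" "b \<preceq> v" "wle (prof_at F i v) x y \<longleftrightarrow> acc i x y" "wle (prof_at F i v) y x \<longleftrightarrow> acc i y x"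
      using faithful[OF xy(1,2) xy(2,1) xy(1,2), of b i i i] by metis
    have "wlt (prof_at F i v) x y" using b v(1,2) ar.not_le by auto
    then show ?thesis using lt[OF xy] v(3,4) by (simp add: wlt_def)
  qed
  have "swf V X F \<sigma>"
    unfolding swf_def \<sigma>(3)
  proof (intro conjI ballI allI impI \<sigma>(1,2))
    fix x y i assume xy: "x \<in> X" "y \<in> X" and un: "\<forall>v\<in>V. wlt (prof_at F i v) x y"
    have "{v \<in> V. \<not> wlt (prof_at F i v) x y} = {}" using un by auto
    then have "fin_set {v \<in> V. \<not> wlt (prof_at F i v) x y}" by (simp only: fin_set_def) simp
    then show "wlt (s i) x y" by (rule cofin[OF xy])
  next
    fix x y i j assume xy: "x \<in> X" "y \<in> X"
      and agree: "\<forall>v\<in>V. agree_on x y (prof_at F i v) (prof_at F j v)"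
    show "agree_on x y (s i) (s j)"
      unfolding agree_on_def
    proof (intro ballI)
      fix a b assume ab: "a \<in> {x, y}" "b \<in> {x, y}"
      then have abX: "a \<in> X" "b \<in> X" using xy by auto
      obtain v where v: "v \<in> V" "wle (prof_at F i v) a b \<longleftrightarrow> acc i a b" "wle (prof_at F j v) a b \<longleftrightarrow> acc j a b"
        using faithful[OF abX abX abX, of \<zero> i j i] by metis
      have "wle (prof_at F i v) a b \<longleftrightarrow> wle (prof_at F j v) a b"
        using agree[THEN bspec, OF v(1)] ab unfolding agree_on_def by blast
      then show "wle (s i) a b \<longleftrightarrow> wle (s j) a b" using s(2)[OF abX] v(2,3) by simp
    qed
  qed
  moreover have "cofinite_coalitions V X F \<sigma>"
    unfolding cofinite_coalitions_def \<sigma>(3) using cofin by simp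
  ultimately show thesis by (rule that)
qed

text \<open>The sequence may have nonstandard length, so that its range belongs to the algebra needs
  an induction inside the structure, adding one singleton at a time. The statement proved is
  arithmetical, and this is what \<open>ACA\<close> is used for.\<close>

lemma ACA_finitely_non_dictatorial:
  assumes ACA and \<sigma>: "cofinite_coalitions V X F \<sigma>"
  shows "finitely_non_dictatorial V X F \<sigma>"
  unfolding finitely_non_dictatorial_def k_non_dictatorial_def
proof (intro allI impI ballI)
  fix k s assume s: "s \<in> Seq" "lh s \<preceq> k \<and> (\<forall>i. i \<prec> lh s \<longrightarrow> entry s i \<in> V)"
  note ACA_recs = ACA_dec_ex[OF \<open>ACA\<close>] ACA_dec_all[OF \<open>ACA\<close>]
  define E where "E i = (if i \<prec> lh s then entry s i else \<zero>)" for i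
  have E: "recf E" unfolding E_def by (rule recf_entry[OF is_seq_lh[OF s(1)]])
  have "l \<preceq> lh s \<longrightarrow> (\<exists>k. \<forall>v. v \<in> sect A k \<longleftrightarrow> (\<exists>i. i \<prec> l \<and> E i = v))" for l
  proof (rule dec_induct[where P = "\<lambda>l. l \<preceq> lh s \<longrightarrow> (\<exists>k. \<forall>v. v \<in> sect A k \<longleftrightarrow> (\<exists>i. i \<prec> l \<and> E i = v))"])
    show "dec (\<lambda>l. l \<preceq> lh s \<longrightarrow> (\<exists>k. \<forall>v. v \<in> sect A k \<longleftrightarrow> (\<exists>i. i \<prec> l \<and> E i = v)))"
      by (rule dec_imp, intro recs, rule ACA_recs, rule ACA_recs) (intro recs A_Sets recf_comp[OF E])
    show "\<zero> \<preceq> lh s \<longrightarrow> (\<exists>k. \<forall>v. v \<in> sect A k \<longleftrightarrow> (\<exists>i. i \<prec> \<zero> \<and> E i = v))"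
      using alg_empty unfolding alg_def by (auto simp: not_less_zero)
    fix l assume IH: "l \<preceq> lh s \<longrightarrow> (\<exists>k. \<forall>v. v \<in> sect A k \<longleftrightarrow> (\<exists>i. i \<prec> l \<and> E i = v))"
    show "l \<oplus> \<one> \<preceq> lh s \<longrightarrow> (\<exists>k. \<forall>v. v \<in> sect A k \<longleftrightarrow> (\<exists>i. i \<prec> l \<oplus> \<one> \<and> E i = v))"
    proof
      assume "l \<oplus> \<one> \<preceq> lh s"
      then have l: "l \<prec> lh s" by (simp add: succ_le_iff)
      then obtain k where k: "\<And>v. v \<in> sect A k \<longleftrightarrow> (\<exists>i. i \<prec> l \<and> E i = v)"
        using IH by (auto simp: le_def)
      have "E l \<in> V" using s(2) l by (simp add: E_def)
      then have "alg (sect A k \<union> {E l})" by (intro alg_Un alg_sect alg_single)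
      then obtain k' where "sect A k' = sect A k \<union> {E l}" unfolding alg_def by metis
      then have "v \<in> sect A k' \<longleftrightarrow> (\<exists>i. i \<prec> l \<oplus> \<one> \<and> E i = v)" for v
        unfolding less_succ using k[of v] by auto
      then show "\<exists>k. \<forall>v. v \<in> sect A k \<longleftrightarrow> (\<exists>i. i \<prec> l \<oplus> \<one> \<and> E i = v)" by metis
    qed
  qed
  from this[of "lh s"] obtain k where k: "\<And>v. v \<in> sect A k \<longleftrightarrow> (\<exists>i. i \<prec> lh s \<and> E i = v)" by auto
  obtain b where b: "\<And>i. i \<prec> lh s \<Longrightarrow> E i \<prec> b" using recf_bounded[OF E] by metis
  have "fin_set (sect A k)" unfolding fin_set_def using k b by (intro exI[of _ b]) auto
  from finite_coalition_outvoted[OF \<sigma> alg_sect this] obtain j x y where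
    xy: "x \<in> X" "y \<in> X" "\<And>v. v \<in> sect A k \<Longrightarrow> wlt (prof_at F j v) x y" "wlt (app \<sigma> j) y x" by auto
  have "entry s i \<in> sect A k" if "i \<prec> lh s" for i
    unfolding k using that by (intro exI[of _ i]) (simp add: E_def)
  then show "\<exists>j. \<exists>x\<in>X. \<exists>y\<in>X. (\<forall>i. i \<prec> lh s \<longrightarrow> wlt (prof_at F j (entry s i)) x y) \<and> wlt (app \<sigma> j) y x"
    using xy by (intro exI[of _ j] bexI[of _ x] bexI[of _ y]) simp_all
qed

end

context RCA0
begin

lemma countable_societyI: "society V X A F \<Longrightarrow> countable_society M V X A F"
  by (intro countable_society.intro countable_society_axioms.intro RCA0_axioms)

lemma ACA_imp_FPT_plus: "ACA \<Longrightarrow> FPT_plus"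
  unfolding FPT_plus_def possibility_def using countable_society.ACA_swf[OF countable_societyI] by metis

lemma ACA_imp_FPT_fin: "ACA \<Longrightarrow> FPT_fin"
  unfolding FPT_fin_def possibility_def
  using countable_society.ACA_swf[OF countable_societyI] countable_society.ACA_finitely_non_dictatorial[OF countable_societyI] by metis

lemma FPT_fin_imp_FPT_k: "1 \<le> k \<Longrightarrow> FPT_fin \<Longrightarrow> FPT_k k"
  unfolding FPT_fin_def FPT_k_def possibility_def finitely_non_dictatorial_def
  using num_le[of 1 k] by (simp add: add_0_left) metis

lemma FPT_k_imp_FPT:
  assumes "1 \<le> k" "FPT_k k"
  shows FPT
proof -
  have "\<one> \<preceq> num k" using num_le[of 1 k] assms(1) by (simp add: add_0_left)
  then show ?thesis using assms(2)
    unfolding FPT_def FPT_k_def possibility_def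
    using countable_society.k_imp_non_dictatorial[OF countable_societyI] by metis
qed

lemma FPT_plus_imp_FPT: "FPT_plus \<Longrightarrow> FPT"
  unfolding FPT_def FPT_plus_def possibility_def
  using countable_society.cofinite_imp_non_dictatorial[OF countable_societyI] by metis

section \<open>Arithmetical comprehension from projections\<close>

lemma recf_val: "(\<And>x. recf (\<lambda>z. \<epsilon> z x)) \<Longrightarrow> recf (\<lambda>z. val (\<epsilon> z) t)"
  by (induction t) (auto intro: recs)

text \<open>Formulas are standard objects, so the induction on them is external. The number
  assignment is allowed to depend recursively on one argument; a quantifier pairs that argument with
  the bound variable, and the hypothesis removes the new coordinate again.\<close>

lemma ACA_if_projections:
  assumes proj: "\<And>R. R \<in> Sets \<Longrightarrow> {x. \<exists>y. pair x y \<in> R} \<in> Sets"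
  shows ACA
proof -
  have ex: "dec (\<lambda>x. \<exists>y. Q x y)" if "dec (\<lambda>z. Q (p1 z) (p2 z))" for Q
    using proj[OF dec_Sets[OF that]] by (simp add: dec_def)
  have all: "dec (\<lambda>x. \<forall>y. Q x y)" if "dec (\<lambda>z. Q (p1 z) (p2 z))" for Q
    using dec_not[OF ex[OF dec_not[OF that]]] by simp
  have sat: "dec (\<lambda>z. sat (\<epsilon> z) E \<phi>)"
    if "arithmetical \<phi>" "set_assignment E" "\<And>x. recf (\<lambda>z. \<epsilon> z x)" for \<epsilon> E \<phi>
    using that
  proof (induction \<phi> arbitrary: \<epsilon>)
    case (Mem t Y)
    then show ?case by (auto intro!: dec_mem recf_val simp: set_assignment_def)
  next
    case (AllN x \<phi>)
    have "recf (\<lambda>w. ((\<epsilon> (p1 w))(x := p2 w)) y)" for y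
      using recf_comp[OF AllN.prems(3) recf_p1'] recf_p2' by (cases "y = x") auto
    then have "dec (\<lambda>w. sat ((\<epsilon> (p1 w))(x := p2 w)) E \<phi>)"
      using AllN by simp
    from all[OF this] show ?case by (simp only: sat.simps)
  next
    case (ExN x \<phi>)
    have "recf (\<lambda>w. ((\<epsilon> (p1 w))(x := p2 w)) y)" for y
      using recf_comp[OF ExN.prems(3) recf_p1'] recf_p2' by (cases "y = x") auto
    then have "dec (\<lambda>w. sat ((\<epsilon> (p1 w))(x := p2 w)) E \<phi>)"
      using ExN by simp
    from ex[OF this] show ?case by (simp only: sat.simps)
  qed (auto intro!: dec_eq dec_less dec_not dec_conj dec_disj dec_imp dec_iff recf_val)
  show ACA
    unfolding ACA_def
  proof (intro allI impI)
    fix \<phi> and x :: nat and e :: "nat \<Rightarrow> 'a" and E assume *: "arithmetical \<phi> \<and> set_assignment E"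
    have "recf (\<lambda>a. (e(x := a)) y)" for y
      by (cases "y = x") (auto intro: recs)
    then have "dec (\<lambda>a. sat (e(x := a)) E \<phi>)" using * by (intro sat) simp_all
    from dec_Sets[OF this] show "\<exists>Y\<in>Sets. \<forall>a. a \<in> Y \<longleftrightarrow> sat (e(x := a)) E \<phi>"
      by (intro bexI[of _ "{a. sat (e(x := a)) E \<phi>}"]) simp_all
  qed
qed

end

section \<open>The pivotal voter\<close>

locale arrow = countable_society +
  fixes \<sigma> :: "'a set"
  assumes swf: "swf V X F \<sigma>"
begin

lemma \<sigma>_Sets: "\<sigma> \<in> Sets" and \<sigma>_fun: "is_fun \<sigma> UNIV (weak_orders X)"
  using swf unfolding swf_def by auto

lemma \<sigma>_in: "app \<sigma> i \<in> weak_orders X"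
  using app_in[OF \<sigma>_fun] by simp

lemma unanimity: "\<lbrakk>x \<in> X; y \<in> X; \<And>v. v \<in> V \<Longrightarrow> wlt (prof_at F i v) x y\<rbrakk> \<Longrightarrow> wlt (app \<sigma> i) x y"
  using swf unfolding swf_def by simp

lemma wle_refl: "r \<in> weak_orders X \<Longrightarrow> x \<in> X \<Longrightarrow> wle r x x"
  using weak_ordersD(4)[of r X x x] by simp

lemma independence:
  assumes xy: "x \<in> X" "y \<in> X"
    and eq: "\<And>v. v \<in> V \<Longrightarrow> wle (prof_at F i v) x y \<longleftrightarrow> wle (prof_at F j v) x y"
      "\<And>v. v \<in> V \<Longrightarrow> wle (prof_at F i v) y x \<longleftrightarrow> wle (prof_at F j v) y x"
  shows "wle (app \<sigma> i) x y \<longleftrightarrow> wle (app \<sigma> j) x y" "wle (app \<sigma> i) y x \<longleftrightarrow> wle (app \<sigma> j) y x"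
proof -
  have "agree_on x y (prof_at F i v) (prof_at F j v)" if "v \<in> V" for v
    using eq[OF that] wle_refl[OF prof_in[OF that]] xy by (simp add: agree_on_def)
  then have "agree_on x y (app \<sigma> i) (app \<sigma> j)"
    using swf xy unfolding swf_def by simp
  then show "wle (app \<sigma> i) x y \<longleftrightarrow> wle (app \<sigma> j) x y" "wle (app \<sigma> i) y x \<longleftrightarrow> wle (app \<sigma> j) y x"
    by (simp_all add: agree_on_def)
qed

lemma \<sigma>_trans: "\<lbrakk>x \<in> X; y \<in> X; z \<in> X; wlt (app \<sigma> j) x y; wlt (app \<sigma> j) y z\<rbrakk> \<Longrightarrow> wlt (app \<sigma> j) x z"
  unfolding wlt_def using weak_ordersD(3)[OF \<sigma>_in] by metis

text \<open>The reversal is free to choose its society, and with exactly three alternatives every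
  order needed is given by three levels.\<close>

definition triple :: "'a \<Rightarrow> 'a \<Rightarrow> 'a \<Rightarrow> bool" where
  "triple x y z \<longleftrightarrow> X = {x, y, z} \<and> x \<noteq> y \<and> x \<noteq> z \<and> y \<noteq> z"

text \<open>The numbers are the levels of \<open>x\<close>, of \<open>y\<close> and of all other
  alternatives: larger levels rank higher, equal levels mean indifference.\<close>

definition ord :: "'a \<Rightarrow> 'a \<Rightarrow> nat \<Rightarrow> nat \<Rightarrow> nat \<Rightarrow> 'a" where
  "ord x y i j k = (SOME r. r \<in> weak_orders X \<and> (\<forall>u\<in>X. \<forall>w\<in>X. wle r u w \<longleftrightarrow>
     (if u = x then i else if u = y then j else k) \<le> (if w = x then i else if w = y then j else k)))"

lemma ord: "ord x y i j k \<in> weak_orders X"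
    "\<lbrakk>u \<in> X; w \<in> X\<rbrakk> \<Longrightarrow> wle (ord x y i j k) u w \<longleftrightarrow>
     (if u = x then i else if u = y then j else k) \<le> (if w = x then i else if w = y then j else k)"
proof -
  let ?\<rho> = "\<lambda>u. if u = x then num i else if u = y then num j else num k"
  have \<rho>: "?\<rho> u \<preceq> ?\<rho> w \<longleftrightarrow>
     (if u = x then i else if u = y then j else k) \<le> (if w = x then i else if w = y then j else k)" for u w
    by simp
  have R: "recf ?\<rho>" by (intro recs)
  have D: "dec (\<lambda>z. ?\<rho> (p1 z) \<preceq> ?\<rho> (p2 z))"
    by (rule dec_le[OF recf_comp[OF R recf_p1'] recf_comp[OF R recf_p2']])
  have "\<exists>r. r \<in> weak_orders X \<and> (\<forall>u\<in>X. \<forall>w\<in>X. wle r u w \<longleftrightarrow> ?\<rho> u \<preceq> ?\<rho> w)"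
  proof (rule weak_order_ex[OF X_Sets X_fin D])
    show "?\<rho> u \<preceq> ?\<rho> w" if "?\<rho> u \<preceq> ?\<rho> v" "?\<rho> v \<preceq> ?\<rho> w" for u v w
      using that by (rule ar.order_trans)
    show "?\<rho> u \<preceq> ?\<rho> w \<or> ?\<rho> w \<preceq> ?\<rho> u" for u w by (rule ar.linear)
  qed metis
  from someI_ex[OF this[unfolded \<rho>]] show "ord x y i j k \<in> weak_orders X"
    "\<lbrakk>u \<in> X; w \<in> X\<rbrakk> \<Longrightarrow> wle (ord x y i j k) u w \<longleftrightarrow>
     (if u = x then i else if u = y then j else k) \<le> (if w = x then i else if w = y then j else k)"
    unfolding ord_def by simp_all
qed

lemma ord_triple:
  assumes "triple x y z"
  shows "wle (ord x y i j k) x y \<longleftrightarrow> i \<le> j" "wle (ord x y i j k) y x \<longleftrightarrow> j \<le> i"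
    "wle (ord x y i j k) x z \<longleftrightarrow> i \<le> k" "wle (ord x y i j k) z x \<longleftrightarrow> k \<le> i"
    "wle (ord x y i j k) y z \<longleftrightarrow> j \<le> k" "wle (ord x y i j k) z y \<longleftrightarrow> k \<le> j"
  using assms ord(2)[of _ _ x y i j k] unfolding triple_def by auto

lemma alg_mem: "alg S \<Longrightarrow> alg {v \<in> V. v \<in> S}"
  using alg_subset[of S] by (simp add: Collect_conj_eq Int_absorb1)

lemma realize_orders:
  assumes "simple g" "\<And>v. v \<in> V \<Longrightarrow> g v \<in> weak_orders X"
  shows "\<exists>q. \<forall>v\<in>V. prof_at F q v = g v"
proof -
  have "g ` V \<subseteq> weak_orders X" using assms(2) by auto
  from realize[OF assms(1) this] show ?thesis by metis
qed

text \<open>Nobody is indifferent, so \<open>S\<close> determines the profile on the pair, and by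
  independence the social verdict there is a function of \<open>S\<close>.\<close>

definition supports :: "'a set \<Rightarrow> 'a \<Rightarrow> 'a \<Rightarrow> 'a \<Rightarrow> bool" where
  "supports S x y j \<longleftrightarrow> (\<forall>v\<in>V. (v \<in> S \<longrightarrow> wlt (prof_at F j v) x y) \<and> (v \<notin> S \<longrightarrow> wlt (prof_at F j v) y x))"

lemma supports_independent:
  assumes "x \<in> X" "y \<in> X" "supports S x y i" "supports S x y j"
  shows "wle (app \<sigma> i) x y \<longleftrightarrow> wle (app \<sigma> j) x y" "wle (app \<sigma> i) y x \<longleftrightarrow> wle (app \<sigma> j) y x"
proof -
  have "(wle (prof_at F i v) x y \<longleftrightarrow> wle (prof_at F j v) x y) \<and> (wle (prof_at F i v) y x \<longleftrightarrow> wle (prof_at F j v) y x)"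
    if "v \<in> V" for v
    using assms(3,4) that unfolding supports_def wlt_def by (cases "v \<in> S") auto
  then show "wle (app \<sigma> i) x y \<longleftrightarrow> wle (app \<sigma> j) x y" "wle (app \<sigma> i) y x \<longleftrightarrow> wle (app \<sigma> j) y x"
    using independence[OF assms(1,2)] by metis+
qed

text \<open>
  Otherwise, moving \<open>x\<close> above or below \<open>y\<close> in all orders at once would contradict unanimity.
\<close>

lemma extremal:
  assumes t: "triple x y z" and S: "alg S" and j: "supports S x z j" and j': "supports S y z j'"
  shows "wlt (app \<sigma> j) x z \<and> wlt (app \<sigma> j') y z \<or> wlt (app \<sigma> j) z x \<and> wlt (app \<sigma> j') z y"
proof -
  have X: "x \<in> X" "y \<in> X" "z \<in> X" using t by (auto simp: triple_def)
  note o = ord_triple[OF t]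
  have ex: "\<exists>q. \<forall>v\<in>V. prof_at F q v = (if v \<in> S then ord x y i1 i2 i3 else ord x y k1 k2 k3)" for i1 i2 i3 k1 k2 k3
    by (rule realize_orders) (auto intro!: simple_if simple_const alg_mem S ord(1))
  \<comment> \<open>In \<open>q\<close> and in \<open>q'\<close> the members of \<open>S\<close> put
    \<open>z\<close> on top and the others put it at the bottom. Everybody has \<open>x\<close>
    below \<open>y\<close> in \<open>q\<close> and \<open>y\<close> below \<open>x\<close> in
    \<open>q'\<close>. Together with unanimity, transitivity forbids that \<open>z\<close> is
    socially between \<open>x\<close> and \<open>y\<close> in either direction.\<close>
  obtain q where q: "\<And>v. v \<in> V \<Longrightarrow> prof_at F q v = (if v \<in> S then ord x y 0 1 2 else ord x y 1 2 0)"
    using ex by metis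
  obtain q' where q': "\<And>v. v \<in> V \<Longrightarrow> prof_at F q' v = (if v \<in> S then ord x y 1 0 2 else ord x y 2 1 0)"
    using ex by metis
  have s: "supports S x z q" "supports S y z q" "supports S x z q'" "supports S y z q'"
    unfolding supports_def wlt_def using q q' by (simp_all add: o)
  have "wlt (app \<sigma> q) x y" using q by (intro unanimity X) (simp add: wlt_def o)
  then have 1: "\<not> (wle (app \<sigma> q) y z \<and> wle (app \<sigma> q) z x)"
    using weak_ordersD(3)[OF \<sigma>_in, of y z x q] X unfolding wlt_def by metis
  have "wlt (app \<sigma> q') y x" using q' by (intro unanimity X) (simp add: wlt_def o)
  then have 2: "\<not> (wle (app \<sigma> q') x z \<and> wle (app \<sigma> q') z y)"
    using weak_ordersD(3)[OF \<sigma>_in, of x z y q'] X unfolding wlt_def by metis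
  have "wle (app \<sigma> j) x z \<or> wle (app \<sigma> j) z x" "wle (app \<sigma> j') y z \<or> wle (app \<sigma> j') z y"
    using weak_ordersD(4)[OF \<sigma>_in] X by metis+
  then show ?thesis
    using 1 2 supports_independent[OF X(1,3) j s(1)] supports_independent[OF X(1,3) j s(3)]
      supports_independent[OF X(2,3) j' s(2)] supports_independent[OF X(2,3) j' s(4)]
    unfolding wlt_def by metis
qed

text \<open>All voters keep their ranking of \<open>x\<close> and \<open>y\<close>, and
  \<open>z\<close> is inserted: between the two for \<open>i\<close>, on top for the others in
  \<open>T\<close>, at the bottom for the rest. Independence carries the social verdict on
  \<open>x\<close> and \<open>y\<close> back to \<open>j\<close>.\<close>

lemma place_third:
  assumes t: "triple x y z" and i: "i \<in> V" "wlt (prof_at F j i) x y" and T: "alg T"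
  obtains q where "wlt (app \<sigma> q) x y \<Longrightarrow> wlt (app \<sigma> j) x y"
    "wlt (prof_at F q i) x z" "wlt (prof_at F q i) z y"
    "\<And>v. \<lbrakk>v \<in> V; v \<noteq> i; v \<in> T\<rbrakk> \<Longrightarrow> wlt (prof_at F q v) x z \<and> wlt (prof_at F q v) y z"
    "\<And>v. \<lbrakk>v \<in> V; v \<noteq> i; v \<notin> T\<rbrakk> \<Longrightarrow> wlt (prof_at F q v) z x \<and> wlt (prof_at F q v) z y"
proof -
  have X: "x \<in> X" "y \<in> X" "z \<in> X" using t by (auto simp: triple_def)
  note o = ord_triple[OF t]
  let ?xy = "\<lambda>v. wle (prof_at F j v) x y" and ?yx = "\<lambda>v. wle (prof_at F j v) y x"
  \<comment> \<open>The inner tests separate indifference from the two strict rankings, so that the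
    ranking of \<open>x\<close> and \<open>y\<close> is reproduced exactly.\<close>
  define g where "g v = (if v = i then ord x y 0 2 1 else if v \<in> T
      then (if ?xy v then if ?yx v then ord x y 0 0 1 else ord x y 0 1 2 else ord x y 1 0 2)
      else (if ?xy v then if ?yx v then ord x y 1 1 0 else ord x y 1 2 0 else ord x y 2 1 0))" for v
  have "{v \<in> V. v = i} = {i}" using i(1) by auto
  then have "alg {v \<in> V. v = i}" using alg_single[OF i(1)] by simp
  then have "simple g"
    unfolding g_def by (intro simple_if simple_const alg_mem T alg_wle X)
  moreover have "g v \<in> weak_orders X" for v unfolding g_def by (simp add: ord(1))
  ultimately obtain q where q: "\<And>v. v \<in> V \<Longrightarrow> prof_at F q v = g v"
    using realize_orders by metis
  have "(wle (prof_at F q v) x y \<longleftrightarrow> ?xy v) \<and> (wle (prof_at F q v) y x \<longleftrightarrow> ?yx v)" if v: "v \<in> V" for v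
    using weak_ordersD(4)[OF prof_in[OF v, of j] X(1,2)] i(2) unfolding q[OF v] g_def wlt_def
    by (auto simp: o)
  then have "wle (app \<sigma> q) x y \<longleftrightarrow> wle (app \<sigma> j) x y" "wle (app \<sigma> q) y x \<longleftrightarrow> wle (app \<sigma> j) y x"
    using independence[OF X(1,2), of q j] by metis+
  then have 1: "wlt (app \<sigma> q) x y \<Longrightarrow> wlt (app \<sigma> j) x y" by (simp add: wlt_def)
  show thesis
    by (rule that[OF 1]) (use q i(1) in \<open>auto simp: g_def wlt_def o split: if_splits\<close>)
qed

section \<open>Dictators over pairs of alternatives\<close>

definition dictates :: "'a \<Rightarrow> 'a \<Rightarrow> 'a \<Rightarrow> bool" where
  "dictates i x y \<longleftrightarrow> (\<forall>j. wlt (prof_at F j i) x y \<longrightarrow> wlt (app \<sigma> j) x y)"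

text \<open>Using \<open>place_third\<close> with \<open>T = S\<close>, the voter \<open>i\<close>
  counts for \<open>z\<close> against \<open>x\<close> but not for \<open>z\<close> against
  \<open>y\<close>. So exactly \<open>S\<close> supports \<open>x\<close> below \<open>z\<close>,
  exactly \<open>S - {i}\<close> supports \<open>y\<close> below \<open>z\<close>, and the
  hypotheses place \<open>z\<close> socially between \<open>x\<close> and \<open>y\<close>, whatever
  the others think of \<open>x\<close> and \<open>y\<close>.\<close>

lemma pivot_dictates:
  assumes t: "triple x y z" and S: "alg S" "i \<in> S"
    and xz: "\<And>j. supports S x z j \<Longrightarrow> wlt (app \<sigma> j) x z"
    and zy: "\<And>j. supports (S - {i}) y z j \<Longrightarrow> wlt (app \<sigma> j) z y"
  shows "dictates i x y"
  unfolding dictates_def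
proof (intro allI impI)
  fix j assume j: "wlt (prof_at F j i) x y"
  have X: "x \<in> X" "y \<in> X" "z \<in> X" using t by (auto simp: triple_def)
  have i: "i \<in> V" using alg_subset S by auto
  obtain q where q: "wlt (app \<sigma> q) x y \<Longrightarrow> wlt (app \<sigma> j) x y"
    "wlt (prof_at F q i) x z" "wlt (prof_at F q i) z y"
    "\<And>v. \<lbrakk>v \<in> V; v \<noteq> i; v \<in> S\<rbrakk> \<Longrightarrow> wlt (prof_at F q v) x z \<and> wlt (prof_at F q v) y z"
    "\<And>v. \<lbrakk>v \<in> V; v \<noteq> i; v \<notin> S\<rbrakk> \<Longrightarrow> wlt (prof_at F q v) z x \<and> wlt (prof_at F q v) z y"
    using place_third[OF t i j S(1)] by metis
  have "supports S x z q" "supports (S - {i}) y z q"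
    unfolding supports_def using q(2-5) S(2) by auto
  then show "wlt (app \<sigma> j) x y" using q(1) \<sigma>_trans[OF X(1,3,2)] xz zy by metis
qed

text \<open>\<open>z\<close> is placed so that the comparison not controlled by \<open>i\<close>
  becomes unanimous: at the bottom for all others when \<open>i\<close> dictates \<open>x\<close>
  below \<open>z\<close>, on top for all others when \<open>i\<close> dictates \<open>z\<close>
  below \<open>y\<close>.\<close>

lemma dictates_expand:
  assumes t: "triple x y z" and i: "i \<in> V" and d: "dictates i x z \<or> dictates i z y"
  shows "dictates i x y"
  unfolding dictates_def
proof (intro allI impI)
  fix j assume j: "wlt (prof_at F j i) x y"
  have X: "x \<in> X" "y \<in> X" "z \<in> X" using t by (auto simp: triple_def)
  from d show "wlt (app \<sigma> j) x y"
  proof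
    assume d: "dictates i x z"
    obtain q where q: "wlt (app \<sigma> q) x y \<Longrightarrow> wlt (app \<sigma> j) x y"
      "wlt (prof_at F q i) x z" "wlt (prof_at F q i) z y"
      "\<And>v. \<lbrakk>v \<in> V; v \<noteq> i; v \<notin> {}\<rbrakk> \<Longrightarrow> wlt (prof_at F q v) z x \<and> wlt (prof_at F q v) z y"
      using place_third[OF t i j alg_empty] by metis
    have "wlt (prof_at F q v) z y" if "v \<in> V" for v using q(3,4) that by (cases "v = i") auto
    then have "wlt (app \<sigma> q) z y" by (intro unanimity X)
    then show ?thesis using q(1,2) d \<sigma>_trans[OF X(1,3,2)] unfolding dictates_def by metis
  next
    assume d: "dictates i z y"
    obtain q where q: "wlt (app \<sigma> q) x y \<Longrightarrow> wlt (app \<sigma> j) x y"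
      "wlt (prof_at F q i) x z" "wlt (prof_at F q i) z y"
      "\<And>v. \<lbrakk>v \<in> V; v \<noteq> i; v \<in> V\<rbrakk> \<Longrightarrow> wlt (prof_at F q v) x z \<and> wlt (prof_at F q v) y z"
      using place_third[OF t i j alg_V] by metis
    have "wlt (prof_at F q v) x z" if "v \<in> V" for v using q(2,4) that by (cases "v = i") auto
    then have "wlt (app \<sigma> q) x z" by (intro unanimity X)
    then show ?thesis using q(1,3) d \<sigma>_trans[OF X(1,3,2)] unfolding dictates_def by metis
  qed
qed

lemma triple_perm: "triple x y z \<Longrightarrow> triple y x z" "triple x y z \<Longrightarrow> triple x z y"
  unfolding triple_def by auto

text \<open>Otherwise \<open>i\<close> would be pivotal, and hence a dictator.\<close>

lemma remove_voter:
  assumes t: "triple a b c" and nd: "non_dictatorial V X F \<sigma>"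
    and S: "alg S" "i \<in> S" "supports S a b j" "wlt (app \<sigma> j) a b" "supports (S - {i}) a b j'"
  shows "wlt (app \<sigma> j') a b"
proof (rule ccontr)
  assume neg: "\<not> wlt (app \<sigma> j') a b"
  have acb: "triple a c b" and cab: "triple c a b" and bac: "triple b a c" and cba: "triple c b a"
    and bca: "triple b c a"
    using t triple_perm by metis+
  have i: "i \<in> V" using alg_subset S by auto
  have Si: "alg (S - {i})"
  proof -
    have "S - {i} = S \<inter> (V - {i})" using alg_subset[OF S(1)] by auto
    then show ?thesis using alg_Int[OF S(1) alg_Diff[OF alg_single[OF i]]] by simp
  qed
  have ne: "\<not> (wlt (app \<sigma> j) x y \<and> wlt (app \<sigma> j) y x)" for x y j by (simp add: wlt_def)
  \<comment> \<open>Making every voter indifferent between \<open>a\<close> and \<open>c\<close>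
    lets one profile support \<open>T\<close> on both pairs with \<open>b\<close>.\<close>
  have ex: "\<exists>q. supports T a b q \<and> supports T c b q" if "alg T" for T
  proof -
    note o = ord_triple[OF acb]
    have "\<exists>q. \<forall>v\<in>V. prof_at F q v = (if v \<in> T then ord a c 0 0 1 else ord a c 1 1 0)"
      by (rule realize_orders) (auto intro!: simple_if simple_const alg_mem that ord(1))
    then obtain q where "\<forall>v\<in>V. prof_at F q v = (if v \<in> T then ord a c 0 0 1 else ord a c 1 1 0)" by metis
    then have "supports T a b q \<and> supports T c b q" by (simp add: supports_def wlt_def o)
    then show ?thesis by metis
  qed
  obtain q where q: "supports S a b q" "supports S c b q" using ex[OF S(1)] by metis
  obtain q' where q': "supports (S - {i}) a b q'" "supports (S - {i}) c b q'" using ex[OF Si] by metis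
  \<comment> \<open>\<open>extremal\<close> passes verdicts between the pairs \<open>a\<close>,
    \<open>b\<close> and \<open>c\<close>, \<open>b\<close>. With \<open>S\<close> both
    \<open>a\<close> and \<open>c\<close> end up below \<open>b\<close>; without \<open>i\<close> it
    sharpens the mere failure of \<open>a\<close> below \<open>b\<close> to \<open>b\<close> being
    below both.\<close>
  have cb: "wlt (app \<sigma> k) c b" if "supports S c b k" for k
    using extremal[OF acb S(1) S(3) that] S(4) ne by metis
  have ab: "wlt (app \<sigma> k) a b" if "supports S a b k" for k
    using extremal[OF acb S(1) that q(2)] cb[OF q(2)] ne by metis
  have bc: "wlt (app \<sigma> k) b c" if "supports (S - {i}) c b k" for k
    using extremal[OF acb Si S(5) that] neg by metis
  have ba: "wlt (app \<sigma> k) b a" if "supports (S - {i}) a b k" for k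
    using extremal[OF acb Si that q'(2)] bc[OF q'(2)] ne by metis
  \<comment> \<open>Here \<open>b\<close> is the intermediate alternative, for \<open>a\<close> and
    \<open>c\<close> in both orders. \<open>dictates_expand\<close> then covers the four ordered
    pairs that involve \<open>b\<close>.\<close>
  have ac: "dictates i a c" by (rule pivot_dictates[OF acb S(1,2) ab bc])
  have ca: "dictates i c a" by (rule pivot_dictates[OF cab S(1,2) cb ba])
  have "dictates i a b" "dictates i c b" "dictates i b a" "dictates i b c"
    using dictates_expand[OF t i] dictates_expand[OF cba i] dictates_expand[OF bac i] dictates_expand[OF bca i] ac ca
    by metis+
  then have "dictates i x y" if "x \<in> X" "y \<in> X" "x \<noteq> y" for x y
    using that ac ca t unfolding triple_def by auto
  moreover obtain k x y where "x \<in> X" "y \<in> X" "wlt (prof_at F k i) x y" "wle (app \<sigma> k) y x"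
    using nd i unfolding non_dictatorial_def by metis
  ultimately show False unfolding dictates_def wlt_def by metis
qed

end

section \<open>A society computing projections\<close>

context RCA0
begin

section \<open>Three alternatives, permutations and quasi-partitions as sets\<close>

definition X3 :: "'a set" where
  "X3 = {num 0, num 1, num 2}"

abbreviation (input) "W3 \<equiv> weak_orders X3"
abbreviation (input) "N3 \<equiv> cardinality W3"
abbreviation (input) "PQ3 \<equiv> pprod (Perm W3) (QPart N3)"

lemma X3_iff: "i \<in> X3 \<longleftrightarrow> i \<prec> num 3"
proof -
  have "i \<prec> num 3 \<longleftrightarrow> i = num 0 \<or> i = num 1 \<or> i = num 2"
    unfolding less_num numeral_3_eq_3 less_Suc_eq numeral_2_eq_2 One_nat_def by (metis not_less0)
  then show ?thesis by (simp add: X3_def)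
qed

lemma X3_Sets: "X3 \<in> Sets" and X3_fin: "fin_set X3"
proof -
  have "X3 = {i. i \<prec> num 3}" using X3_iff by auto
  moreover have "{i. i \<prec> num 3} \<in> Sets" by (intro dec_Sets recs)
  ultimately show "X3 \<in> Sets" "fin_set X3" using fin_set_less by simp_all
qed

lemma X3_card: "cardinality X3 = num 3"
  by (rule cardinality_eq, rule has_cardI[OF recf_id]) (auto simp: X3_iff)

lemma W3_Sets: "W3 \<in> Sets" and W3_fin: "fin_set W3"
  using weak_orders_Sets weak_orders_fin X3_Sets X3_fin by auto

lemma Perm_Sets:
  assumes W: "W \<in> Sets" "fin_set W"
  shows "Perm W \<in> Sets"
proof -
  obtain b where b: "\<And>r. r \<in> W \<Longrightarrow> r \<prec> b" using W(2) unfolding fin_set_def by metis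
  have "p \<in> Perm W \<longleftrightarrow> enumerates W p (cardinality W) b" for p
  proof
    assume p: "p \<in> Perm W"
    show "enumerates W p (cardinality W) b"
      unfolding enumerates_def using PermD[OF p] b by simp
  next
    assume "enumerates W p (cardinality W) b"
    then have p: "is_seq p (cardinality W)" "\<And>i. i \<prec> cardinality W \<Longrightarrow> entry p i \<in> W"
        "\<And>r. r \<in> W \<Longrightarrow> \<exists>!i. i \<prec> cardinality W \<and> entry p i = r"
      using b unfolding enumerates_def by auto
    show "p \<in> Perm W" unfolding Perm_iff lh_eq[OF p(1)] using p by simp
  qed
  then have "dec (\<lambda>p. p \<in> Perm W)"
    using dec_enumerates[OF W(1) recf_id recf_const recf_const] by simp
  then show ?thesis using dec_Sets by fastforce
qed

lemma QPart_iff: "s \<in> QPart k \<longleftrightarrow> (\<exists>l. l \<preceq> k \<and> \<one> \<preceq> l \<and> is_seq s l)"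
  unfolding QPart_def using is_seq_lh is_seq_Seq lh_eq by auto

lemma QPart_Sets: "QPart k \<in> Sets"
proof -
  have "dec (\<lambda>s. s \<in> QPart k)" unfolding QPart_iff by (intro recs)
  then show ?thesis using dec_Sets by fastforce
qed

lemma PQ3_Sets: "PQ3 \<in> Sets"
  by (intro pprod_Sets Perm_Sets QPart_Sets W3_Sets W3_fin)

text \<open>
  For a voter lying in exactly the sets \<open>A\<^sub>k\<close> with \<open>k \<in> S\<close>, \<open>in_cell S s i\<close> says that the voter
  belongs to the \<open>i\<close>-th cell of \<open>s\<close>, and \<open>chosen S s i\<close> that the \<open>i\<close>-th order of the permutation is
  assigned to the voter.
\<close>

definition in_cell :: "'a set \<Rightarrow> 'a \<Rightarrow> 'a \<Rightarrow> bool" where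
  "in_cell S s i \<longleftrightarrow> i \<oplus> \<one> \<prec> lh s \<and> entry s i \<in> S"

definition chosen :: "'a set \<Rightarrow> 'a \<Rightarrow> 'a \<Rightarrow> bool" where
  "chosen S s i \<longleftrightarrow> (if \<exists>!i. in_cell S s i then in_cell S s i else i \<oplus> \<one> = lh s)"

definition default_order :: 'a where
  "default_order = (SOME r. r \<in> W3)"

text \<open>Profile indices are the pairs of a permutation and a quasi-partition themselves, so that
  the identity can serve as embedding; other indices give a constant profile. A voter enters only
  through the set \<open>S\<close> of indices of sets containing it, so profiles can be evaluated
  while the algebra is still being defined.\<close>

definition assigned :: "'a set \<Rightarrow> 'a \<Rightarrow> 'a \<Rightarrow> bool" where
  "assigned S n r \<longleftrightarrow> (if n \<in> PQ3 then \<exists>i. chosen S (p2 n) i \<and> r = entry (p1 n) i else r = default_order)"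

lemma default_order: "default_order \<in> W3"
proof -
  have "\<exists>r. r \<in> W3"
  proof (rule weak_order_ex[OF X3_Sets X3_fin, where P = "\<lambda>x y. True"])
    show "dec (\<lambda>z. True)" by (rule dec_const)
  qed auto
  then show ?thesis unfolding default_order_def by (rule someI_ex)
qed

lemma chosen_unique:
  assumes "s \<in> QPart k"
  shows "\<exists>!i. chosen S s i" "chosen S s i \<Longrightarrow> i \<prec> lh s"
proof -
  obtain l where l: "l \<preceq> k" "\<one> \<preceq> l" "is_seq s l" using assms unfolding QPart_iff by metis
  then obtain l' where l': "lh s = l' \<oplus> \<one>" using lh_eq[OF l(3)] zero_or_succ[of l] ar.not_one_le_zero by metis
  show "\<exists>!i. chosen S s i"
    unfolding chosen_def by (cases "\<exists>!i. in_cell S s i") (simp_all add: l')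
  have "in_cell S s i \<Longrightarrow> i \<prec> lh s" unfolding in_cell_def using less_succ ar.less_trans by metis
  moreover have "i \<oplus> \<one> = lh s \<Longrightarrow> i \<prec> lh s" using less_succ[of i i] by auto
  ultimately show "chosen S s i \<Longrightarrow> i \<prec> lh s" unfolding chosen_def by (auto split: if_splits)
qed

lemma assigned_unique: "\<exists>!r. assigned S n r"
proof (cases "n \<in> PQ3")
  case True
  then have "p2 n \<in> QPart N3" unfolding pprod_def by auto
  from chosen_unique(1)[OF this] obtain i where "chosen S (p2 n) i" "\<And>j. chosen S (p2 n) j \<Longrightarrow> j = i" by metis
  then have "assigned S n r \<longleftrightarrow> r = entry (p1 n) i" for r unfolding assigned_def using True by metis
  then show ?thesis by simp
qed (simp add: assigned_def)

lemma assigned_in: "assigned S n r \<Longrightarrow> r \<in> W3"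
proof (cases "n \<in> PQ3")
  case True
  assume "assigned S n r"
  then obtain i where i: "chosen S (p2 n) i" "r = entry (p1 n) i" using True unfolding assigned_def by auto
  have n: "p1 n \<in> Perm W3" "p2 n \<in> QPart N3" using True unfolding pprod_def by auto
  have "i \<prec> lh (p2 n)" using chosen_unique(2)[OF n(2) i(1)] .
  moreover have "lh (p2 n) \<preceq> N3" using n(2) unfolding QPart_def by simp
  ultimately have "i \<prec> N3" by (rule ar.less_le_trans)
  then show ?thesis using PermD(3)[OF n(1)] i(2) by simp
qed (simp add: assigned_def default_order)

lemma chosen_cong:
  assumes s: "s \<in> QPart l" and "\<And>j. j \<prec> s \<Longrightarrow> j \<in> S \<longleftrightarrow> j \<in> S'"
  shows "chosen S s i \<longleftrightarrow> chosen S' s i"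
proof -
  have "in_cell S s i \<longleftrightarrow> in_cell S' s i" for i
  proof (cases "i \<oplus> \<one> \<prec> lh s")
    case True
    then have "i \<prec> lh s" using less_succ ar.less_trans by metis
    moreover have "is_seq s (lh s)" using s is_seq_lh unfolding QPart_def by simp
    ultimately have "entry s i \<prec> s" by (intro entry_less)
    then show ?thesis using assms(2) unfolding in_cell_def by simp
  qed (simp add: in_cell_def)
  then have "in_cell S s = in_cell S' s" by (intro ext)
  then show ?thesis unfolding chosen_def by simp
qed

lemma p2_le: "p2 n \<preceq> n" and p1_le: "p1 n \<preceq> n"
proof -
  have "p2 n \<preceq> n \<and> p1 n \<preceq> n"
  proof (cases "\<exists>a b. n = pair a b")
    case True
    then show ?thesis using pair_le1 pair_le2 by auto
  qed (simp add: p1_def p2_def)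
  then show "p2 n \<preceq> n" "p1 n \<preceq> n" by auto
qed

text \<open>Only sets indexed by entries of the quasi-partition are consulted, and these entries are
  smaller than its code, hence smaller than \<open>n\<close>. This is the locality required by the
  recursion.\<close>

lemma assigned_cong:
  assumes "\<And>j. j \<prec> n \<Longrightarrow> j \<in> S \<longleftrightarrow> j \<in> S'"
  shows "assigned S n r \<longleftrightarrow> assigned S' n r"
proof (cases "n \<in> PQ3")
  case True
  have "p2 n \<in> QPart N3" using True unfolding pprod_def by auto
  then have "chosen S (p2 n) i \<longleftrightarrow> chosen S' (p2 n) i" for i
    by (rule chosen_cong) (use assms ar.less_le_trans[OF _ p2_le] in auto)
  then show ?thesis unfolding assigned_def by simp
qed (simp add: assigned_def)

definition cell_bounded :: "'a set \<Rightarrow> 'a \<Rightarrow> 'a \<Rightarrow> 'a \<Rightarrow> bool" where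
  "cell_bounded S s l i \<longleftrightarrow> i \<oplus> \<one> \<prec> l \<and> (\<exists>y. y \<prec> s \<and> pair i y \<in> elems s \<and> y \<in> S)"

text \<open>Length and entries, given by definite descriptions, are replaced by bounded witnesses,
  so that decidability can be read off.\<close>

lemma assigned_bounded: "assigned S n r \<longleftrightarrow>
  n \<in> PQ3 \<and> (\<exists>l. l \<preceq> N3 \<and> is_seq (p2 n) l \<and> (\<exists>i. i \<prec> l \<and> pair i r \<in> elems (p1 n) \<and>
    (cell_bounded S (p2 n) l i \<and> (\<forall>j. j \<prec> l \<longrightarrow> cell_bounded S (p2 n) l j \<longrightarrow> j = i) \<or>
     \<not> (\<exists>j. j \<prec> l \<and> cell_bounded S (p2 n) l j \<and> (\<forall>j'. j' \<prec> l \<longrightarrow> cell_bounded S (p2 n) l j' \<longrightarrow> j' = j)) \<and> i \<oplus> \<one> = l))) \<or>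
  n \<notin> PQ3 \<and> r = default_order"
proof (cases "n \<in> PQ3")
  case True
  let ?s = "p2 n"
  have n: "p1 n \<in> Perm W3" "?s \<in> QPart N3" using True unfolding pprod_def by auto
  have s: "is_seq ?s (lh ?s)" "lh ?s \<preceq> N3" using n(2) is_seq_lh unfolding QPart_def by auto
  have less: "i \<prec> lh ?s" if "i \<oplus> \<one> \<prec> lh ?s" for i using that less_succ ar.less_trans by metis
  have cell: "cell_bounded S ?s (lh ?s) i \<longleftrightarrow> in_cell S ?s i" for i
  proof (cases "i \<oplus> \<one> \<prec> lh ?s")
    case True
    then show ?thesis unfolding cell_bounded_def in_cell_def
      using entry_iff[OF s(1) less[OF True]] entry_less[OF s(1) less[OF True]] by auto
  qed (simp add: cell_bounded_def in_cell_def)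
  have in_less: "in_cell S ?s i \<Longrightarrow> i \<prec> lh ?s" for i using less unfolding in_cell_def by simp
  have ch: "chosen S ?s i \<longleftrightarrow> (in_cell S ?s i \<and> (\<forall>j. j \<prec> lh ?s \<longrightarrow> in_cell S ?s j \<longrightarrow> j = i) \<or>
     \<not> (\<exists>j. j \<prec> lh ?s \<and> in_cell S ?s j \<and> (\<forall>j'. j' \<prec> lh ?s \<longrightarrow> in_cell S ?s j' \<longrightarrow> j' = j)) \<and> i \<oplus> \<one> = lh ?s)" for i
  proof -
    have a: "(\<forall>j. j \<prec> lh ?s \<longrightarrow> in_cell S ?s j \<longrightarrow> j = i) \<longleftrightarrow> (\<forall>j. in_cell S ?s j \<longrightarrow> j = i)" for i
      using in_less by blast
    have b: "(\<exists>!i. in_cell S ?s i) \<longleftrightarrow>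
        (\<exists>j. j \<prec> lh ?s \<and> in_cell S ?s j \<and> (\<forall>j'. in_cell S ?s j' \<longrightarrow> j' = j))"
      unfolding Ex1_def using in_less by blast
    show ?thesis
    proof (cases "\<exists>!i. in_cell S ?s i")
      case True
      then show ?thesis unfolding a chosen_def b[symmetric] by (simp only: if_True) blast
    next
      case False
      then have "\<not> (in_cell S ?s i \<and> (\<forall>j. in_cell S ?s j \<longrightarrow> j = i))" by blast
      with False show ?thesis unfolding a chosen_def b[symmetric] by (simp only: if_False) blast
    qed
  qed
  have l: "is_seq ?s l \<longleftrightarrow> l = lh ?s" for l using s(1) is_seq_unique by metis
  have e: "pair i r \<in> elems (p1 n) \<longleftrightarrow> r = entry (p1 n) i" if "i \<prec> lh ?s" for i
    using entry_iff[OF PermD(1)[OF n(1)]] ar.less_le_trans[OF that s(2)] by simp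
  have "assigned S n r \<longleftrightarrow> (\<exists>i. i \<prec> lh ?s \<and> pair i r \<in> elems (p1 n) \<and> chosen S ?s i)"
    unfolding assigned_def using True e chosen_unique(2)[OF n(2)] by auto
  then show ?thesis using True s(2) unfolding l cell[symmetric] ch by (simp add: cell)
qed (simp add: assigned_def)

lemma dec_assigned:
  assumes S: "\<And>g h. \<lbrakk>recf g; recf h\<rbrakk> \<Longrightarrow> dec (\<lambda>x. h x \<in> S (g x))"
    and r: "recf f" "recf g" "recf h"
  shows "dec (\<lambda>x. assigned (S (g x)) (f x) (h x))"
proof -
  have c: "dec (\<lambda>x. cell_bounded (S (k1 x)) (k2 x) (k3 x) (k4 x))" if k: "recf k1" "recf k2" "recf k3" "recf k4" for k1 k2 k3 k4
    unfolding cell_bounded_def by (intro recs S k k[THEN recf_comp_p1])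
  show ?thesis
    unfolding assigned_bounded
    by (intro c recs r r[THEN recf_comp_p1] PQ3_Sets)
qed

lemma dec_assigned_elems:
  "\<lbrakk>recf f; recf g; recf h\<rbrakk> \<Longrightarrow> dec (\<lambda>x. assigned (elems (g x)) (f x) (h x))"
  by (rule dec_assigned[where S = elems]) (intro recs)

text \<open>
  The number \<open>k = (t, w)\<close> indexes, according to its tag \<open>t\<close>: a singleton, a final segment, the
  stages at which \<open>w\<close> has entered the projection of \<open>R\<close>, a union, a complement, or the set of
  voters weakly preferring \<open>y\<close> to \<open>x\<close> under the \<open>n\<close>-th profile, where \<open>w = (n, (x, y))\<close>.  Indices occurring
  in \<open>w\<close> are less than \<open>k\<close>, so this is a course-of-values recursion.
\<close>

definition clause :: "'a set \<Rightarrow> 'a \<Rightarrow> 'a \<Rightarrow> 'a set \<Rightarrow> bool" where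
  "clause R v k S \<longleftrightarrow>
     p1 k = num 1 \<and> v = p2 k \<or>
     p1 k = num 2 \<and> p2 k \<preceq> v \<or>
     p1 k = num 3 \<and> (\<exists>y. y \<preceq> v \<and> pair (p2 k) y \<in> R) \<or>
     p1 k = num 4 \<and> (p1 (p2 k) \<in> S \<or> p2 (p2 k) \<in> S) \<or>
     p1 k = num 5 \<and> p2 k \<notin> S \<or>
     p1 k = num 6 \<and> (\<exists>r\<in>W3. assigned S (p1 (p2 k)) r \<and> wle r (p1 (p2 (p2 k))) (p2 (p2 (p2 k))))"

lemma dec_clause:
  assumes "R \<in> Sets"
  shows "dec (\<lambda>z. clause R (p1 z) (p1 (p2 z)) (elems (p2 (p2 z))))"
  unfolding clause_def by (intro recs dec_assigned_elems assms W3_Sets W3_fin)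

text \<open>A positive tag excludes the default value of \<open>p1\<close>, so \<open>k\<close> is a
  genuine pair, and a pair with positive first component exceeds its second. This is why tags start
  at one.\<close>

lemma p2_less: "p1 k = num (Suc t) \<Longrightarrow> p2 k \<prec> k"
proof -
  assume t: "p1 k = num (Suc t)"
  have "k = pair (p1 k) (p2 k)"
  proof (rule ccontr)
    assume "k \<noteq> pair (p1 k) (p2 k)"
    then have "p1 k = \<zero>" by (auto simp: p1_def)
    then show False using t succ_nonzero by simp
  qed
  moreover have "\<zero> \<prec> p1 k" using num_less[of 0 "Suc t"] t by simp
  ultimately show ?thesis using pair_less2 by metis
qed

lemma clause_cong:
  assumes "\<And>j. j \<prec> k \<Longrightarrow> j \<in> S \<longleftrightarrow> j \<in> S'"
  shows "clause R v k S = clause R v k S'"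
proof (cases "\<exists>t. p1 k = num (Suc t)")
  case True
  then have k: "p2 k \<prec> k" using p2_less by metis
  then have k1: "p1 (p2 k) \<prec> k" and k2: "p2 (p2 k) \<prec> k"
    using ar.le_less_trans[OF p1_le] ar.le_less_trans[OF p2_le] by metis+
  have "assigned S (p1 (p2 k)) r \<longleftrightarrow> assigned S' (p1 (p2 k)) r" for r
    by (rule assigned_cong) (use assms ar.less_trans[OF _ k1] in simp)
  then show ?thesis unfolding clause_def using assms[OF k] assms[OF k1] assms[OF k2] by simp
next
  case False
  have "p1 k \<noteq> num 1" "p1 k \<noteq> num 2" "p1 k \<noteq> num 3" "p1 k \<noteq> num 4" "p1 k \<noteq> num 5" "p1 k \<noteq> num 6"
    using False by (metis One_nat_def, metis numeral_2_eq_2, metis numeral_3_eq_3, metis eval_nat_numeral(2) semiring_norm(26), metis eval_nat_numeral(3), metis eval_nat_numeral(2) semiring_norm(26))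
  then show ?thesis unfolding clause_def by simp
qed

lemma projection_society:
  assumes R: "R \<in> Sets"
  obtains A F where "society UNIV X3 A F"
    "\<And>c. sect A (pair (num 2) c) = {v. c \<preceq> v}"
    "\<And>n. sect A (pair (num 3) n) = {v. \<exists>y. y \<preceq> v \<and> pair n y \<in> R}"
proof -
  obtain A where A: "A \<in> Sets" "\<And>k v. pair k v \<in> A \<longleftrightarrow> clause R v k {j. pair j v \<in> A}"
    using course_of_values[of "clause R", OF dec_clause[OF R] clause_cong] by metis
  define row where "row v = {j. pair j v \<in> A}" for v
  have sect: "v \<in> sect A k \<longleftrightarrow> clause R v k (row v)" for v k
    unfolding sect_def row_def mem_Collect_eq by (rule A(2))
  have row: "j \<in> row v \<longleftrightarrow> v \<in> sect A j" for j v unfolding row_def sect_def by simp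
  have s1: "sect A (pair (num 1) c) = {c}" for c
    unfolding set_eq_iff sect clause_def p1_pair p2_pair num_inject by simp
  have s2: "sect A (pair (num 2) c) = {v. c \<preceq> v}" for c
    unfolding set_eq_iff sect clause_def p1_pair p2_pair num_inject by simp
  have s3: "sect A (pair (num 3) n) = {v. \<exists>y. y \<preceq> v \<and> pair n y \<in> R}" for n
    unfolding set_eq_iff sect clause_def p1_pair p2_pair num_inject by simp
  have s4: "sect A (pair (num 4) (pair m n)) = sect A m \<union> sect A n" for m n
    unfolding set_eq_iff Un_iff sect[of _ "pair (num 4) _"] clause_def p1_pair p2_pair num_inject row by simp
  have s5: "sect A (pair (num 5) n) = UNIV - sect A n" for n
    unfolding set_eq_iff Diff_iff sect[of _ "pair (num 5) _"] clause_def p1_pair p2_pair num_inject row by simp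
  have s6: "v \<in> sect A (pair (num 6) (pair n (pair x y))) \<longleftrightarrow> (\<exists>r\<in>W3. assigned (row v) n r \<and> wle r x y)" for v n x y
    unfolding sect[of _ "pair (num 6) _"] clause_def p1_pair p2_pair num_inject by simp
  \<comment> \<open>Profiles are evaluated on the completed rows by the same relation that tag 6
    uses. Prefixing that tag therefore witnesses measurability.\<close>
  define F where "F = {z. z \<in> pprod UNIV (pprod UNIV W3) \<and> assigned (row (p1 (p2 z))) (p1 z) (p2 (p2 z))}"
  have dec_row: "dec (\<lambda>x. h x \<in> row (g x))" if "recf g" "recf h" for g h
    unfolding row_def mem_Collect_eq by (intro recs that A(1))
  have F_Sets: "F \<in> Sets"
    unfolding F_def
    by (intro dec_Sets dec_conj dec_mem pprod_Sets UNIV_Sets W3_Sets dec_assigned[where S = row] dec_row recf_p1 recf_p2 recf_id)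
  have F: "pair v r \<in> sect F n \<longleftrightarrow> assigned (row v) n r" for n v r
    using assigned_in[of "row v" n r] unfolding sect_def F_def by auto
  have fun_F: "is_fun (sect F n) UNIV W3" for n
    unfolding is_fun_def
  proof (intro conjI ballI)
    show "sect F n \<subseteq> pprod UNIV W3" unfolding sect_def F_def by auto
    show "\<exists>!r. pair v r \<in> sect F n" for v unfolding F by (rule assigned_unique)
  qed
  have prof: "assigned (row v) n r \<longleftrightarrow> r = prof_at F n v" for n v r
    unfolding prof_at_def using app_eq[OF fun_F UNIV_I, of v r n] F by metis
  have alg: "countable_algebra UNIV A"
    unfolding countable_algebra_def
  proof (intro conjI allI)
    have "sect A (pair (num 2) \<zero>) = UNIV" unfolding s2 using zero_le by blast
    then show "\<exists>n. sect A n = UNIV" by metis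
    show "\<exists>k. sect A k = sect A m \<union> sect A n" for m n using s4 by metis
    show "\<exists>k. sect A k = UNIV - sect A n" for n using s5 by metis
    have "sect A m \<inter> sect A n = UNIV - ((UNIV - sect A m) \<union> (UNIV - sect A n))" for m n by auto
    then show "\<exists>k. sect A k = sect A m \<inter> sect A n" for m n using s4 s5 by metis
  qed simp
  have meas: "uniformly_measurable UNIV X3 A F"
    unfolding uniformly_measurable_def
  proof (intro bexI conjI allI ballI)
    let ?B = "pprod UNIV (pprod X3 X3)" and ?f = "\<lambda>z. pair (num 6) z"
    let ?\<mu> = "{z. z \<in> graph ?f \<and> p1 z \<in> ?B}"
    show "?\<mu> \<in> Sets" by (intro graph_restrict_Sets recs pprod_Sets UNIV_Sets X3_Sets)
    show "is_fun ?\<mu> ?B UNIV" by (rule graph_is_fun) simp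
    fix n x y v assume xy: "x \<in> X3" "y \<in> X3"
    have "app ?\<mu> (pair n (pair x y)) = pair (num 6) (pair n (pair x y))"
      by (rule graph_is_fun(2)[where C = UNIV]) (use xy in auto)
    then show "wle (prof_at F n v) x y \<longleftrightarrow> v \<in> sect A (app ?\<mu> (pair n (pair x y)))"
      using s6[of v n x y] assigned_in[of "row v" n "prof_at F n v"] unfolding prof by auto
  qed
  have emb: "qp_embedded UNIV X3 A F"
    unfolding qp_embedded_def Let_def
  proof (intro bexI conjI ballI)
    let ?e = "{z. z \<in> graph (\<lambda>z. z) \<and> p1 z \<in> PQ3}"
    show "?e \<in> Sets" by (intro graph_restrict_Sets recs PQ3_Sets)
    show "is_fun ?e PQ3 UNIV" by (rule graph_is_fun) simp
    fix p s v assume ps: "p \<in> Perm W3" "s \<in> QPart N3"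
    have e: "app ?e (pair p s) = pair p s"
      by (rule graph_is_fun(2)[where C = UNIV]) (use ps in auto)
    have cell: "cell A s v = in_cell (row v) s"
      by (intro ext) (simp add: cell_def in_cell_def row)
    have as: "assigned (row v) (pair p s) (entry p i)" if "chosen (row v) s i" for i
      unfolding assigned_def using that ps by auto
    show "(\<exists>!i. cell A s v i) \<longrightarrow> (\<forall>i. cell A s v i \<longrightarrow> prof_at F (app ?e (pair p s)) v = entry p i)"
      unfolding cell e using as[unfolded prof] unfolding chosen_def by simp
    show "\<not> (\<exists>!i. cell A s v i) \<longrightarrow> (\<forall>l. l \<oplus> \<one> = lh s \<longrightarrow> prof_at F (app ?e (pair p s)) v = entry p l)"
      unfolding cell e using as[unfolded prof] unfolding chosen_def by simp
  qed
  have "atomic UNIV A" unfolding atomic_def using s1 by metis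
  then have "society UNIV X3 A F"
    unfolding society_def profile_def
    using UNIV_Sets X3_Sets A(1) F_Sets X3_fin X3_card alg fun_F meas emb by simp
  then show thesis using s2 s3 by (rule that)
qed

lemma FPT_imp_ACA:
  assumes FPT
  shows ACA
proof (rule ACA_if_projections)
  fix R assume "R \<in> Sets"
  then obtain A F where soc: "society UNIV X3 A F"
    and J: "\<And>c. sect A (pair (num 2) c) = {v. c \<preceq> v}"
    and B: "\<And>n. sect A (pair (num 3) n) = {v. \<exists>y. y \<preceq> v \<and> pair n y \<in> R}"
    by (rule projection_society) (rule that; assumption)
  have "\<not> fin_set UNIV" unfolding fin_set_def using less_irrefl by auto
  then obtain \<sigma> where \<sigma>: "swf UNIV X3 F \<sigma>" "non_dictatorial UNIV X3 F \<sigma>"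
    using assms soc unfolding FPT_def possibility_def by metis
  interpret arrow M UNIV X3 A F \<sigma>
    by (intro arrow.intro countable_societyI soc arrow_axioms.intro \<sigma>(1))
  let ?a = "num 0" and ?b = "num 1" and ?c = "num 2"
  have t: "triple ?a ?b ?c" unfolding triple_def unfolding X3_def num_inject by simp
  have X: "?a \<in> X3" "?b \<in> X3" by (simp_all add: X3_def)
  note o = ord_triple[OF t]
  have "ord ?a ?b 0 1 2 \<noteq> ord ?a ?b 1 0 2" using o(1)[of 0 1 2] o(1)[of 1 0 2] by auto
  from two_cell_index[OF ord(1) ord(1) this] obtain jj where jj: "recf jj"
    "\<And>k v. prof_at F (jj k) v = (if v \<in> sect A k then ord ?a ?b 0 1 2 else ord ?a ?b 1 0 2)"
    by (metis UNIV_I)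
  have lt: "wlt (ord ?a ?b 0 1 2) ?a ?b" "wlt (ord ?a ?b 1 0 2) ?b ?a"
    unfolding wlt_def o by simp_all
  have supp: "supports (sect A k) ?a ?b (jj k)" for k
    unfolding supports_def jj(2) using lt by simp
  \<comment> \<open>\<open>U\<close> tests a coalition on one pair and one profile. Being decidable,
    it can be proved by induction for all final segments, including those from nonstandard starting
    points.\<close>
  define U where "U k \<longleftrightarrow> wlt (app \<sigma> (jj k)) ?a ?b" for k
  have U: "dec (\<lambda>x. U (f x))" if "recf f" for f
    unfolding U_def by (intro recs recf_app[OF \<sigma>_Sets \<sigma>_fun] recf_comp[OF jj(1)] that UNIV_I)
  \<comment> \<open>The verdict depends on the coalition and not on its index. This is needed
    because the same final segment occurs under tag 2 and under tag 3.\<close>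
  have U_cong: "U k \<longleftrightarrow> U k'" if "sect A k = sect A k'" for k k'
    using supports_independent[OF X supp[of k] supp[of k', folded that]] unfolding U_def wlt_def by simp
  have U_J: "U (pair (num 2) i)" for i
  proof (rule dec_induct[where P = "\<lambda>i. U (pair (num 2) i)"])
    show "dec (\<lambda>i. U (pair (num 2) i))" by (intro U recs)
    show "U (pair (num 2) \<zero>)"
      unfolding U_def
      by (rule unanimity[OF X]) (use supp[of "pair (num 2) \<zero>"] in \<open>simp add: supports_def J\<close>)
    fix i assume IH: "U (pair (num 2) i)"
    have "sect A (pair (num 2) (i \<oplus> \<one>)) = sect A (pair (num 2) i) - {i}"
      unfolding J succ_le_iff unfolding le_def using less_irrefl by auto
    then have s: "supports (sect A (pair (num 2) i) - {i}) ?a ?b (jj (pair (num 2) (i \<oplus> \<one>)))"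
      using supp[of "pair (num 2) (i \<oplus> \<one>)"] by simp
    show "U (pair (num 2) (i \<oplus> \<one>))"
      unfolding U_def
      by (rule remove_voter[OF t \<sigma>(2) alg_sect _ supp IH[unfolded U_def] s]) (simp add: J)
  qed
  \<comment> \<open>If there is a least witness, the coalition is the final segment from it and
    prevails. If there is none, the coalition is empty and unanimity decides against it.\<close>
  have "U (pair (num 3) n) \<longleftrightarrow> (\<exists>y. pair n y \<in> R)" for n
  proof (cases "\<exists>y. pair n y \<in> R")
    case True
    have "dec (\<lambda>y. pair n y \<in> R)" using \<open>R \<in> Sets\<close> by (intro recs)
    then obtain y where y: "pair n y \<in> R" "\<And>y'. pair n y' \<in> R \<Longrightarrow> y \<preceq> y'"
      using True dec_least by metis
    have "sect A (pair (num 3) n) = sect A (pair (num 2) y)"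
      unfolding J B using y ar.order_trans by blast
    then show ?thesis using U_J[of y] U_cong True by metis
  next
    case False
    then have "sect A (pair (num 3) n) = {}" unfolding B by simp
    then have "wlt (app \<sigma> (jj (pair (num 3) n))) ?b ?a"
      using supp[of "pair (num 3) n"] by (intro unanimity X) (simp add: supports_def)
    then show ?thesis using False unfolding U_def wlt_def by simp
  qed
  then show "{x. \<exists>y. pair x y \<in> R} \<in> Sets"
    using dec_Sets[OF U, of "\<lambda>n. pair (num 3) n"] by (simp add: recs)
qed

end

theorem theorem5p4:
  fixes M :: "'a l2_structure"
  assumes "RCA0 M"
  shows "(l2.FPT M \<longleftrightarrow> l2.ACA M) \<and>
         (\<forall>k\<ge>1. l2.FPT_k M k \<longleftrightarrow> l2.ACA M) \<and>
         (l2.FPT_fin M \<longleftrightarrow> l2.ACA M) \<and>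
         (l2.FPT_plus M \<longleftrightarrow> l2.ACA M)"
proof -
  interpret RCA0 M by (rule assms)
  show ?thesis
    using ACA_imp_FPT_plus ACA_imp_FPT_fin FPT_fin_imp_FPT_k FPT_k_imp_FPT FPT_plus_imp_FPT FPT_imp_ACA
    by (metis order_refl)
qed

end
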